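(* (a) Let $(F,g_F)$ be a Riemannian $n$-manifold, $J\subset\mathbb{R}$ an interval, $h:J\to(0,\infty)$ smooth, and let $M=J\times F$ with the metric $g=d\rho^2+h(\rho)^2g_F$. Let $\Phi:I\times\Sigma\to M$ be a smooth family of two-sided minimal immersions $\Phi_a=\Phi(a,\cdot):\Sigma\to\{\rho\le r(a)\}$ with $\Phi_a(\partial\Sigma)\subset\{\rho=r(a)\}$, meeting $\{\rho=r(a)\}$ orthogonally with $\eta=\partial_\rho$ along $\partial\Sigma$, where $r:I\to J$ is smooth. Then, with $\varphi_a=\langle\partial_a\Phi_a,\nu_a\rangle$, for every $a\in I$, $$\partial_\eta\varphi_a-\frac{h'(r(a))}{h(r(a))}\,\varphi_a=r'(a)\,A_a(\eta,\eta)\qquad\text{on }\partial\Sigma .$$ (b) The same conclusion holds when $F=\mathbb{S}^n$ is the round unit sphere, $h$ is smooth and positive on $(0,r_0)$ and extends to a smooth odd function with $h'(0)=1$, so that $g=d\rho^2+h(\rho)^2g_{\mathbb{S}^n}$ closes up smoothly at a point $p_0$ to a metric on a ball $B(r_0)$, and $\Phi_a$ is a smooth family of free boundary minimal immersions in the geodesic balls $\{\rho\le r(a)\}$ centred at $p_0$, with $r:I\to(0,r_0)$ smooth.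
   Context: $I\subset\mathbb{R}$ is an interval and $\Sigma$ is a compact $n$-manifold with boundary each of whose connected components has nonempty boundary. $\nu_a$ is a unit normal of $\Phi_a$ chosen smoothly in $a$, $\eta$ is the outward unit conormal of $\partial\Sigma$ in $\Sigma$ for the metric induced by $\Phi_a$, and $A_a(X,Y)=\langle\overline\nabla_X\nu_a,Y\rangle$ with $\overline\nabla$ the Levi-Civita connection of the ambient metric. In (b), $\rho$ is the distance from $p_0$, and "free boundary" means $\Phi_a(\partial\Sigma)\subset\{\rho=r(a)\}$ with $\eta=\partial_\rho$ along $\partial\Sigma$. *)

theory Defs
  imports "HOL-Analysis.Analysis"
begin

section \<open>Smooth functions on subsets of Euclidean spaces\<close>

primrec Ck_on :: "nat \<Rightarrow> 'a::euclidean_space set \<Rightarrow> ('a \<Rightarrow> 'b::real_normed_vector) \<Rightarrow> bool" where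
  "Ck_on 0 U f \<longleftrightarrow> continuous_on U f"
| "Ck_on (Suc k) U f \<longleftrightarrow> (\<forall>x\<in>U. f differentiable (at x)) \<and>
     (\<forall>v. Ck_on k U (\<lambda>x. frechet_derivative f (at x) v))"

text \<open>On a set that need not be open, smooth means locally the restriction of a smooth function on
  an open set; this covers one-sided smoothness at end points and up to the boundary.\<close>

definition smooth_on :: "'a::euclidean_space set \<Rightarrow> ('a \<Rightarrow> 'b::real_normed_vector) \<Rightarrow> bool" where
  "smooth_on S f \<longleftrightarrow> (\<forall>x\<in>S. \<exists>U g. open U \<and> x \<in> U \<and> (\<forall>k. Ck_on k U g) \<and> (\<forall>y\<in>S \<inter> U. f y = g y))"

text \<open>The derivative within a set.  It is used only on sets that are open in all of Euclidean space,
  in a half-space, or in the product of an interval with one of these, where it is unique.\<close>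

definition D :: "'a::euclidean_space set \<Rightarrow> ('a \<Rightarrow> 'b::real_normed_vector) \<Rightarrow> 'a \<Rightarrow> 'a \<Rightarrow> 'b" where
  "D S f x u = frechet_derivative f (at x within S) u"

abbreviation ddt :: "real set \<Rightarrow> (real \<Rightarrow> 'b::real_normed_vector) \<Rightarrow> real \<Rightarrow> 'b" where
  "ddt I f t \<equiv> vector_derivative f (at t within I)"

definition proper_interval :: "real set \<Rightarrow> bool" where
  "proper_interval I \<longleftrightarrow> is_interval I \<and> interior I \<noteq> {}"


section \<open>Smooth manifolds\<close>

type_synonym ('m, 'e) chart = "'m set \<times> ('m \<Rightarrow> 'e)"

abbreviation cinv :: "('m, 'e) chart \<Rightarrow> 'e \<Rightarrow> 'm" where
  "cinv c \<equiv> inv_into (fst c) (snd c)"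

definition carrier :: "('m, 'e) chart set \<Rightarrow> 'm set" where
  "carrier A = (\<Union>c\<in>A. fst c)"

definition charts_at :: "('m, 'e) chart set \<Rightarrow> 'm \<Rightarrow> ('m, 'e) chart set" where
  "charts_at A p = {c \<in> A. p \<in> fst c}"

definition chart_at :: "('m, 'e) chart set \<Rightarrow> 'm \<Rightarrow> ('m, 'e) chart" where
  "chart_at A p = (SOME c. c \<in> charts_at A p)"

text \<open>\<open>A\<close> is a smooth atlas of \<open>M\<close> with charts onto relatively open subsets of the model
  region \<open>R\<close>: \<open>R = UNIV\<close> gives manifolds without boundary, a half-space gives manifolds
  with boundary.\<close>

definition smooth_atlas ::
  "'e::euclidean_space set \<Rightarrow> 'm::topological_space set \<Rightarrow> ('m, 'e) chart set \<Rightarrow> bool" where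
  "smooth_atlas R M A \<longleftrightarrow> carrier A = M \<and>
     (\<forall>c\<in>A. openin (top_of_set M) (fst c) \<and> openin (top_of_set R) (snd c ` fst c) \<and>
        homeomorphism (fst c) (snd c ` fst c) (snd c) (cinv c)) \<and>
     (\<forall>c\<in>A. \<forall>d\<in>A. smooth_on (snd c ` (fst c \<inter> fst d)) (snd d \<circ> cinv c))"

definition bdir :: "'e::euclidean_space" where
  "bdir = (SOME b. b \<in> Basis)"

definition half_space :: "'e::euclidean_space set" where
  "half_space = {y. 0 \<le> y \<bullet> bdir}"

definition bdry :: "('m, 'e::euclidean_space) chart set \<Rightarrow> 'm set" where
  "bdry A = {x. \<exists>c\<in>charts_at A x. snd c x \<bullet> bdir = 0}"

text \<open>The product of an interval with a manifold.\<close>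

definition cyl :: "real set \<Rightarrow> ('m, 'e) chart set \<Rightarrow> (real \<times> 'm, real \<times> 'e) chart set" where
  "cyl I A = (\<lambda>c. (I \<times> fst c, \<lambda>q. (fst q, snd c (snd q)))) ` A"


section \<open>Tangent vectors and smooth maps\<close>

text \<open>A tangent vector at \<open>p\<close> is given by its components in all charts at \<open>p\<close>, subject to the
  usual transformation law; components in other charts are set to 0.\<close>

type_synonym ('m, 'e) tvec = "('m, 'e) chart \<Rightarrow> 'e"

definition tangent_space :: "('m, 'e::euclidean_space) chart set \<Rightarrow> 'm \<Rightarrow> ('m, 'e) tvec set" where
  "tangent_space A p = {X.
     (\<forall>c\<in>charts_at A p. \<forall>d\<in>charts_at A p.
        X d = D (snd c ` (fst c \<inter> fst d)) (snd d \<circ> cinv c) (snd c p) (X c)) \<and>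
     (\<forall>c. c \<notin> charts_at A p \<longrightarrow> X c = 0)}"

text \<open>The tangent vector at \<open>p\<close> with components \<open>u\<close> in the chart \<open>c\<close>.\<close>

definition tvec_of ::
  "('m, 'e::euclidean_space) chart set \<Rightarrow> ('m, 'e) chart \<Rightarrow> 'm \<Rightarrow> 'e \<Rightarrow> ('m, 'e) tvec" where
  "tvec_of A c p u = (\<lambda>d. if d \<in> charts_at A p
     then D (snd c ` (fst c \<inter> fst d)) (snd d \<circ> cinv c) (snd c p) u else 0)"

definition dir_deriv ::
  "('m, 'e::euclidean_space) chart set \<Rightarrow> ('m \<Rightarrow> 'b::real_normed_vector) \<Rightarrow> 'm \<Rightarrow> ('m, 'e) tvec \<Rightarrow> 'b" where
  "dir_deriv A f p X = (let c = chart_at A p in D (snd c ` fst c) (f \<circ> cinv c) (snd c p) (X c))"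

text \<open>The differential of a map \<open>f\<close> between manifolds.\<close>

definition push ::
  "('m, 'e::euclidean_space) chart set \<Rightarrow> ('k, 'b::euclidean_space) chart set \<Rightarrow> ('m \<Rightarrow> 'k) \<Rightarrow>
   'm \<Rightarrow> ('m, 'e) tvec \<Rightarrow> ('k, 'b) tvec" where
  "push A B f p X = (\<lambda>d. if d \<in> charts_at B (f p)
     then let c = chart_at A p in
       D (snd c ` (fst c \<inter> f -` fst d)) (snd d \<circ> f \<circ> cinv c) (snd c p) (X c)
     else 0)"

definition velocity ::
  "('k, 'b::euclidean_space) chart set \<Rightarrow> real set \<Rightarrow> (real \<Rightarrow> 'k) \<Rightarrow> real \<Rightarrow> ('k, 'b) tvec" where
  "velocity B I \<gamma> t = (\<lambda>d. if d \<in> charts_at B (\<gamma> t) then ddt I (snd d \<circ> \<gamma>) t else 0)"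

definition smooth_map ::
  "('m::topological_space, 'e::euclidean_space) chart set \<Rightarrow>
   ('k::topological_space, 'b::euclidean_space) chart set \<Rightarrow> ('m \<Rightarrow> 'k) \<Rightarrow> bool" where
  "smooth_map A B f \<longleftrightarrow> f ` carrier A \<subseteq> carrier B \<and> continuous_on (carrier A) f \<and>
     (\<forall>c\<in>A. \<forall>d\<in>B. smooth_on (snd c ` (fst c \<inter> f -` fst d)) (snd d \<circ> f \<circ> cinv c))"

definition smooth_field_along ::
  "('m, 'e::euclidean_space) chart set \<Rightarrow> ('k, 'b::euclidean_space) chart set \<Rightarrow> ('m \<Rightarrow> 'k) \<Rightarrow>
   ('m \<Rightarrow> ('k, 'b) tvec) \<Rightarrow> bool" where
  "smooth_field_along A B f V \<longleftrightarrow> (\<forall>x\<in>carrier A. V x \<in> tangent_space B (f x)) \<and>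
     (\<forall>c\<in>A. \<forall>d\<in>B. smooth_on (snd c ` (fst c \<inter> f -` fst d)) (\<lambda>y. V (cinv c y) d))"


section \<open>Riemannian metrics and the Levi-Civita connection\<close>

type_synonym ('m, 'e) metric = "'m \<Rightarrow> ('m, 'e) tvec \<Rightarrow> ('m, 'e) tvec \<Rightarrow> real"

text \<open>The components of the metric in a chart, as a bilinear form on the model space.\<close>

definition coef ::
  "('m, 'e::euclidean_space) chart set \<Rightarrow> ('m, 'e) metric \<Rightarrow> ('m, 'e) chart \<Rightarrow> 'e \<Rightarrow> 'e \<Rightarrow> 'e \<Rightarrow> real" where
  "coef A g c y u w = (let p = cinv c y in g p (tvec_of A c p u) (tvec_of A c p w))"

definition riemannian_metric :: "('m, 'e::euclidean_space) chart set \<Rightarrow> ('m, 'e) metric \<Rightarrow> bool" where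
  "riemannian_metric A g \<longleftrightarrow> (\<forall>c\<in>A.
     (\<forall>y\<in>snd c ` fst c. bilinear (coef A g c y) \<and>
        (\<forall>u w. coef A g c y u w = coef A g c y w u) \<and>
        (\<forall>u. u \<noteq> 0 \<longrightarrow> 0 < coef A g c y u u)) \<and>
     (\<forall>u w. smooth_on (snd c ` fst c) (\<lambda>y. coef A g c y u w)))"

text \<open>The Christoffel symbols \<open>\<Gamma> u w = \<nabla>\<^sub>u w\<close> (for constant \<open>u\<close>, \<open>w\<close> in the chart \<open>c\<close>) of the
  unique connection that is torsion-free and compatible with the metric.\<close>

definition christoffel ::
  "('m, 'e::euclidean_space) chart set \<Rightarrow> ('m, 'e) metric \<Rightarrow> ('m, 'e) chart \<Rightarrow> 'e \<Rightarrow> 'e \<Rightarrow> 'e \<Rightarrow> 'e" where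
  "christoffel A g c y = (THE \<Gamma>. bilinear \<Gamma> \<and> (\<forall>u w. \<Gamma> u w = \<Gamma> w u) \<and>
     (\<forall>t u w. D (snd c ` fst c) (\<lambda>z. coef A g c z u w) y t =
        coef A g c y (\<Gamma> t u) w + coef A g c y u (\<Gamma> t w)))"

text \<open>The covariant derivative \<open>\<nabla>\<^sub>X V\<close> of a vector field \<open>V\<close> along \<open>f\<close>.\<close>

definition cov_deriv ::
  "('m, 'e::euclidean_space) chart set \<Rightarrow> ('k, 'b::euclidean_space) chart set \<Rightarrow> ('k, 'b) metric \<Rightarrow>
   ('m \<Rightarrow> 'k) \<Rightarrow> ('m \<Rightarrow> ('k, 'b) tvec) \<Rightarrow> 'm \<Rightarrow> ('m, 'e) tvec \<Rightarrow> ('k, 'b) tvec" where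
  "cov_deriv A B g f V x X = (\<lambda>d. if d \<in> charts_at B (f x)
     then let c = chart_at A x in
       D (snd c ` (fst c \<inter> f -` fst d)) (\<lambda>y. V (cinv c y) d) (snd c x) (X c) +
       christoffel B g d (snd d (f x)) (push A B f x X d) (V x d)
     else 0)"

text \<open>The distance as the infimum of lengths of smooth curves.  The length is a lower integral in
  \<open>[0, \<infinity>]\<close>, so no integrability side condition arises.\<close>

definition curve_length :: "('k, 'b::euclidean_space) chart set \<Rightarrow> ('k, 'b) metric \<Rightarrow> (real \<Rightarrow> 'k) \<Rightarrow> ennreal" where
  "curve_length B g \<gamma> = (\<integral>\<^sup>+t\<in>{0..1}.
     ennreal (sqrt (g (\<gamma> t) (velocity B {0..1} \<gamma> t) (velocity B {0..1} \<gamma> t))) \<partial>lborel)"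

definition riem_dist ::
  "('k::topological_space, 'b::euclidean_space) chart set \<Rightarrow> ('k, 'b) metric \<Rightarrow> 'k \<Rightarrow> 'k \<Rightarrow> real" where
  "riem_dist B g p q = enn2real (INF \<gamma> \<in> {\<gamma>. smooth_map {({0..1}, \<lambda>t. t)} B \<gamma> \<and> \<gamma> 0 = p \<and> \<gamma> 1 = q}.
     curve_length B g \<gamma>)"


section \<open>Minimal immersed hypersurfaces\<close>

definition immersion ::
  "('m::topological_space, 'e::euclidean_space) chart set \<Rightarrow>
   ('k::topological_space, 'b::euclidean_space) chart set \<Rightarrow> ('m \<Rightarrow> 'k) \<Rightarrow> bool" where
  "immersion A B f \<longleftrightarrow> smooth_map A B f \<and> (\<forall>x\<in>carrier A. inj_on (push A B f x) (tangent_space A x))"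

definition unit_normal ::
  "('m, 'e::euclidean_space) chart set \<Rightarrow> ('k, 'b::euclidean_space) chart set \<Rightarrow> ('k, 'b) metric \<Rightarrow>
   ('m \<Rightarrow> 'k) \<Rightarrow> ('m \<Rightarrow> ('k, 'b) tvec) \<Rightarrow> bool" where
  "unit_normal A B g f \<nu> \<longleftrightarrow> smooth_field_along A B f \<nu> \<and>
     (\<forall>x\<in>carrier A. g (f x) (\<nu> x) (\<nu> x) = 1 \<and>
        (\<forall>X\<in>tangent_space A x. g (f x) (\<nu> x) (push A B f x X) = 0))"

definition induced ::
  "('m, 'e::euclidean_space) chart set \<Rightarrow> ('k, 'b::euclidean_space) chart set \<Rightarrow> ('k, 'b) metric \<Rightarrow>
   ('m \<Rightarrow> 'k) \<Rightarrow> ('m, 'e) metric" where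
  "induced A B g f x X Y = g (f x) (push A B f x X) (push A B f x Y)"

definition second_ff ::
  "('m, 'e::euclidean_space) chart set \<Rightarrow> ('k, 'b::euclidean_space) chart set \<Rightarrow> ('k, 'b) metric \<Rightarrow>
   ('m \<Rightarrow> 'k) \<Rightarrow> ('m \<Rightarrow> ('k, 'b) tvec) \<Rightarrow> ('m, 'e) metric" where
  "second_ff A B g f \<nu> x X Y = g (f x) (cov_deriv A B g f \<nu> x X) (push A B f x Y)"

definition orthonormal_frame ::
  "('m, 'e::euclidean_space) chart set \<Rightarrow> ('m, 'e) metric \<Rightarrow> 'm \<Rightarrow> ('e \<Rightarrow> ('m, 'e) tvec) \<Rightarrow> bool" where
  "orthonormal_frame A g x E \<longleftrightarrow> (\<forall>i\<in>Basis. E i \<in> tangent_space A x) \<and>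
     (\<forall>i\<in>Basis. \<forall>j\<in>Basis. g x (E i) (E j) = (if i = j then 1 else 0))"

text \<open>Vanishing mean curvature: the second fundamental form has trace 0.\<close>

definition minimal ::
  "('m, 'e::euclidean_space) chart set \<Rightarrow> ('k, 'b::euclidean_space) chart set \<Rightarrow> ('k, 'b) metric \<Rightarrow>
   ('m \<Rightarrow> 'k) \<Rightarrow> ('m \<Rightarrow> ('k, 'b) tvec) \<Rightarrow> bool" where
  "minimal A B g f \<nu> \<longleftrightarrow> (\<forall>x\<in>carrier A. \<forall>E. orthonormal_frame A (induced A B g f) x E \<longrightarrow>
     (\<Sum>i\<in>Basis. second_ff A B g f \<nu> x (E i) (E i)) = 0)"

definition bdry_tangent_space ::
  "('m, 'e::euclidean_space) chart set \<Rightarrow> 'm \<Rightarrow> ('m, 'e) tvec set" where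
  "bdry_tangent_space A x = {X \<in> tangent_space A x.
     \<exists>c\<in>charts_at A x. snd c x \<bullet> bdir = 0 \<and> X c \<bullet> bdir = 0}"

definition outward_unit_conormal ::
  "('m, 'e::euclidean_space) chart set \<Rightarrow> ('m, 'e) metric \<Rightarrow> 'm \<Rightarrow> ('m, 'e) tvec \<Rightarrow> bool" where
  "outward_unit_conormal A g x X \<longleftrightarrow> X \<in> tangent_space A x \<and> g x X X = 1 \<and>
     (\<forall>Y\<in>bdry_tangent_space A x. g x X Y = 0) \<and>
     (\<exists>c\<in>charts_at A x. snd c x \<bullet> bdir = 0 \<and> X c \<bullet> bdir < 0)"

text \<open>A smooth family, parametrised by \<open>I\<close>, of two-sided minimal immersions with unit normals
  \<open>\<nu> (a, x)\<close> depending smoothly on \<open>(a, x)\<close>.\<close>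

definition minimal_family ::
  "real set \<Rightarrow> ('m::topological_space, 'e::euclidean_space) chart set \<Rightarrow>
   ('k::topological_space, 'b::euclidean_space) chart set \<Rightarrow> ('k, 'b) metric \<Rightarrow>
   (real \<times> 'm \<Rightarrow> 'k) \<Rightarrow> (real \<times> 'm \<Rightarrow> ('k, 'b) tvec) \<Rightarrow> bool" where
  "minimal_family I A B g \<Phi> \<nu> \<longleftrightarrow>
     smooth_map (cyl I A) B \<Phi> \<and> smooth_field_along (cyl I A) B \<Phi> \<nu> \<and>
     (\<forall>a\<in>I. immersion A B (\<lambda>x. \<Phi> (a, x)) \<and>
        unit_normal A B g (\<lambda>x. \<Phi> (a, x)) (\<lambda>x. \<nu> (a, x)) \<and>
        minimal A B g (\<lambda>x. \<Phi> (a, x)) (\<lambda>x. \<nu> (a, x)))"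

text \<open>The immersions map into the sublevel sets of \<open>\<rho>\<close>, the boundary to the level sets, and the
  outward unit conormal \<open>\<eta> a x\<close> to \<open>R = \<partial>\<^sub>\<rho>\<close>; since \<open>\<partial>\<^sub>\<rho>\<close> is normal to the level sets of \<open>\<rho>\<close>,
  they are met orthogonally.\<close>

definition free_boundary ::
  "real set \<Rightarrow> ('m, 'e::euclidean_space) chart set \<Rightarrow> ('k, 'b::euclidean_space) chart set \<Rightarrow>
   ('k, 'b) metric \<Rightarrow> ('k \<Rightarrow> real) \<Rightarrow> ('k \<Rightarrow> ('k, 'b) tvec) \<Rightarrow> (real \<Rightarrow> real) \<Rightarrow>
   (real \<times> 'm \<Rightarrow> 'k) \<Rightarrow> (real \<Rightarrow> 'm \<Rightarrow> ('m, 'e) tvec) \<Rightarrow> bool" where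
  "free_boundary I A B g \<rho> R r \<Phi> \<eta> \<longleftrightarrow> (\<forall>a\<in>I.
     (\<forall>x\<in>carrier A. \<rho> (\<Phi> (a, x)) \<le> r a) \<and>
     (\<forall>x\<in>bdry A. \<rho> (\<Phi> (a, x)) = r a \<and>
        outward_unit_conormal A (induced A B g (\<lambda>x. \<Phi> (a, x))) x (\<eta> a x) \<and>
        push A B (\<lambda>x. \<Phi> (a, x)) x (\<eta> a x) = R (\<Phi> (a, x))))"

definition normal_speed ::
  "real set \<Rightarrow> ('k, 'b::euclidean_space) chart set \<Rightarrow> ('k, 'b) metric \<Rightarrow>
   (real \<times> 'm \<Rightarrow> 'k) \<Rightarrow> (real \<times> 'm \<Rightarrow> ('k, 'b) tvec) \<Rightarrow> real \<Rightarrow> 'm \<Rightarrow> real" where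
  "normal_speed I B g \<Phi> \<nu> a x =
     g (\<Phi> (a, x)) (velocity B I (\<lambda>t. \<Phi> (t, x)) a) (\<nu> (a, x))"


section \<open>The ambient spaces\<close>

text \<open>The metric \<open>d\<rho>\<^sup>2 + h(\<rho>)\<^sup>2 g\<^sub>F\<close> on \<open>J \<times> F\<close>, where \<open>A\<close> is an atlas of \<open>F\<close>.\<close>

definition warped_metric ::
  "real set \<Rightarrow> ('f, 'e::euclidean_space) chart set \<Rightarrow> (real \<Rightarrow> real) \<Rightarrow> ('f, 'e) metric \<Rightarrow>
   (real \<times> 'f, real \<times> 'e) metric" where
  "warped_metric J A h gF q v w =
     dir_deriv (cyl J A) fst q v * dir_deriv (cyl J A) fst q w +
     (h (fst q))\<^sup>2 * gF (snd q) (push (cyl J A) A snd q v) (push (cyl J A) A snd q w)"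

definition warped_radial ::
  "real set \<Rightarrow> ('f, 'e::euclidean_space) chart set \<Rightarrow> real \<times> 'f \<Rightarrow> (real \<times> 'f, real \<times> 'e) tvec" where
  "warped_radial J A q = velocity (cyl J A) J (\<lambda>t. (t, snd q)) (fst q)"

text \<open>The ball \<open>B(r\<^sub>0)\<close> is modelled on the Euclidean ball via polar coordinates \<open>x = \<rho> \<theta>\<close> with
  \<open>\<rho> = norm x\<close> and \<open>\<theta> = sgn x = x / norm x\<close> in the unit sphere, whose round metric is the restriction
  of the inner product.  At the centre the metric is the limit of \<open>d\<rho>\<^sup>2 + h(\<rho>)\<^sup>2 g\<^sub>S\<close>, which is
  Euclidean because \<open>h(\<rho>) / \<rho>\<close> tends to \<open>h'(0) = 1\<close>.\<close>

definition ball_atlas :: "real \<Rightarrow> ('b::euclidean_space, 'b) chart set" where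
  "ball_atlas r0 = {(ball 0 r0, \<lambda>x. x)}"

definition polar_metric :: "real \<Rightarrow> (real \<Rightarrow> real) \<Rightarrow> ('b::euclidean_space, 'b) metric" where
  "polar_metric r0 h x v w =
     (if x = 0 then dir_deriv (ball_atlas r0) (\<lambda>y. y) x v \<bullet> dir_deriv (ball_atlas r0) (\<lambda>y. y) x w
      else dir_deriv (ball_atlas r0) norm x v * dir_deriv (ball_atlas r0) norm x w +
        (h (norm x))\<^sup>2 * (dir_deriv (ball_atlas r0) sgn x v \<bullet> dir_deriv (ball_atlas r0) sgn x w))"

definition polar_radial :: "real \<Rightarrow> 'b::euclidean_space \<Rightarrow> ('b, 'b) tvec" where
  "polar_radial r0 x = velocity (ball_atlas r0) {0<..<r0} (\<lambda>t. t *\<^sub>R sgn x) (norm x)"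

end

theory Submission
  imports Defs
begin

text \<open>
  Write \<open>V = \<partial>\<^sub>a \<Phi>\<^sub>a\<close> and let \<open>\<nabla>\<close> denote covariant differentiation along \<open>\<Phi>\<close>.  On the boundary
  \<open>\<partial>\<^sub>\<eta> \<phi> = \<langle>\<nabla>\<^sub>\<eta> V, \<nu>\<rangle> + \<langle>V, \<nabla>\<^sub>\<eta> \<nu>\<rangle>\<close>, and the two terms produce the two terms of the claim.

  For the first one, the free boundary condition says \<open>\<langle>\<nu>, \<partial>\<^sub>\<rho>\<rangle> = 0\<close> along \<open>\<partial>\<Sigma>\<close> for every \<open>a\<close>.
  Differentiating this in \<open>a\<close>, and using that the level sets of \<open>\<rho>\<close> are umbilic, i.e.
  \<open>\<langle>\<nabla>\<^sub>v \<partial>\<^sub>\<rho>, w\<rangle> = (h'/h) (\<langle>v, w\<rangle> - d\<rho>(v) d\<rho>(w))\<close>, gives \<open>\<langle>\<nabla>\<^sub>a \<nu>, \<partial>\<^sub>\<rho>\<rangle> = - (h'/h) \<phi>\<close>.  On the other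
  hand \<open>\<nu>\<close> is orthogonal to \<open>d\<Phi>\<^sub>a(u)\<close> for every \<open>u\<close> that is constant in a chart and in \<open>a\<close>; for
  \<open>u = \<eta>\<close>, together with the symmetry \<open>\<nabla>\<^sub>a d\<Phi>(u) = \<nabla>\<^sub>u V\<close>, this turns \<open>\<langle>\<nabla>\<^sub>a \<nu>, \<partial>\<^sub>\<rho>\<rangle>\<close> into
  \<open>- \<langle>\<nu>, \<nabla>\<^sub>\<eta> V\<rangle>\<close>.  Hence \<open>\<langle>\<nabla>\<^sub>\<eta> V, \<nu>\<rangle> = (h'/h) \<phi>\<close>.

  For the second one, decompose \<open>V = c \<nu> + \<alpha> \<eta> + w\<close> with \<open>w\<close> tangent to the boundary.  The vector
  \<open>\<nabla>\<^sub>\<eta> \<nu>\<close> is orthogonal to \<open>\<nu>\<close>; differentiating \<open>\<rho> \<circ> \<Phi> = r\<close> shows \<open>\<alpha> = r'\<close>; and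
  \<open>A(\<eta>, w) = A(w, \<eta>) = \<langle>\<nabla>\<^sub>w \<nu>, \<partial>\<^sub>\<rho>\<rangle> = 0\<close> by differentiating \<open>\<langle>\<nu>, \<partial>\<^sub>\<rho>\<rangle> = 0\<close> along the boundary and
  using umbilicity again.  Hence \<open>\<langle>V, \<nabla>\<^sub>\<eta> \<nu>\<rangle> = r' A(\<eta>, \<eta>)\<close>.

  The lemma \<open>free_boundary_identity\<close> is this computation in coordinates, and
  \<open>free_boundary_variation\<close> transports it to manifolds for any ambient metric whose radial field
  has the umbilicity property, expressed there through the Lie derivative \<open>L\<^sub>R g\<close> of the metric along
  \<open>R = \<partial>\<^sub>\<rho>\<close>.  The property is then checked for warped products in \<open>free_boundary_variation_warped\<close>
  and for rotationally symmetric balls in \<open>free_boundary_variation_polar\<close>.  In the second case the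
  distance function also has to be identified with the Euclidean norm, in \<open>riem_dist_ball\<close>: no
  curve is shorter than the increase of its norm, and radial segments realise it.
\<close>


section \<open>Derivatives within sets and second derivatives\<close>

text \<open>A condition that makes derivatives within \<open>S\<close> at \<open>x\<close> unique, because partial derivatives can be
  read off inside \<open>S\<close>.  It holds at boundary points of a half-space and at end
  points of an interval, and passes to products and to relatively open subsets.\<close>

definition accessible :: "'a::euclidean_space set \<Rightarrow> 'a \<Rightarrow> bool" where
  "accessible S x \<longleftrightarrow> (\<forall>i\<in>Basis. \<forall>e>0. \<exists>d. 0 < \<bar>d\<bar> \<and> \<bar>d\<bar> < e \<and> x + d *\<^sub>R i \<in> S)"

lemma D_eqI:
  assumes "accessible S x" "(f has_derivative f') (at x within S)"
  shows "D S f x = f'"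
proof -
  have "(f has_derivative frechet_derivative f (at x within S)) (at x within S)"
    using assms(2) frechet_derivative_works differentiableI by blast
  then have "frechet_derivative f (at x within S) = f'"
    by (rule frechet_derivative_unique_within[OF _ assms(2)]) (use assms(1) in \<open>auto simp: accessible_def\<close>)
  then show ?thesis by (auto simp: D_def fun_eq_iff)
qed

lemma has_derivative_D:
  assumes "f differentiable (at x within S)"
  shows "(f has_derivative D S f x) (at x within S)"
  using assms unfolding frechet_derivative_works D_def[abs_def] by (simp add: eta_contract_eq)

lemma at_within_openin:
  assumes "openin (top_of_set S) V" "x \<in> V"
  shows "at x within V = at x within S"
proof -
  obtain O' where "open O'" "V = S \<inter> O'" using assms(1) unfolding openin_open by auto
  then show ?thesis using assms(2)
    by (intro at_within_nhd[where S = O']) auto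
qed

lemma accessible_openin:
  assumes "accessible S x" "openin (top_of_set S) V" "x \<in> V"
  shows "accessible V x"
proof -
  obtain O' where O': "open O'" "V = S \<inter> O'" using assms(2) unfolding openin_open by auto
  then obtain r where r: "r > 0" "ball x r \<subseteq> O'" using assms(3) open_contains_ball by blast
  show ?thesis unfolding accessible_def
  proof (intro ballI allI impI)
    fix i :: 'a and e :: real assume i: "i \<in> Basis" "0 < e"
    then obtain d where d: "0 < \<bar>d\<bar>" "\<bar>d\<bar> < min e r" "x + d *\<^sub>R i \<in> S"
      using assms(1) r(1) unfolding accessible_def by (meson min_less_iff_conj)
    then have "x + d *\<^sub>R i \<in> ball x r" using i by (simp add: dist_norm)
    then show "\<exists>d. 0 < \<bar>d\<bar> \<and> \<bar>d\<bar> < e \<and> x + d *\<^sub>R i \<in> V" using d r O' by auto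
  qed
qed

lemma accessible_UNIV: "accessible UNIV x"
  unfolding accessible_def by (metis UNIV_I abs_of_pos dense)

lemma bdir_Basis: "bdir \<in> Basis"
  unfolding bdir_def by (rule someI_ex) (use nonempty_Basis in blast)

lemma accessible_half_space:
  assumes "y \<in> half_space" shows "accessible half_space y"
  unfolding accessible_def
proof (intro ballI allI impI)
  fix i :: 'a and e :: real assume i: "i \<in> Basis" "0 < e"
  have "y + (e/2) *\<^sub>R i \<in> half_space"
    using assms i inner_Basis[OF i(1) bdir_Basis] by (simp add: half_space_def inner_add_left split: if_splits)
  then show "\<exists>d. 0 < \<bar>d\<bar> \<and> \<bar>d\<bar> < e \<and> y + d *\<^sub>R i \<in> half_space" using i by (intro exI[of _ "e/2"]) auto
qed

lemma accessible_Times: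
  assumes "accessible S x" "accessible S' y" "x \<in> S" "y \<in> S'"
  shows "accessible (S \<times> S') (x, y)"
  unfolding accessible_def Basis_prod_def
proof (intro ballI allI impI)
  fix i :: "'a \<times> 'b" and e :: real
  assume i: "i \<in> (\<lambda>u. (u, 0)) ` Basis \<union> (\<lambda>v. (0, v)) ` Basis" "0 < e"
  then consider u where "u \<in> Basis" "i = (u,0)" | v where "v \<in> Basis" "i = (0,v)" by auto
  then show "\<exists>d. 0 < \<bar>d\<bar> \<and> \<bar>d\<bar> < e \<and> (x, y) + d *\<^sub>R i \<in> S \<times> S'"
  proof cases
    case 1
    then show ?thesis using assms i(2) unfolding accessible_def by fastforce
  next
    case 2
    then show ?thesis using assms i(2) unfolding accessible_def by fastforce
  qed
qed

text \<open>Move from \<open>a\<close> a short way towards an interior point; convexity keeps the segment in \<open>I\<close>.\<close>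

lemma proper_interval_near:
  assumes "proper_interval I" "a \<in> I" "0 < e"
  shows "\<exists>d. 0 < \<bar>d\<bar> \<and> \<bar>d\<bar> < e \<and> a + d \<in> I"
proof -
  obtain b r where b: "r > 0" "ball b r \<subseteq> I"
    using assms(1) unfolding proper_interval_def mem_interior by (metis ex_in_conv mem_interior)
  define b' where "b' = (if a = b then b + r/2 else b)"
  have b': "b' \<in> I" "b' \<noteq> a" using b unfolding b'_def by (auto simp: dist_norm subset_iff)
  define s where "s = min (1/2) (e / (2 * \<bar>b' - a\<bar>))"
  have s: "0 < s" "s \<le> 1" "s * \<bar>b' - a\<bar> < e"
  proof -
    show "0 < s" "s \<le> 1" using b' assms(3) unfolding s_def by auto
    have "s * \<bar>b' - a\<bar> \<le> e / (2 * \<bar>b' - a\<bar>) * \<bar>b' - a\<bar>"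
      unfolding s_def by (intro mult_right_mono) auto
    also have "\<dots> < e" using b' assms(3) by (simp add: field_simps)
    finally show "s * \<bar>b' - a\<bar> < e" .
  qed
  have "convex I" using assms(1) unfolding proper_interval_def by (simp add: is_interval_convex_1)
  then have "(1 - s) *\<^sub>R a + s *\<^sub>R b' \<in> I"
    using convexD_alt[OF _ assms(2) b'(1)] s by auto
  then have "a + s * (b' - a) \<in> I" by (simp add: algebra_simps)
  then show ?thesis using s b' by (intro exI[of _ "s * (b' - a)"]) (auto simp: abs_mult)
qed

lemma accessible_proper_interval:
  assumes "proper_interval I" "a \<in> I" shows "accessible I a"
  using proper_interval_near[OF assms] unfolding accessible_def by simp

lemma smooth_on_differentiable:
  assumes "smooth_on S f" "x \<in> S"
  shows "f differentiable (at x within S)"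
proof -
  obtain U g where U: "open U" "x \<in> U" "\<forall>k. Ck_on k U g" "\<forall>y\<in>S \<inter> U. f y = g y"
    using assms unfolding smooth_on_def by blast
  have "Ck_on (Suc 0) U g" using U(3) by blast
  then have "g differentiable (at x)" using U(2) by simp
  then have "g differentiable (at x within (S \<inter> U))" by (rule differentiable_at_withinI)
  then have "f differentiable (at x within (S \<inter> U))"
    using U assms(2) unfolding differentiable_def
    by (metis IntI has_derivative_transform)
  moreover have "at x within (S \<inter> U) = at x within S"
    by (rule at_within_openin) (use U assms(2) in auto)
  ultimately show ?thesis by simp
qed

text \<open>By the mean value theorem the second difference equals \<open>s\<close> times
  \<open>f'(x + \<tau> u + s v) u - f'(x + \<tau> u) u\<close> for some \<open>\<tau>\<close> between 0 and \<open>s\<close>, which is \<open>s L v\<close> up to \<open>o(s)\<close>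
  by differentiability of \<open>y \<mapsto> f' y u\<close> at the single point \<open>x\<close>.\<close>

lemma second_difference_limit:
  fixes f :: "'a::euclidean_space \<Rightarrow> real"
  assumes U: "open U" "x \<in> U" and f: "\<And>y. y \<in> U \<Longrightarrow> (f has_derivative f' y) (at y)"
    and f2: "((\<lambda>y. f' y u) has_derivative L) (at x)"
  shows "((\<lambda>s. (f (x + s *\<^sub>R u + s *\<^sub>R v) - f (x + s *\<^sub>R u) - f (x + s *\<^sub>R v) + f x) / s\<^sup>2)
           \<longlongrightarrow> L v) (at_right 0)"
proof (rule tendstoI)
  fix \<epsilon> :: real assume eps: "0 < \<epsilon>"
  define K where "K = norm u + norm v + 1"
  have K: "K > 0" unfolding K_def by (smt (verit) norm_ge_zero)
  \<comment> \<open>two errors of at most \<open>\<epsilon>' s K\<close> each must add up to less than \<open>\<epsilon> s\<close>\<close>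
  define \<epsilon>' where "\<epsilon>' = \<epsilon> / (4 * K)"
  have eps': "\<epsilon>' > 0" unfolding \<epsilon>'_def using eps K by simp
  have bl: "bounded_linear L" using f2 has_derivative_bounded_linear by blast
  obtain \<delta> where del: "\<delta> > 0" and dl: "\<And>y. norm (y - x) < \<delta> \<Longrightarrow>
      norm (f' y u - f' x u - L (y - x)) \<le> \<epsilon>' * norm (y - x)"
    using f2 eps' unfolding has_derivative_at_alt by blast
  obtain r where r: "r > 0" "ball x r \<subseteq> U" using U open_contains_ball by blast
  define e where "e = min \<delta> r / K"
  have e: "e > 0" unfolding e_def using del r K by simp
  have "dist ((f (x + s *\<^sub>R u + s *\<^sub>R v) - f (x + s *\<^sub>R u) - f (x + s *\<^sub>R v) + f x) / s\<^sup>2) (L v) < \<epsilon>"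
    if s: "0 < s" "s < e" for s
  proof -
    have sK: "s * K < min \<delta> r" using s K unfolding e_def by (simp add: field_simps)
    have nrm: "norm (\<tau> *\<^sub>R u + \<sigma> *\<^sub>R v) \<le> s * K" if "0 \<le> \<tau>" "\<tau> \<le> s" "0 \<le> \<sigma>" "\<sigma> \<le> s" for \<tau> \<sigma>
    proof -
      have "norm (\<tau> *\<^sub>R u + \<sigma> *\<^sub>R v) \<le> \<tau> * norm u + \<sigma> * norm v"
        using norm_triangle_ineq[of "\<tau> *\<^sub>R u" "\<sigma> *\<^sub>R v"] that by simp
      also have "\<dots> \<le> s * norm u + s * norm v" using that by (intro add_mono mult_right_mono) auto
      also have "\<dots> \<le> s * K" using s unfolding K_def by (simp add: algebra_simps)
      finally show ?thesis .
    qed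
    have inU: "x + (\<tau> *\<^sub>R u + \<sigma> *\<^sub>R v) \<in> U" if "0 \<le> \<tau>" "\<tau> \<le> s" "0 \<le> \<sigma>" "\<sigma> \<le> s" for \<tau> \<sigma>
    proof -
      have "norm (\<tau> *\<^sub>R u + \<sigma> *\<^sub>R v) < r" using nrm[OF that] sK by linarith
      then have "x + (\<tau> *\<^sub>R u + \<sigma> *\<^sub>R v) \<in> ball x r" using norm_minus_cancel[of "\<tau> *\<^sub>R u + \<sigma> *\<^sub>R v"] by (simp add: dist_norm del: norm_minus_cancel)
      then show ?thesis using r by blast
    qed
    define \<phi> where "\<phi> \<tau> = f (x + (\<tau> *\<^sub>R u + s *\<^sub>R v)) - f (x + \<tau> *\<^sub>R u)" for \<tau>
    have der: "(\<phi> has_real_derivative (f' (x + (\<tau> *\<^sub>R u + s *\<^sub>R v)) u - f' (x + \<tau> *\<^sub>R u) u)) (at \<tau>)"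
      if "0 \<le> \<tau>" "\<tau> \<le> s" for \<tau>
    proof -
      have i1: "x + (\<tau> *\<^sub>R u + s *\<^sub>R v) \<in> U" using inU[of \<tau> s] that s by auto
      have i2: "x + \<tau> *\<^sub>R u \<in> U" using inU[of \<tau> 0] that s by auto
      have "((\<lambda>\<tau>. f (x + (\<tau> *\<^sub>R u + s *\<^sub>R v))) has_derivative (\<lambda>h. f' (x + (\<tau> *\<^sub>R u + s *\<^sub>R v)) (h *\<^sub>R u))) (at \<tau>)"
        by (rule has_derivative_compose[where f = "\<lambda>\<tau>. x + (\<tau> *\<^sub>R u + s *\<^sub>R v)", OF _ f[OF i1]])
           (auto intro!: derivative_eq_intros)
      moreover have "((\<lambda>\<tau>. f (x + \<tau> *\<^sub>R u)) has_derivative (\<lambda>h. f' (x + \<tau> *\<^sub>R u) (h *\<^sub>R u))) (at \<tau>)"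
        by (rule has_derivative_compose[where f = "\<lambda>\<tau>. x + \<tau> *\<^sub>R u", OF _ f[OF i2]])
           (auto intro!: derivative_eq_intros)
      ultimately have "(\<phi> has_derivative (\<lambda>h. f' (x + (\<tau> *\<^sub>R u + s *\<^sub>R v)) (h *\<^sub>R u) - f' (x + \<tau> *\<^sub>R u) (h *\<^sub>R u))) (at \<tau>)"
        unfolding \<phi>_def by (rule has_derivative_diff)
      moreover have "linear (f' (x + (\<tau> *\<^sub>R u + s *\<^sub>R v)))" "linear (f' (x + \<tau> *\<^sub>R u))"
        using f[OF i1] f[OF i2] has_derivative_linear by auto
      ultimately show ?thesis unfolding has_field_derivative_def
        by (elim has_derivative_eq_rhs) (auto simp: linear_scale algebra_simps)
    qed
    obtain \<tau> where tau: "0 < \<tau>" "\<tau> < s"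
      "\<phi> s - \<phi> 0 = (s - 0) * (f' (x + (\<tau> *\<^sub>R u + s *\<^sub>R v)) u - f' (x + \<tau> *\<^sub>R u) u)"
      using MVT2[where f = \<phi>, OF s(1) der] by blast
    let ?q = "f' (x + (\<tau> *\<^sub>R u + s *\<^sub>R v)) u - f' (x + \<tau> *\<^sub>R u) u"
    have a1: "\<bar>f' (x + (\<tau> *\<^sub>R u + s *\<^sub>R v)) u - f' x u - L (\<tau> *\<^sub>R u + s *\<^sub>R v)\<bar> \<le> \<epsilon>' * (s * K)"
    proof -
      have n: "norm (\<tau> *\<^sub>R u + s *\<^sub>R v) \<le> s * K" using nrm[of \<tau> s] tau s by auto
      then have "norm (x + (\<tau> *\<^sub>R u + s *\<^sub>R v) - x) < \<delta>" using sK by simp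
      from dl[OF this] have "\<bar>f' (x + (\<tau> *\<^sub>R u + s *\<^sub>R v)) u - f' x u - L (\<tau> *\<^sub>R u + s *\<^sub>R v)\<bar>
         \<le> \<epsilon>' * norm (\<tau> *\<^sub>R u + s *\<^sub>R v)" by simp
      also have "\<dots> \<le> \<epsilon>' * (s * K)" using n eps' by (intro mult_left_mono) auto
      finally show ?thesis .
    qed
    have a2: "\<bar>f' (x + \<tau> *\<^sub>R u) u - f' x u - L (\<tau> *\<^sub>R u)\<bar> \<le> \<epsilon>' * (s * K)"
    proof -
      have n: "norm (\<tau> *\<^sub>R u) \<le> s * K" using nrm[of \<tau> 0] tau s by auto
      then have "norm (x + \<tau> *\<^sub>R u - x) < \<delta>" using sK by simp
      from dl[OF this] have "\<bar>f' (x + \<tau> *\<^sub>R u) u - f' x u - L (\<tau> *\<^sub>R u)\<bar>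
         \<le> \<epsilon>' * norm (\<tau> *\<^sub>R u)" by simp
      also have "\<dots> \<le> \<epsilon>' * (s * K)" using n eps' by (intro mult_left_mono) auto
      finally show ?thesis .
    qed
    have L: "L (\<tau> *\<^sub>R u + s *\<^sub>R v) - L (\<tau> *\<^sub>R u) = s * L v"
      using bl by (simp add: linear_simps)
    have "\<bar>?q - s * L v\<bar> \<le> 2 * (\<epsilon>' * (s * K))" using a1 a2 L by linarith
    then have "\<bar>?q / s - L v\<bar> \<le> 2 * \<epsilon>' * K" using s by (simp add: field_simps abs_if split: if_splits)
    also have "\<dots> < \<epsilon>" unfolding \<epsilon>'_def using eps K by (simp add: field_simps)
    finally have fin: "\<bar>?q / s - L v\<bar> < \<epsilon>" .
    have "f (x + s *\<^sub>R u + s *\<^sub>R v) - f (x + s *\<^sub>R u) - f (x + s *\<^sub>R v) + f x = \<phi> s - \<phi> 0"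
      unfolding \<phi>_def by (simp add: add.assoc)
    also have "\<dots> = s * ?q" using tau by simp
    finally show ?thesis using fin s by (simp add: dist_real_def power2_eq_square)
  qed
  then show "\<forall>\<^sub>F s in at_right 0. dist ((f (x + s *\<^sub>R u + s *\<^sub>R v) - f (x + s *\<^sub>R u) - f (x + s *\<^sub>R v) + f x) / s\<^sup>2) (L v) < \<epsilon>"
    unfolding eventually_at_right_field using e by blast
qed

text \<open>The second difference is symmetric in \<open>u\<close> and \<open>v\<close>, so its two limits agree.\<close>

lemma symmetric_second_derivative:
  fixes f :: "'a::euclidean_space \<Rightarrow> 'b::euclidean_space"
  assumes U: "open U" "x \<in> U" and f: "\<And>y. y \<in> U \<Longrightarrow> (f has_derivative f' y) (at y)"
    and u: "((\<lambda>y. f' y u) has_derivative Lu) (at x)"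
    and v: "((\<lambda>y. f' y v) has_derivative Lv) (at x)"
  shows "Lu v = Lv u"
proof (rule euclidean_eqI)
  fix b :: 'b assume "b \<in> Basis"
  have f': "((\<lambda>y. f y \<bullet> b) has_derivative (\<lambda>h. f' y h \<bullet> b)) (at y)" if "y \<in> U" for y
    using f[OF that] by (rule has_derivative_inner_left)
  have l1: "((\<lambda>s. (f (x + s *\<^sub>R u + s *\<^sub>R v) \<bullet> b - f (x + s *\<^sub>R u) \<bullet> b - f (x + s *\<^sub>R v) \<bullet> b + f x \<bullet> b) / s\<^sup>2)
           \<longlongrightarrow> Lu v \<bullet> b) (at_right 0)"
    by (rule second_difference_limit[OF U f' has_derivative_inner_left[OF u]])
  have "((\<lambda>s. (f (x + s *\<^sub>R v + s *\<^sub>R u) \<bullet> b - f (x + s *\<^sub>R v) \<bullet> b - f (x + s *\<^sub>R u) \<bullet> b + f x \<bullet> b) / s\<^sup>2)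
           \<longlongrightarrow> Lv u \<bullet> b) (at_right 0)"
    by (rule second_difference_limit[OF U f' has_derivative_inner_left[OF v]])
  moreover have "(f (x + s *\<^sub>R v + s *\<^sub>R u) \<bullet> b - f (x + s *\<^sub>R v) \<bullet> b - f (x + s *\<^sub>R u) \<bullet> b + f x \<bullet> b)
     = (f (x + s *\<^sub>R u + s *\<^sub>R v) \<bullet> b - f (x + s *\<^sub>R u) \<bullet> b - f (x + s *\<^sub>R v) \<bullet> b + f x \<bullet> b)" for s
    by (simp add: algebra_simps)
  ultimately show "Lu v \<bullet> b = Lv u \<bullet> b"
    using tendsto_unique[OF _ l1] trivial_limit_at_right_real by simp
qed

text \<open>What the boundary computation needs of smoothness up to the boundary.  The first derivatives
  are those of a smooth extension, so that they are differentiable in a full neighbourhood and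
  their derivatives are symmetric.\<close>

lemma smooth_on_second_order:
  fixes f :: "'a::euclidean_space \<Rightarrow> 'b::euclidean_space"
  assumes "smooth_on S f" "x \<in> S"
  obtains O' f' L where "open O'" "x \<in> O'"
    "\<And>y. y \<in> S \<inter> O' \<Longrightarrow> (f has_derivative f' y) (at y within S)"
    "\<And>u. ((\<lambda>y. f' y u) has_derivative L u) (at x)"
    "\<And>u v. L u v = L v u"
proof -
  obtain U g where U: "open U" "x \<in> U" "\<forall>k. Ck_on k U g" "\<forall>y\<in>S \<inter> U. f y = g y"
    using assms unfolding smooth_on_def by blast
  define f' where "f' y = frechet_derivative g (at y)" for y
  have C2: "Ck_on (Suc (Suc 0)) U g" using U(3) by blast
  have g: "(g has_derivative f' y) (at y)" if "y \<in> U" for y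
    using C2 that unfolding f'_def by (simp add: frechet_derivative_works)
  define L where "L u = frechet_derivative (\<lambda>y. f' y u) (at x)" for u
  have L: "((\<lambda>y. f' y u) has_derivative L u) (at x)" for u
    using C2 U(2) unfolding L_def f'_def by (simp flip: frechet_derivative_works)
  have sym: "L u v = L v u" for u v
    by (rule symmetric_second_derivative[OF U(1,2) g L L])
  have f: "(f has_derivative f' y) (at y within S)" if y: "y \<in> S \<inter> U" for y
  proof -
    have "(g has_derivative f' y) (at y within (S \<inter> U))" using g y by (auto intro: has_derivative_at_withinI)
    then have "(f has_derivative f' y) (at y within (S \<inter> U))"
      by (rule has_derivative_transform[rotated 2]) (use U y in auto)
    moreover have "at y within (S \<inter> U) = at y within S"
      by (rule at_within_openin) (use U y in auto)
    ultimately show ?thesis by simp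
  qed
  show thesis by (rule that[OF U(1,2) f L sym])
qed


section \<open>Charts and tangent vectors\<close>

text \<open>Smooth atlases with differentiable instead of smooth transition maps: first derivatives of
  transition maps suffice to compare components in different charts, and this weaker notion is
  easily inherited by the product with an interval.\<close>

definition diff_atlas ::
  "'e::euclidean_space set \<Rightarrow> 'm::topological_space set \<Rightarrow> ('m, 'e) chart set \<Rightarrow> bool" where
  "diff_atlas R M A \<longleftrightarrow> carrier A = M \<and> (\<forall>y\<in>R. accessible R y) \<and>
     (\<forall>c\<in>A. openin (top_of_set M) (fst c) \<and> openin (top_of_set R) (snd c ` fst c) \<and>
        homeomorphism (fst c) (snd c ` fst c) (snd c) (cinv c)) \<and>
     (\<forall>c\<in>A. \<forall>d\<in>A. \<forall>y\<in>snd c ` (fst c \<inter> fst d).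
        (snd d \<circ> cinv c) differentiable (at y within snd c ` (fst c \<inter> fst d)))"

lemma smooth_atlas_imp_diff_atlas:
  assumes "smooth_atlas R M A" "\<And>y. y \<in> R \<Longrightarrow> accessible R y"
  shows "diff_atlas R M A"
  using assms smooth_on_differentiable unfolding smooth_atlas_def diff_atlas_def by blast

lemma accessible_real_limit_point:
  fixes t :: real
  assumes "accessible I t" shows "t islimpt I"
  unfolding islimpt_approachable
proof (intro allI impI)
  fix e :: real assume "0 < e"
  then obtain d where "0 < \<bar>d\<bar>" "\<bar>d\<bar> < e" "t + d *\<^sub>R 1 \<in> I"
    using assms unfolding accessible_def by (metis Basis_real_def singletonI)
  then show "\<exists>s\<in>I. s \<noteq> t \<and> dist s t < e" by (intro bexI[of _ "t + d"]) (auto simp: dist_real_def)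
qed

lemma charts_atD: "c \<in> charts_at A p \<Longrightarrow> c \<in> A" "c \<in> charts_at A p \<Longrightarrow> p \<in> fst c"
  by (auto simp: charts_at_def)

lemma chart_at: "p \<in> carrier A \<Longrightarrow> chart_at A p \<in> charts_at A p"
  unfolding chart_at_def by (rule someI_ex) (auto simp: carrier_def charts_at_def)

context
  fixes R :: "'e::euclidean_space set" and M :: "'m::topological_space set" and A
  assumes atlas: "diff_atlas R M A"
begin

lemma atlas_carrier: "carrier A = M"
  using atlas by (simp add: diff_atlas_def)

lemma atlas_homeo: "c \<in> A \<Longrightarrow> homeomorphism (fst c) (snd c ` fst c) (snd c) (cinv c)"
  using atlas by (simp add: diff_atlas_def)

lemma cinv_chart: "c \<in> A \<Longrightarrow> p \<in> fst c \<Longrightarrow> cinv c (snd c p) = p"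
  using homeomorphism_apply1[OF atlas_homeo] by blast

lemma atlas_openin: "c \<in> A \<Longrightarrow> openin (top_of_set M) (fst c)"
  using atlas by (simp add: diff_atlas_def)

lemma chart_image_openin:
  assumes "c \<in> A" "openin (top_of_set M) W"
  shows "openin (top_of_set R) (snd c ` (fst c \<inter> W))"
proof -
  have "fst c \<subseteq> M" using atlas_openin[OF assms(1)] openin_imp_subset by blast
  then have "openin (top_of_set (fst c)) (fst c \<inter> W)"
    using assms(2) unfolding openin_open by blast
  then have "openin (top_of_set (snd c ` fst c)) (snd c ` (fst c \<inter> W))"
    by (rule homeomorphism_imp_open_map[OF atlas_homeo[OF assms(1)]])
  moreover have "openin (top_of_set R) (snd c ` fst c)"
    using atlas assms(1) by (simp add: diff_atlas_def)
  ultimately show ?thesis using openin_trans by blast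
qed

lemma chart_image_accessible:
  assumes "c \<in> A" "openin (top_of_set M) W" "x \<in> fst c" "x \<in> W"
  shows "accessible (snd c ` (fst c \<inter> W)) (snd c x)"
proof -
  have o: "openin (top_of_set R) (snd c ` (fst c \<inter> W))" using chart_image_openin assms by blast
  have m: "snd c x \<in> snd c ` (fst c \<inter> W)" using assms by blast
  then have "snd c x \<in> R" using openin_imp_subset[OF o] by blast
  then show ?thesis using accessible_openin[OF _ o m] atlas by (simp add: diff_atlas_def)
qed

lemma chart_range_accessible:
  assumes "c \<in> A" "x \<in> fst c"
  shows "accessible (snd c ` fst c) (snd c x)"
proof -
  have "fst c \<inter> M = fst c" using openin_imp_subset[OF atlas_openin[OF assms(1)]] by blast
  then show ?thesis
    using chart_image_accessible[OF assms(1) openin_subtopology_self[of M] assms(2)] assms(2) by auto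
qed

lemma transition_derivative:
  assumes "c \<in> charts_at A x" "d \<in> charts_at A x"
  shows "((snd d \<circ> cinv c) has_derivative D (snd c ` (fst c \<inter> fst d)) (snd d \<circ> cinv c) (snd c x))
     (at (snd c x) within snd c ` (fst c \<inter> fst d))"
proof (rule has_derivative_D)
  show "(snd d \<circ> cinv c) differentiable (at (snd c x) within snd c ` (fst c \<inter> fst d))"
    using atlas assms unfolding diff_atlas_def by (blast dest: charts_atD)
qed

lemma at_within_chart_image:
  assumes "c \<in> A" "openin (top_of_set M) V" "openin (top_of_set M) W" "x \<in> fst c" "x \<in> V" "V \<subseteq> W"
  shows "at (snd c x) within snd c ` (fst c \<inter> V) = at (snd c x) within snd c ` (fst c \<inter> W)"
proof (rule at_within_openin)
  have "openin (top_of_set R) (snd c ` (fst c \<inter> V))" "openin (top_of_set R) (snd c ` (fst c \<inter> W))"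
    using chart_image_openin assms by blast+
  moreover have "snd c ` (fst c \<inter> V) \<subseteq> snd c ` (fst c \<inter> W)" using assms(6) by blast
  ultimately show "openin (top_of_set (snd c ` (fst c \<inter> W))) (snd c ` (fst c \<inter> V))"
    by (meson openin_imp_subset openin_subset_trans)
  show "snd c x \<in> snd c ` (fst c \<inter> V)" using assms by blast
qed

text \<open>The chain rule along the transition map.  The functions and their domains are described by sets of
  the manifold, such as the preimage of a chart domain of another manifold, so that the same lemma
  serves directional derivatives, differentials and covariant derivatives.\<close>

lemma chart_change:
  fixes F :: "'m \<Rightarrow> 'v::real_normed_vector"
  assumes c: "c \<in> charts_at A x" "c' \<in> charts_at A x"
    and W: "openin (top_of_set M) W" "x \<in> W"
    and F: "((F \<circ> cinv c) has_derivative F') (at (snd c x) within snd c ` (fst c \<inter> W))"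
  shows "((F \<circ> cinv c') has_derivative
      (\<lambda>u. F' (D (snd c' ` (fst c' \<inter> fst c)) (snd c \<circ> cinv c') (snd c' x) u)))
      (at (snd c' x) within snd c' ` (fst c' \<inter> W))"
proof -
  note cA = charts_atD[OF c(1)] charts_atD[OF c(2)]
  let ?V = "fst c \<inter> W"
  have V: "openin (top_of_set M) ?V" "x \<in> ?V"
    using W atlas_openin[OF cA(1)] cA by auto
  let ?S = "snd c' ` (fst c' \<inter> ?V)"
  let ?\<tau> = "D (snd c' ` (fst c' \<inter> fst c)) (snd c \<circ> cinv c') (snd c' x)"
  have tau: "((snd c \<circ> cinv c') has_derivative ?\<tau>) (at (snd c' x) within ?S)"
    by (rule has_derivative_subset[OF transition_derivative[OF c(2,1)]]) auto
  have im: "(snd c \<circ> cinv c') ` ?S \<subseteq> snd c ` (fst c \<inter> W)"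
    using cinv_chart cA by auto
  have val: "(snd c \<circ> cinv c') (snd c' x) = snd c x" using cinv_chart cA by simp
  have F1: "((F \<circ> cinv c) has_derivative F') (at ((snd c \<circ> cinv c') (snd c' x)) within (snd c \<circ> cinv c') ` ?S)"
    unfolding val by (rule has_derivative_subset[OF F im])
  have "((F \<circ> cinv c') has_derivative (\<lambda>u. F' (?\<tau> u))) (at (snd c' x) within ?S)"
    by (rule has_derivative_transform[OF _ _ has_derivative_in_compose[OF tau F1]])
       (use V cinv_chart cA in auto)
  then show ?thesis
    using at_within_chart_image[OF cA(3) V(1) W(1) cA(4) V(2)] by simp
qed

text \<open>The definitions of directional derivative, differential and covariant derivative evaluate in
  one chosen chart; for genuine tangent vectors the choice is immaterial.\<close>

lemma D_chart_change:
  fixes F :: "'m \<Rightarrow> 'v::real_normed_vector"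
  assumes c: "c \<in> charts_at A x" "c' \<in> charts_at A x"
    and W: "openin (top_of_set M) W" "x \<in> W"
    and F: "((F \<circ> cinv c) has_derivative F') (at (snd c x) within snd c ` (fst c \<inter> W))"
    and X: "X \<in> tangent_space A x"
  shows "D (snd c' ` (fst c' \<inter> W)) (F \<circ> cinv c') (snd c' x) (X c') = F' (X c)"
proof -
  note cA = charts_atD[OF c(1)] charts_atD[OF c(2)]
  have "X c = D (snd c' ` (fst c' \<inter> fst c)) (snd c \<circ> cinv c') (snd c' x) (X c')"
    using X c unfolding tangent_space_def by blast
  then have "F' (X c) = F' (D (snd c' ` (fst c' \<inter> fst c)) (snd c \<circ> cinv c') (snd c' x) (X c'))"
    by (rule arg_cong)
  then show ?thesis
    unfolding D_eqI[OF chart_image_accessible[OF cA(3) W(1) cA(4) W(2)] chart_change[OF c W F]] by (rule sym)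
qed

lemma tvec_of_same:
  assumes "c \<in> charts_at A x" shows "tvec_of A c x u c = u"
proof -
  note cA = charts_atD[OF assms]
  have o: "openin (top_of_set M) (fst c)" using atlas_openin cA by blast
  have "((\<lambda>y. y) has_derivative (\<lambda>y. y)) (at (snd c x) within snd c ` (fst c \<inter> fst c))" by simp
  then have "((snd c \<circ> cinv c) has_derivative (\<lambda>y. y)) (at (snd c x) within snd c ` (fst c \<inter> fst c))"
    by (rule has_derivative_transform[rotated 2]) (use cinv_chart cA in auto)
  from D_eqI[OF chart_image_accessible[OF cA(1) o cA(2,2)] this] show ?thesis
    using assms by (simp add: tvec_of_def)
qed

lemma tvec_of_tangent:
  assumes c: "c \<in> charts_at A x" shows "tvec_of A c x u \<in> tangent_space A x"
proof -
  have "tvec_of A c x u e = D (snd d ` (fst d \<inter> fst e)) (snd e \<circ> cinv d) (snd d x) (tvec_of A c x u d)"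
    if d: "d \<in> charts_at A x" and e: "e \<in> charts_at A x" for d e
  proof -
    note cA = charts_atD[OF c] charts_atD[OF d] charts_atD[OF e]
    have o: "openin (top_of_set M) (fst e)" using atlas_openin cA by blast
    show ?thesis
      using D_eqI[OF chart_image_accessible[OF cA(1) o cA(2,6)]
          chart_change[OF d c o cA(6) transition_derivative[OF d e]]] c d e
      by (simp add: tvec_of_def)
  qed
  moreover have "tvec_of A c x u e = 0" if "e \<notin> charts_at A x" for e
    using that by (simp add: tvec_of_def)
  ultimately show ?thesis unfolding tangent_space_def by blast
qed

lemma tvec_of_component:
  assumes "X \<in> tangent_space A x" "c \<in> charts_at A x"
  shows "tvec_of A c x (X c) = X"
proof
  fix d
  show "tvec_of A c x (X c) d = X d"
  proof (cases "d \<in> charts_at A x")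
    case True
    then have "X d = D (snd c ` (fst c \<inter> fst d)) (snd d \<circ> cinv c) (snd c x) (X c)"
      using assms unfolding tangent_space_def by blast
    then show ?thesis using True unfolding tvec_of_def by metis
  next
    case False
    then have "X d = 0" using assms(1) unfolding tangent_space_def by blast
    then show ?thesis using False by (simp add: tvec_of_def)
  qed
qed

lemma tangent_space_eqI:
  assumes "X \<in> tangent_space A x" "Y \<in> tangent_space A x" "c \<in> charts_at A x" "X c = Y c"
  shows "X = Y"
  using tvec_of_component assms by metis

text \<open>A metric is an arbitrary function of component families, but on tangent vectors it is determined
  by the components in any single chart.\<close>

lemma coef_eq:
  assumes "X \<in> tangent_space A x" "Y \<in> tangent_space A x" "c \<in> charts_at A x"
  shows "g x X Y = coef A g c (snd c x) (X c) (Y c)"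
  using tvec_of_component assms cinv_chart charts_atD[OF assms(3)]
  unfolding coef_def by (simp add: Let_def)

text \<open>The components of the derivative of a map into the manifold obey the transformation law of
  tangent vectors; used for differentials and for velocities.\<close>

lemma transition_of_map:
  fixes \<psi> :: "'z::euclidean_space \<Rightarrow> 'm"
  assumes d: "d \<in> charts_at A (\<psi> y)" and e: "e \<in> charts_at A (\<psi> y)"
    and S: "y \<in> S" "\<And>z. z \<in> S \<Longrightarrow> \<psi> z \<in> fst d \<inter> fst e"
    and \<psi>: "((snd d \<circ> \<psi>) has_derivative \<psi>') (at y within S)"
  shows "((snd e \<circ> \<psi>) has_derivative
     (\<lambda>u. D (snd d ` (fst d \<inter> fst e)) (snd e \<circ> cinv d) (snd d (\<psi> y)) (\<psi>' u))) (at y within S)"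
proof -
  note dA = charts_atD[OF d] charts_atD[OF e]
  let ?\<tau> = "D (snd d ` (fst d \<inter> fst e)) (snd e \<circ> cinv d) (snd d (\<psi> y))"
  have "((snd e \<circ> cinv d) has_derivative ?\<tau>) (at ((snd d \<circ> \<psi>) y) within (snd d \<circ> \<psi>) ` S)"
    unfolding o_apply[of "snd d" \<psi> y]
    by (rule has_derivative_subset[OF transition_derivative[OF d e]]) (use S in auto)
  from has_derivative_in_compose[OF \<psi> this] show ?thesis
    by (rule has_derivative_transform[rotated 2]) (use S cinv_chart dA in auto)
qed

lemma velocity_component:
  assumes I: "accessible I t" "t \<in> I" and \<gamma>: "continuous (at t within I) \<gamma>" "\<gamma> ` I \<subseteq> M"
    and d: "d \<in> charts_at A (\<gamma> t)" and der: "((snd d \<circ> \<gamma>) has_vector_derivative v) (at t within (I \<inter> \<gamma> -` fst d))"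
  shows "velocity A I \<gamma> t = tvec_of A d (\<gamma> t) v"
proof
  fix e show "velocity A I \<gamma> t e = tvec_of A d (\<gamma> t) v e"
  proof (cases "e \<in> charts_at A (\<gamma> t)")
    case True
    note dA = charts_atD[OF d] charts_atD[OF True]
    have "openin (top_of_set M) (fst d \<inter> fst e)" using atlas_openin dA by blast
    then obtain O' where O': "open O'" "fst d \<inter> fst e = M \<inter> O'" unfolding openin_open by auto
    then obtain N where N: "open N" "t \<in> N" "\<And>s. s \<in> I \<inter> N \<Longrightarrow> \<gamma> s \<in> O'"
      using \<gamma>(1) dA unfolding continuous_within_topological by (metis IntD1 IntD2 IntI)
    have at: "at t within (I \<inter> N) = at t within I"
      by (rule at_within_openin) (use N I in auto)
    have acc: "accessible (I \<inter> N) t" by (rule accessible_openin[OF I(1)]) (use N I in auto)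
    let ?\<tau> = "D (snd d ` (fst d \<inter> fst e)) (snd e \<circ> cinv d) (snd d (\<gamma> t))"
    have "((snd d \<circ> \<gamma>) has_derivative (\<lambda>s. s *\<^sub>R v)) (at t within (I \<inter> N))"
      using der[unfolded has_vector_derivative_def]
      by (rule has_derivative_subset) (use N(3) O'(2) \<gamma>(2) in blast)
    then have d2: "((snd e \<circ> \<gamma>) has_derivative (\<lambda>u. ?\<tau> (u *\<^sub>R v))) (at t within (I \<inter> N))"
      by (rule transition_of_map[where \<psi> = \<gamma> and y = t, OF d True, rotated 2]) (use N I O' \<gamma> in auto)
    have "linear ?\<tau>" using transition_derivative[OF d True] has_derivative_linear by blast
    then have "((snd e \<circ> \<gamma>) has_vector_derivative ?\<tau> v) (at t within I)"
      using d2 unfolding has_vector_derivative_def at by (simp add: linear_scale)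
    moreover have "at t within I \<noteq> bot"
      using accessible_real_limit_point[OF I(1)] trivial_limit_within by blast
    ultimately show ?thesis using True d
      by (simp add: velocity_def tvec_of_def vector_derivative_within)
  qed (simp add: velocity_def tvec_of_def)
qed

end

definition cyl_chart :: "real set \<Rightarrow> ('m, 'e) chart \<Rightarrow> (real \<times> 'm, real \<times> 'e) chart" where
  "cyl_chart J c = (J \<times> fst c, \<lambda>q. (fst q, snd c (snd q)))"

lemma cyl_eq: "cyl J A = cyl_chart J ` A"
  by (simp add: cyl_def cyl_chart_def)

lemma cyl_chart_simps [simp]:
  "fst (cyl_chart J c) = J \<times> fst c" "snd (cyl_chart J c) q = (fst q, snd c (snd q))"
  by (simp_all add: cyl_chart_def)

lemma cyl_chart_image: "snd (cyl_chart J c) ` (J \<times> V) = J \<times> snd c ` V"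
  by (auto simp: image_iff)

lemma cinv_cyl_chart:
  assumes "inj_on (snd c) (fst c)" "p \<in> J \<times> snd c ` fst c"
  shows "cinv (cyl_chart J c) p = (fst p, cinv c (snd p))"
proof -
  have "inj_on (snd (cyl_chart J c)) (fst (cyl_chart J c))"
    using assms(1) by (auto simp: inj_on_def)
  moreover have "(fst p, cinv c (snd p)) \<in> fst (cyl_chart J c)"
    using assms(2) by (auto intro: inv_into_into)
  moreover have "snd (cyl_chart J c) (fst p, cinv c (snd p)) = p"
    using assms(2) by (auto simp: f_inv_into_f)
  ultimately show ?thesis by (metis inv_into_f_f)
qed

lemma atlas_inj: "diff_atlas R M A \<Longrightarrow> c \<in> A \<Longrightarrow> inj_on (snd c) (fst c)"
  by (rule inj_on_inverseI[where g = "cinv c"]) (rule cinv_chart)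


section \<open>Metrics and Christoffel symbols in coordinates\<close>

lemma bilinear_expand:
  fixes B :: "'b::euclidean_space \<Rightarrow> 'c::euclidean_space \<Rightarrow> 'd::real_vector"
  assumes "bilinear B"
  shows "B u w = (\<Sum>i\<in>Basis. \<Sum>j\<in>Basis. ((u \<bullet> i) * (w \<bullet> j)) *\<^sub>R B i j)"
proof -
  have l: "linear (B x)" "linear (\<lambda>x. B x y)" for x y using assms by (auto simp: bilinear_def)
  have "B u w = B (\<Sum>i\<in>Basis. (u \<bullet> i) *\<^sub>R i) w" by (simp add: euclidean_representation)
  also have "\<dots> = (\<Sum>i\<in>Basis. (u \<bullet> i) *\<^sub>R B i w)"
    by (simp only: linear_sum[OF l(2)] linear_scale[OF l(2)])
  also have "\<dots> = (\<Sum>i\<in>Basis. (u \<bullet> i) *\<^sub>R B i (\<Sum>j\<in>Basis. (w \<bullet> j) *\<^sub>R j))"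
    by (simp add: euclidean_representation)
  also have "\<dots> = (\<Sum>i\<in>Basis. \<Sum>j\<in>Basis. ((u \<bullet> i) * (w \<bullet> j)) *\<^sub>R B i j)"
    by (simp only: linear_sum[OF l(1)] linear_scale[OF l(1)] scaleR_sum_right scaleR_scaleR)
  finally show ?thesis .
qed

lemmas bilinear_simps = bilinear_ladd bilinear_radd bilinear_lmul bilinear_rmul
  bilinear_lzero bilinear_rzero bilinear_lneg bilinear_rneg bilinear_lsub bilinear_rsub

text \<open>Compatibility of the connection with the metric, for vector fields \<open>X\<close> and \<open>Y\<close> along a map \<open>P\<close>:
  \<open>\<partial> \<langle>X, Y\<rangle> = \<langle>\<nabla>X, Y\<rangle> + \<langle>X, \<nabla>Y\<rangle>\<close>, where \<open>\<nabla>\<^sub>\<delta> X = X' \<delta> + \<Gamma> (P' \<delta>) X\<close>.  Every differentiation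
  of an orthogonality relation below is an instance.\<close>

lemma metric_along_map_derivative:
  fixes G :: "'b::euclidean_space \<Rightarrow> 'b \<Rightarrow> 'b \<Rightarrow> real" and P :: "'q::euclidean_space \<Rightarrow> 'b"
  assumes bil: "\<And>z. z \<in> U \<Longrightarrow> bilinear (G z)" and \<Gamma>: "bilinear \<Gamma>"
    and dG: "\<And>u w. ((\<lambda>z. G z u w) has_derivative (\<lambda>v. G z0 (\<Gamma> v u) w + G z0 u (\<Gamma> v w))) (at z0 within U)"
    and q: "q \<in> T" "P q = z0" "P ` T \<subseteq> U"
    and P: "(P has_derivative P') (at q within T)"
    and X: "(X has_derivative X') (at q within T)"
    and Y: "(Y has_derivative Y') (at q within T)"
  shows "((\<lambda>q. G (P q) (X q) (Y q)) has_derivative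
     (\<lambda>\<delta>. G z0 (X' \<delta> + \<Gamma> (P' \<delta>) (X q)) (Y q) + G z0 (X q) (Y' \<delta> + \<Gamma> (P' \<delta>) (Y q)))) (at q within T)"
proof -
  have z0: "z0 \<in> U" using q by blast
  let ?g = "G z0"
  have b: "bilinear ?g" using bil z0 .
  have gP: "((\<lambda>q. G (P q) i j) has_derivative (\<lambda>\<delta>. ?g (\<Gamma> (P' \<delta>) i) j + ?g i (\<Gamma> (P' \<delta>) j))) (at q within T)" for i j
    by (rule has_derivative_in_compose[OF P]) (use has_derivative_subset[OF dG q(3)] q in simp)
  let ?d = "\<lambda>\<delta>. (\<Sum>i\<in>Basis. \<Sum>j\<in>Basis.
      ((X q \<bullet> i) * (Y q \<bullet> j)) * (?g (\<Gamma> (P' \<delta>) i) j + ?g i (\<Gamma> (P' \<delta>) j))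
      + ((X q \<bullet> i) * (Y' \<delta> \<bullet> j) + (X' \<delta> \<bullet> i) * (Y q \<bullet> j)) * ?g i j)"
  have "((\<lambda>q. \<Sum>i\<in>Basis. \<Sum>j\<in>Basis. ((X q \<bullet> i) * (Y q \<bullet> j)) * G (P q) i j) has_derivative ?d) (at q within T)"
    unfolding q(2)[symmetric]
    by (intro has_derivative_sum has_derivative_mult has_derivative_inner_left X Y gP[unfolded q(2)[symmetric]])
  then have "((\<lambda>q. G (P q) (X q) (Y q)) has_derivative ?d) (at q within T)"
    by (rule has_derivative_transform[rotated 2]) (use q in \<open>auto simp: bilinear_expand[OF bil, of "P _" "X _" "Y _"]\<close>)
  moreover have "?d \<delta> = ?g (X' \<delta> + \<Gamma> (P' \<delta>) (X q)) (Y q) + ?g (X q) (Y' \<delta> + \<Gamma> (P' \<delta>) (Y q))" for \<delta>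
  proof -
    let ?v = "P' \<delta>"
    have g1: "bilinear (\<lambda>u w. ?g (\<Gamma> ?v u) w)" and g2: "bilinear (\<lambda>u w. ?g u (\<Gamma> ?v w))"
      unfolding bilinear_def by (auto intro!: linearI simp: bilinear_simps[OF b] bilinear_simps[OF \<Gamma>])
    have "?d \<delta> = ?g (\<Gamma> ?v (X q)) (Y q) + ?g (X q) (\<Gamma> ?v (Y q)) + ?g (X q) (Y' \<delta>) + ?g (X' \<delta>) (Y q)"
      unfolding bilinear_expand[OF g1, of "X q" "Y q"] bilinear_expand[OF g2, of "X q" "Y q"]
        bilinear_expand[OF b, of "X q" "Y' \<delta>"] bilinear_expand[OF b, of "X' \<delta>" "Y q"]
      by (simp add: algebra_simps sum.distrib)
    then show ?thesis by (simp add: bilinear_simps[OF b])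
  qed
  ultimately show ?thesis by (simp add: has_derivative_eq_rhs)
qed

text \<open>Riesz representation: \<open>z \<mapsto> g z\<close> is an injective linear map between spaces of equal finite
  dimension.\<close>

lemma positive_form_represents:
  fixes g :: "'b::euclidean_space \<Rightarrow> 'b \<Rightarrow> real"
  assumes b: "bilinear g" and pos: "\<And>u. u \<noteq> 0 \<Longrightarrow> 0 < g u u" and L: "linear L"
  shows "\<exists>!z. \<forall>w. g z w = L w"
proof -
  have l: "linear (g x)" "linear (\<lambda>x. g x y)" for x y using b by (auto simp: bilinear_def)
  define T where "T z = (\<Sum>i\<in>Basis. g z i *\<^sub>R i)" for z
  have Ti: "T z \<bullet> i = g z i" if "i \<in> Basis" for z i
    unfolding T_def using that by simp
  have lT: "linear T"
    by (rule linearI; rule euclidean_eqI) (auto simp: Ti inner_add_left linear_add[OF l(2)] linear_scale[OF l(2)])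
  have eq: "g z w = g z' w" if "T z = T z'" for z z' w
  proof -
    have "g z i = g z' i" if "i \<in> Basis" for i using Ti that \<open>T z = T z'\<close> by metis
    then show ?thesis using linear_eq_on_span[OF l(1) l(1), of Basis z z' w] by simp
  qed
  have inj: "inj T"
  proof (rule injI)
    fix z z' assume "T z = T z'"
    from eq[OF this, of "z - z'"] have "g (z - z') (z - z') = 0"
      by (simp add: bilinear_lsub[OF b])
    then show "z = z'" using pos[of "z - z'"] by fastforce
  qed
  then obtain z where z: "T z = (\<Sum>i\<in>Basis. L i *\<^sub>R i)"
    using linear_injective_imp_surjective[OF lT] by (metis surjD)
  have "g z i = L i" if "i \<in> Basis" for i using Ti[OF that, of z] that z by simp
  then have "g z w = L w" for w using linear_eq_on_span[OF l(1) L, of Basis z w] by simp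
  moreover have "z' = z" if "\<forall>w. g z' w = L w" for z'
  proof (rule ccontr)
    assume "z' \<noteq> z"
    moreover have "g (z' - z) (z' - z) = 0" using that calculation(1) \<open>\<And>w. g z w = L w\<close> by (simp add: bilinear_lsub[OF b])
    ultimately show False using pos[of "z' - z"] by simp
  qed
  ultimately show ?thesis by blast
qed

text \<open>The Koszul formula at a point, with \<open>Dg u w v\<close> in the role of \<open>\<partial>\<^sub>v (g u w)\<close>.\<close>

lemma levi_civita_unique_existence:
  fixes g :: "'b::euclidean_space \<Rightarrow> 'b \<Rightarrow> real" and Dg :: "'b \<Rightarrow> 'b \<Rightarrow> 'b \<Rightarrow> real"
  assumes b: "bilinear g" and sym: "\<And>u w. g u w = g w u" and pos: "\<And>u. u \<noteq> 0 \<Longrightarrow> 0 < g u u"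
    and Dl: "\<And>u w. linear (Dg u w)" and Db: "\<And>v. bilinear (\<lambda>u w. Dg u w v)" and Ds: "\<And>u w. Dg u w = Dg w u"
  shows "\<exists>!\<Gamma>. bilinear \<Gamma> \<and> (\<forall>u w. \<Gamma> u w = \<Gamma> w u) \<and>
     (\<forall>t u w. Dg u w t = g (\<Gamma> t u) w + g u (\<Gamma> t w))"
proof -
  define K where "K v u w = (Dg u w v + Dg v w u - Dg v u w) / 2" for v u w
  note Dsimps = linear_add[OF Dl] linear_scale[OF Dl] bilinear_simps[OF Db]
  have lK: "linear (K v u)" for v u
    unfolding K_def by (rule linearI) (simp_all add: Dsimps field_simps)
  define \<Gamma> where "\<Gamma> v u = (THE z. \<forall>w. g z w = K v u w)" for v u
  have G: "g (\<Gamma> v u) w = K v u w" for v u w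
    using theI'[OF positive_form_represents[OF b pos lK]] unfolding \<Gamma>_def by blast
  have uniq: "z = \<Gamma> v u" if "\<And>w. g z w = K v u w" for z v u
    using positive_form_represents[OF b pos lK, of v u] that G by blast
  have bG: "bilinear \<Gamma>"
    unfolding bilinear_def
    by (intro conjI allI linearI; rule uniq[symmetric])
       (simp_all add: bilinear_simps[OF b] G K_def Dsimps field_simps)
  have sG: "\<Gamma> u w = \<Gamma> w u" for u w
    by (rule uniq) (simp add: G K_def Ds[of u w])
  have cG: "Dg u w t = g (\<Gamma> t u) w + g u (\<Gamma> t w)" for t u w
  proof -
    have "g u (\<Gamma> t w) = K t w u" using G sym by metis
    then show ?thesis using G[of t u w] Ds[of w u] by (simp add: K_def field_simps)
  qed
  show ?thesis
  proof (rule ex1I[of _ \<Gamma>])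
    show "bilinear \<Gamma> \<and> (\<forall>u w. \<Gamma> u w = \<Gamma> w u) \<and> (\<forall>t u w. Dg u w t = g (\<Gamma> t u) w + g u (\<Gamma> t w))"
      using bG sG cG by blast
    fix \<Delta> assume D: "bilinear \<Delta> \<and> (\<forall>u w. \<Delta> u w = \<Delta> w u) \<and> (\<forall>t u w. Dg u w t = g (\<Delta> t u) w + g u (\<Delta> t w))"
    have "\<Delta> v u = \<Gamma> v u" for v u
    proof (rule uniq)
      fix w
      have "Dg u w v = g (\<Delta> v u) w + g u (\<Delta> v w)" "Dg v w u = g (\<Delta> u v) w + g v (\<Delta> u w)"
        "Dg v u w = g (\<Delta> w v) u + g v (\<Delta> w u)" using D by blast+
      moreover have "\<Delta> u v = \<Delta> v u" "\<Delta> w v = \<Delta> v w" "\<Delta> w u = \<Delta> u w" using D by blast+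
      moreover have "g (\<Delta> v w) u = g u (\<Delta> v w)" using sym by blast
      ultimately show "g (\<Delta> v u) w = K v u w" by (simp add: K_def)
    qed
    then show "\<Delta> = \<Gamma>" by (simp add: fun_eq_iff)
  qed
qed

text \<open>Bilinearity and symmetry pass from the metric to its derivative because derivatives within \<open>U\<close>
  are unique.\<close>

lemma metric_derivative_properties:
  fixes G :: "'b::euclidean_space \<Rightarrow> 'b \<Rightarrow> 'b \<Rightarrow> real"
  assumes acc: "accessible U z0" and z0: "z0 \<in> U"
    and bil: "\<And>z. z \<in> U \<Longrightarrow> bilinear (G z)" and sym: "\<And>z u w. z \<in> U \<Longrightarrow> G z u w = G z w u"
    and dG: "\<And>u w. ((\<lambda>z. G z u w) has_derivative Dg u w) (at z0 within U)"
  shows "linear (Dg u w)" "bilinear (\<lambda>u w. Dg u w v)" "Dg u w = Dg w u"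
proof -
  show "linear (Dg u w)" using dG has_derivative_linear by blast
  have eqI: "Dg u w = F" if "((\<lambda>z. H z) has_derivative F) (at z0 within U)" "\<And>z. z \<in> U \<Longrightarrow> G z u w = H z" for u w F H
  proof -
    have "((\<lambda>z. G z u w) has_derivative F) (at z0 within U)"
      by (rule has_derivative_transform[OF z0 _ that(1)]) (use that in auto)
    then show ?thesis using D_eqI[OF acc dG] D_eqI[OF acc] by metis
  qed
  show "Dg u w = Dg w u" for u w by (rule eqI[OF dG sym])
  have "Dg (u + u') w = (\<lambda>v. Dg u w v + Dg u' w v)" "Dg (c *\<^sub>R u) w = (\<lambda>v. c *\<^sub>R Dg u w v)"
    "Dg u (w + w') = (\<lambda>v. Dg u w v + Dg u w' v)" "Dg u (c *\<^sub>R w) = (\<lambda>v. c *\<^sub>R Dg u w v)" for u u' w w' c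
    by (rule eqI, rule has_derivative_add[OF dG dG] has_derivative_scaleR_right[OF dG],
        simp add: bilinear_simps[OF bil])+
  then show "bilinear (\<lambda>u w. Dg u w v)"
    unfolding bilinear_def by (auto intro!: linearI)
qed


section \<open>The boundary identity in coordinates\<close>

text \<open>The boundary relations hold only on a subset of \<open>T\<close> without interior; returning to the same value
  along a sequence on the line in direction \<open>\<delta>\<close>, possibly from one side only, is enough for the
  derivative in that direction to vanish.\<close>

lemma derivative_zero_along:
  fixes f :: "'q::euclidean_space \<Rightarrow> 'c::real_normed_vector"
  assumes f: "(f has_derivative f') (at q within T)" "q \<in> T"
    and z: "\<And>e. e > 0 \<Longrightarrow> \<exists>s. 0 < \<bar>s\<bar> \<and> \<bar>s\<bar> < e \<and> q + s *\<^sub>R \<delta> \<in> T \<and> f (q + s *\<^sub>R \<delta>) = f q"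
  shows "f' \<delta> = 0"
proof -
  let ?S = "{s. q + s *\<^sub>R \<delta> \<in> T \<and> f (q + s *\<^sub>R \<delta>) = f q}"
  have acc: "accessible ?S (0::real)" using z unfolding accessible_def by auto
  have "((\<lambda>s. q + s *\<^sub>R \<delta>) has_derivative (\<lambda>s. s *\<^sub>R \<delta>)) (at 0 within ?S)"
    by (auto intro!: derivative_eq_intros)
  then have "((\<lambda>s. f (q + s *\<^sub>R \<delta>)) has_derivative (\<lambda>s. f' (s *\<^sub>R \<delta>))) (at 0 within ?S)"
    by (rule has_derivative_in_compose) (use has_derivative_subset[OF f(1)] in \<open>auto simp: image_subset_iff\<close>)
  then have "((\<lambda>s. f q) has_derivative (\<lambda>s. f' (s *\<^sub>R \<delta>))) (at 0 within ?S)"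
    by (rule has_derivative_transform[rotated 2]) (use f(2) in auto)
  from D_eqI[OF acc this] D_eqI[OF acc has_derivative_const[of "f q"]]
  have "(\<lambda>s. f' (s *\<^sub>R \<delta>)) = (\<lambda>s. 0)" by simp
  from fun_cong[OF this, of 1] show ?thesis by simp
qed

lemma hypersurface_decomposition:
  fixes L :: "'e::euclidean_space \<Rightarrow> 'b::euclidean_space"
  assumes dim: "DIM('b) = DIM('e) + 1" and L: "linear L" "inj L" and n: "n \<notin> range L"
  obtains c u where "v = c *\<^sub>R n + L u"
proof -
  have sub: "subspace (range L)" using L(1) by (simp add: linear_subspace_image)
  have "dim (range L) = DIM('e)" using dim_image_eq[OF L(1), of UNIV] L(2) by simp
  then have "dim (insert n (range L)) = DIM('b)"
    using n sub dim by (simp add: dim_insert span_eq_iff[THEN iffD2])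
  then have "v \<in> span (insert n (range L))" using dim_eq_full by blast
  then obtain k where "v - k *\<^sub>R n \<in> span (range L)" using span_breakdown_eq by blast
  then obtain u where "v - k *\<^sub>R n = L u" using sub by (auto simp: span_eq_iff[THEN iffD2])
  then show thesis using that[of k u] by (simp add: algebra_simps)
qed

text \<open>The bilinear form \<open>\<langle>\<nabla>\<^sub>v R, w\<rangle>\<close> is symmetric, since \<open>\<langle>R, w\<rangle>\<close> has the symmetric derivative \<open>S\<close>, i.e.
  \<open>R\<close> is a gradient.  It therefore equals half the Lie derivative \<open>L\<^sub>R g\<close>, whose value in
  coordinates is the left-hand side of the assumption \<open>lie\<close>.  This gives \<open>\<nabla>R\<close> without computing
  any Christoffel symbol.\<close>

lemma radial_shape:
  fixes G :: "'b::euclidean_space \<Rightarrow> 'b \<Rightarrow> 'b \<Rightarrow> real"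
  assumes acc: "accessible U z0" and z0: "z0 \<in> U"
    and bil: "\<And>z. z \<in> U \<Longrightarrow> bilinear (G z)" and sym: "\<And>u w. G z0 u w = G z0 w u"
    and \<Gamma>: "bilinear \<Gamma>" and \<Gamma>s: "\<And>u w. \<Gamma> u w = \<Gamma> w u"
    and dG: "\<And>u w. ((\<lambda>z. G z u w) has_derivative (\<lambda>v. G z0 (\<Gamma> v u) w + G z0 u (\<Gamma> v w))) (at z0 within U)"
    and R: "(R has_derivative DR) (at z0 within U)"
    and hess: "\<And>w. ((\<lambda>z. G z (R z) w) has_derivative S w) (at z0 within U)" and hs: "\<And>v w. S w v = S v w"
    and lie: "\<And>v w. G z0 (\<Gamma> (R z0) v) w + G z0 v (\<Gamma> (R z0) w) + G z0 (DR v) w + G z0 v (DR w)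
               = 2 * \<beta> v w"
  shows "G z0 (DR v + \<Gamma> v (R z0)) w = \<beta> v w"
proof -
  have b: "bilinear (G z0)" using bil z0 .
  have "((\<lambda>z. G z (R z) w) has_derivative
      (\<lambda>v. G z0 (DR v + \<Gamma> v (R z0)) w + G z0 (R z0) (0 + \<Gamma> v w))) (at z0 within U)" for w
    by (rule metric_along_map_derivative[where P = "\<lambda>z. z", OF _ \<Gamma> dG z0 refl _
          has_derivative_ident R has_derivative_const]) (use bil in auto)
  then have "S w = (\<lambda>v. G z0 (DR v + \<Gamma> v (R z0)) w + G z0 (R z0) (0 + \<Gamma> v w))" for w
    using D_eqI[OF acc hess] D_eqI[OF acc] by metis
  then have S: "S w v = G z0 (DR v + \<Gamma> v (R z0)) w + G z0 (R z0) (\<Gamma> v w)" for v w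
    by simp
  have s: "G z0 (DR v + \<Gamma> v (R z0)) w = G z0 (DR w + \<Gamma> w (R z0)) v"
    using S[of w v] S[of v w] hs[of w v] arg_cong[OF \<Gamma>s[of v w], of "G z0 (R z0)"] by linarith
  have "G z0 (DR v + \<Gamma> v (R z0)) w = G z0 (DR v) w + G z0 (\<Gamma> (R z0) v) w"
    using \<Gamma>s[of v "R z0"] by (simp add: bilinear_simps[OF b])
  moreover have "G z0 (DR w + \<Gamma> w (R z0)) v = G z0 v (DR w) + G z0 v (\<Gamma> (R z0) w)"
    using \<Gamma>s[of w "R z0"] sym[of "DR w + \<Gamma> w (R z0)" v] by (simp add: bilinear_simps[OF b])
  ultimately show ?thesis using lie[of v w] s by linarith
qed

text \<open>The coordinate form of the identity.  A point \<open>p = (t, y)\<close> of \<open>T\<close> consists of the parameter of the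
  family and a coordinate of \<open>\<Sigma>\<close>; \<open>P\<close> and \<open>N\<close> represent \<open>\<Phi>\<close> and \<open>\<nu>\<close>, the boundary is \<open>y \<bullet> b = 0\<close>, and
  \<open>\<eta>\<close> has the components \<open>e\<close>.  Since \<open>t\<close> may be an end point of the interval, \<open>T\<close> is only required to
  contain short segments (in one of the two senses) in the pure parameter and pure space directions.\<close>

lemma free_boundary_identity:
  fixes P N :: "real \<times> 'e::euclidean_space \<Rightarrow> 'b::euclidean_space" and G :: "'b \<Rightarrow> 'b \<Rightarrow> 'b \<Rightarrow> real"
  assumes dim: "DIM('b) = DIM('e) + 1"
    and bil: "\<And>z. z \<in> U \<Longrightarrow> bilinear (G z)" and sym: "\<And>u w. G z0 u w = G z0 w u"
    and \<Gamma>: "bilinear \<Gamma>" and \<Gamma>s: "\<And>u w. \<Gamma> u w = \<Gamma> w u"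
    and dG: "\<And>u w. ((\<lambda>z. G z u w) has_derivative (\<lambda>v. G z0 (\<Gamma> v u) w + G z0 u (\<Gamma> v w))) (at z0 within U)"
    and q: "q \<in> T" "P q = z0" "P ` T \<subseteq> U"
    and P: "(P has_derivative DP q) (at q within T)"
    and D2: "\<And>\<delta>. ((\<lambda>p. DP p \<delta>) has_derivative D2 \<delta>) (at q within T)" and D2s: "\<And>\<delta> \<epsilon>. D2 \<delta> \<epsilon> = D2 \<epsilon> \<delta>"
    and N: "(N has_derivative DN) (at q within T)"
    and orth: "\<And>p u. p \<in> T \<Longrightarrow> G (P p) (N p) (DP p (0, u)) = 0"
    and unit: "\<And>p. p \<in> T \<Longrightarrow> G (P p) (N p) (N p) = 1"
    and inj: "inj (\<lambda>u. DP q (0, u))"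
    and R: "(R has_derivative DR) (at z0 within U)"
    and rad: "\<And>p. p \<in> T \<Longrightarrow> snd p \<bullet> b = 0 \<Longrightarrow> G (P p) (N p) (R (P p)) = 0"
    and level: "\<And>p. p \<in> T \<Longrightarrow> snd p \<bullet> b = 0 \<Longrightarrow> \<rho> (P p) = r (fst p)"
    and \<rho>: "(\<rho> has_derivative G z0 (R z0)) (at z0 within U)"
    and r: "((\<lambda>p. r (fst p)) has_derivative (\<lambda>\<delta>. fst \<delta> * r')) (at q within T)"
    and e: "e \<bullet> b \<noteq> 0" "DP q (0, e) = R z0" and R1: "G z0 (R z0) (R z0) = 1"
    and shape: "\<And>v w. G z0 (DR v + \<Gamma> v (R z0)) w = \<kappa> * (G z0 v w - G z0 (R z0) v * G z0 (R z0) w)"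
    and bd: "snd q \<bullet> b = 0"
    and dirs: "\<And>\<delta> e. fst \<delta> = 0 \<or> snd \<delta> = 0 \<Longrightarrow> e > 0 \<Longrightarrow>
        \<exists>s. 0 < \<bar>s\<bar> \<and> \<bar>s\<bar> < e \<and> q + s *\<^sub>R \<delta> \<in> T"
  shows "\<exists>F'. ((\<lambda>p. G (P p) (DP p (1, 0)) (N p)) has_derivative F') (at q within T) \<and>
     F' (0, e) - \<kappa> * G z0 (DP q (1, 0)) (N q) = r' * G z0 (DN (0, e) + \<Gamma> (R z0) (N q)) (R z0)"
proof -
  let ?g = "G z0" and ?R = "R z0" and ?n = "N q"
  let ?dP = "DP q"
  have z0: "z0 \<in> U" using q by blast
  have b: "bilinear ?g" using bil z0 .
  have lP: "linear ?dP" using P has_derivative_linear by blast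
  have lL: "linear (\<lambda>u. ?dP (0, u))"
    by (rule linearI) (simp_all flip: linear_add[OF lP] linear_scale[OF lP])
  define nN where "nN \<delta> = DN \<delta> + \<Gamma> (?dP \<delta>) ?n" for \<delta>
  define nP where "nP \<epsilon> \<delta> = D2 \<epsilon> \<delta> + \<Gamma> (?dP \<delta>) (?dP \<epsilon>)" for \<epsilon> \<delta>
  have nP_sym: "nP \<epsilon> \<delta> = nP \<delta> \<epsilon>" for \<epsilon> \<delta> unfolding nP_def using D2s \<Gamma>s by metis
  have compat: "((\<lambda>p. G (P p) (X p) (Y p)) has_derivative
      (\<lambda>\<delta>. ?g (X' \<delta> + \<Gamma> (?dP \<delta>) (X q)) (Y q) + ?g (X q) (Y' \<delta> + \<Gamma> (?dP \<delta>) (Y q)))) (at q within T)"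
    if "(X has_derivative X') (at q within T)" "(Y has_derivative Y') (at q within T)" for X Y X' Y'
    by (rule metric_along_map_derivative[OF _ \<Gamma> dG q P that]) (rule bil)
  have const: "f' \<delta> = 0"
    if f: "(f has_derivative f') (at q within T)" "\<And>p. p \<in> T \<Longrightarrow> f p = k"
      and \<delta>: "fst \<delta> = 0 \<or> snd \<delta> = 0" for f f' \<delta> and k :: real
    by (rule derivative_zero_along[OF f(1) q(1)]) (metis dirs[OF \<delta>] f(2) q(1))
  have bconst: "f' \<delta> = 0"
    if f: "(f has_derivative f') (at q within T)" "\<And>p. p \<in> T \<Longrightarrow> snd p \<bullet> b = 0 \<Longrightarrow> f p = k"
      and \<delta>: "snd \<delta> \<bullet> b = 0" "fst \<delta> = 0 \<or> snd \<delta> = 0" for f f' \<delta> and k :: real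
  proof (rule derivative_zero_along[OF f(1) q(1)])
    fix \<epsilon> :: real assume "\<epsilon> > 0"
    then obtain s where s: "0 < \<bar>s\<bar>" "\<bar>s\<bar> < \<epsilon>" "q + s *\<^sub>R \<delta> \<in> T" using dirs[OF \<delta>(2)] by blast
    have "snd (q + s *\<^sub>R \<delta>) \<bullet> b = 0" using bd \<delta>(1) by (simp add: inner_add_left)
    then show "\<exists>s. 0 < \<bar>s\<bar> \<and> \<bar>s\<bar> < \<epsilon> \<and> q + s *\<^sub>R \<delta> \<in> T \<and> f (q + s *\<^sub>R \<delta>) = f q"
      using s f(2) bd q(1) by metis
  qed
  have n1: "?g ?n ?n = 1" using unit[OF q(1)] q by simp
  have n0: "?g ?n (?dP (0, u)) = 0" for u using orth[OF q(1)] q by simp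
  have nR: "?g ?n ?R = 0" using n0[of e] e by simp
  have dorth: "?g (nN \<delta>) (?dP (0, u)) + ?g ?n (nP (0, u) \<delta>) = 0"
    if "fst \<delta> = 0 \<or> snd \<delta> = 0" for \<delta> u
    using const[OF compat[OF N D2[of "(0, u)"]] orth that]
    unfolding nN_def nP_def by simp
  have dunit: "?g ?n (nN (0, e)) = 0"
  proof -
    have "?g (nN (0, e)) ?n + ?g ?n (nN (0, e)) = 0"
      using const[OF compat[OF N N] unit, of "(0, e)"] unfolding nN_def by simp
    then show ?thesis using sym[of "nN (0, e)" ?n] by simp
  qed
  have drad: "?g (nN \<delta>) ?R + ?g ?n (DR (?dP \<delta>) + \<Gamma> (?dP \<delta>) ?R) = 0"
    if \<delta>: "snd \<delta> \<bullet> b = 0" "fst \<delta> = 0 \<or> snd \<delta> = 0" for \<delta>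
  proof -
    have "((\<lambda>p. R (P p)) has_derivative (\<lambda>\<delta>. DR (?dP \<delta>))) (at q within T)"
      by (rule has_derivative_in_compose[OF P]) (use has_derivative_subset[OF R q(3)] q in simp)
    from bconst[OF compat[OF N this] rad \<delta>] show ?thesis using q(2) unfolding nN_def by simp
  qed
  have dlevel: "?g ?R (?dP \<delta>) = fst \<delta> * r'" if \<delta>: "snd \<delta> \<bullet> b = 0" "fst \<delta> = 0 \<or> snd \<delta> = 0" for \<delta>
  proof -
    have "((\<lambda>p. \<rho> (P p)) has_derivative (\<lambda>\<delta>. ?g ?R (?dP \<delta>))) (at q within T)"
      by (rule has_derivative_in_compose[OF P]) (use has_derivative_subset[OF \<rho> q(3)] q in simp)
    from bconst[OF has_derivative_diff[OF this r] _ \<delta>, of 0] show ?thesis using level by simp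
  qed
  have "?n \<notin> range (\<lambda>u. ?dP (0, u))" using n0 n1 by fastforce
  then obtain c u where V: "?dP (1, 0) = c *\<^sub>R ?n + ?dP (0, u)"
    using hypersurface_decomposition[OF dim lL inj] by blast
  \<comment> \<open>split off the multiple of \<open>e\<close> that makes the remainder tangent to the boundary\<close>
  define \<alpha> where "\<alpha> = (u \<bullet> b) / (e \<bullet> b)"
  define w where "w = u - \<alpha> *\<^sub>R e"
  have wb: "snd (0, w) \<bullet> b = 0" using e unfolding w_def \<alpha>_def by (simp add: inner_diff_left)
  have u: "?dP (0, u) = \<alpha> *\<^sub>R ?R + ?dP (0, w)"
  proof -
    have "u = \<alpha> *\<^sub>R e + w" unfolding w_def by simp
    then show ?thesis using linear_add[OF lL] linear_scale[OF lL] e(2) by metis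
  qed
  have w0: "?g ?R (?dP (0, w)) = 0" using dlevel[OF wb] by simp
  have V1: "?g ?R (?dP (1, 0)) = r'" using dlevel[of "(1, 0)"] by simp
  then have \<alpha>: "\<alpha> = r'"
    unfolding V u using w0 R1 nR sym[of ?R ?n] by (simp add: bilinear_simps[OF b])
  have nw: "?g (nN (0, w)) ?R = 0"
    using drad[OF wb] sym[of ?n "DR (?dP (0, w)) + \<Gamma> (?dP (0, w)) ?R"] shape[of "?dP (0, w)" ?n]
      n0[of w] sym[of ?n "?dP (0, w)"] w0 by simp
  \<comment> \<open>the symmetry of the second fundamental form: \<open>A(\<eta>, w) = A(w, \<eta>)\<close>\<close>
  have ew: "?g (nN (0, e)) (?dP (0, w)) = 0"
    using dorth[of "(0, e)" w] dorth[of "(0, w)" e] nw e(2) nP_sym by simp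
  have A: "?g (?dP (1, 0)) (nN (0, e)) = r' * ?g (nN (0, e)) ?R"
    unfolding V u using dunit ew sym[of "nN (0, e)" ?R] sym[of "nN (0, e)" "?dP (0, w)"] \<alpha> by (simp add: bilinear_simps[OF b])
  have B: "?g (nP (1, 0) (0, e)) ?n = \<kappa> * ?g (?dP (1, 0)) ?n"
  proof -
    have "?g ?n (nP (0, e) (1, 0)) = - ?g (nN (1, 0)) ?R" using dorth[of "(1, 0)" e] e(2) by simp
    also have "\<dots> = ?g (DR (?dP (1, 0)) + \<Gamma> (?dP (1, 0)) ?R) ?n"
      using drad[of "(1, 0)"] sym[of ?n "DR (?dP (1, 0)) + \<Gamma> (?dP (1, 0)) ?R"] by simp
    also have "\<dots> = \<kappa> * ?g (?dP (1, 0)) ?n" using shape nR sym[of ?R ?n] by simp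
    finally show ?thesis using nP_sym sym by metis
  qed
  let ?F = "\<lambda>\<delta>. ?g (nP (1, 0) \<delta>) ?n + ?g (?dP (1, 0)) (nN \<delta>)"
  have "((\<lambda>p. G (P p) (DP p (1, 0)) (N p)) has_derivative ?F) (at q within T)"
    using compat[OF D2[of "(1, 0)"] N] unfolding nN_def nP_def .
  moreover have "?F (0, e) - \<kappa> * ?g (?dP (1, 0)) ?n = r' * ?g (DN (0, e) + \<Gamma> ?R ?n) ?R"
    using A B e(2) unfolding nN_def by simp
  ultimately show ?thesis by (intro exI[of _ ?F] conjI)
qed


section \<open>The Levi-Civita connection and differentials in charts\<close>

lemma open_vimage_chart:
  fixes f :: "'s::topological_space \<Rightarrow> 'k::topological_space"
  assumes "continuous_on UNIV f" "range f \<subseteq> M'" "openin (top_of_set M') V"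
  shows "openin (top_of_set UNIV) (f -` V)"
proof -
  obtain O' where O': "open O'" "V = M' \<inter> O'" using assms(3) unfolding openin_open by auto
  then have "f -` V = f -` O'" using assms(2) by auto
  then show ?thesis using open_vimage[OF O'(1) assms(1)] by simp
qed

text \<open>The differential is defined by its components in all charts of the target separately; the
  transformation law between them is the chain rule.\<close>

lemma push_tangent:
  fixes A :: "('s::topological_space, 'e::euclidean_space) chart set"
    and B :: "('k::topological_space, 'b::euclidean_space) chart set"
  assumes A: "diff_atlas R UNIV A" and B: "diff_atlas R' M' B" and f: "smooth_map A B f"
  shows "push A B f x X \<in> tangent_space B (f x)"
proof -
  have cA: "carrier A = UNIV" "carrier B = M'" using atlas_carrier A B by auto
  have f1: "continuous_on UNIV f" "range f \<subseteq> M'" using f cA unfolding smooth_map_def by auto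
  define c where "c = chart_at A x"
  have c: "c \<in> charts_at A x" unfolding c_def by (rule chart_at) (simp add: cA)
  note cA' = charts_atD[OF c]
  define F where "F d = D (snd c ` (fst c \<inter> f -` fst d)) (snd d \<circ> f \<circ> cinv c) (snd c x)"
    for d :: "('k, 'b) chart"
  have o: "openin (top_of_set UNIV) (f -` V)" if "openin (top_of_set M') V" for V
    using open_vimage_chart[OF f1 that] .
  have F: "((snd d \<circ> f \<circ> cinv c) has_derivative F d) (at (snd c x) within snd c ` (fst c \<inter> f -` fst d))"
    if "d \<in> charts_at B (f x)" for d
  proof -
    have "smooth_on (snd c ` (fst c \<inter> f -` fst d)) (snd d \<circ> f \<circ> cinv c)"
      using f cA' charts_atD[OF that] unfolding smooth_map_def by blast
    moreover have "snd c x \<in> snd c ` (fst c \<inter> f -` fst d)" using cA' charts_atD[OF that] by auto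
    ultimately show ?thesis unfolding F_def by (intro has_derivative_D smooth_on_differentiable)
  qed
  have law: "F e u = D (snd d ` (fst d \<inter> fst e)) (snd e \<circ> cinv d) (snd d (f x)) (F d u)"
    if d: "d \<in> charts_at B (f x)" and e: "e \<in> charts_at B (f x)" for d e u
  proof -
    note dB = charts_atD[OF d] charts_atD[OF e]
    let ?S = "snd c ` (fst c \<inter> f -` (fst d \<inter> fst e))"
    have x: "f x = (f \<circ> cinv c) (snd c x)" using cinv_chart[OF A] cA' by simp
    have oV: "openin (top_of_set M') (fst d \<inter> fst e)" "openin (top_of_set M') (fst e)"
      using atlas_openin[OF B] dB by blast+
    have *: "((snd d \<circ> (f \<circ> cinv c)) has_derivative F d) (at (snd c x) within ?S)"
      using has_derivative_subset[OF F[OF d], of ?S] by (auto simp: o_assoc)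
    have "((snd e \<circ> (f \<circ> cinv c)) has_derivative
        (\<lambda>u. D (snd d ` (fst d \<inter> fst e)) (snd e \<circ> cinv d) (snd d (f x)) (F d u))) (at (snd c x) within ?S)"
      by (rule transition_of_map[OF B d[unfolded x] e[unfolded x] _ _ *, folded x])
         (use cA' dB cinv_chart[OF A] in auto)
    moreover have "at (snd c x) within ?S = at (snd c x) within snd c ` (fst c \<inter> f -` fst e)"
      by (rule at_within_chart_image[OF A cA'(1) o[OF oV(1)] o[OF oV(2)]]) (use cA' dB in auto)
    moreover have "accessible (snd c ` (fst c \<inter> f -` fst e)) (snd c x)"
      by (rule chart_image_accessible[OF A]) (use cA' dB o oV in auto)
    ultimately show ?thesis
      using D_eqI[of "snd c ` (fst c \<inter> f -` fst e)" "snd c x" "snd e \<circ> f \<circ> cinv c"]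
      unfolding F_def[of e] o_assoc by metis
  qed
  have push: "push A B f x X d = (if d \<in> charts_at B (f x) then F d (X c) else 0)" for d
    unfolding push_def F_def c_def by (simp add: Let_def)
  show ?thesis unfolding tangent_space_def mem_Collect_eq
  proof (intro conjI ballI allI impI)
    fix d e assume d: "d \<in> charts_at B (f x)" and e: "e \<in> charts_at B (f x)"
    show "push A B f x X e = D (snd d ` (fst d \<inter> fst e)) (snd e \<circ> cinv d) (snd d (f x)) (push A B f x X d)"
      by (simp only: push d e if_True) (rule law[OF d e])
  qed (simp add: push)
qed

text \<open>Existence and uniqueness in the pointwise Koszul formula turn the definite description of the
  Christoffel symbols into their defining equations.  Differentiability and positivity are asked for at
  the one point only, so that the lemma applies to polar coordinates away from the centre.\<close>

lemma christoffel_properties: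
  fixes B :: "('k::topological_space, 'b::euclidean_space) chart set"
  assumes B: "diff_atlas R' M' B" and d: "d \<in> charts_at B p"
    and bil: "\<And>z. z \<in> snd d ` fst d \<Longrightarrow> bilinear (coef B g d z)"
    and sym: "\<And>z u w. z \<in> snd d ` fst d \<Longrightarrow> coef B g d z u w = coef B g d z w u"
    and pos: "\<And>u. u \<noteq> 0 \<Longrightarrow> 0 < coef B g d (snd d p) u u"
    and dG: "\<And>u w. ((\<lambda>z. coef B g d z u w) has_derivative DG u w) (at (snd d p) within snd d ` fst d)"
  shows "bilinear (christoffel B g d (snd d p))"
    and "christoffel B g d (snd d p) u w = christoffel B g d (snd d p) w u"
    and "DG u w = (\<lambda>v. coef B g d (snd d p) (christoffel B g d (snd d p) v u) w
                    + coef B g d (snd d p) u (christoffel B g d (snd d p) v w))"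
proof -
  let ?U = "snd d ` fst d" and ?z = "snd d p"
  note dB = charts_atD[OF d]
  have z: "?z \<in> ?U" using dB by blast
  have acc: "accessible ?U ?z" by (rule chart_range_accessible[OF B dB])
  have P: "linear (DG u w)" "bilinear (\<lambda>u w. DG u w v)" "DG u w = DG w u" for u w v
    by (rule metric_derivative_properties[OF acc z, of "coef B g d"]; use bil sym dG in blast)+
  have "D ?U (\<lambda>z. coef B g d z u w) ?z = DG u w" for u w by (rule D_eqI[OF acc dG])
  then have chr: "christoffel B g d ?z = (THE \<Gamma>. bilinear \<Gamma> \<and> (\<forall>u w. \<Gamma> u w = \<Gamma> w u) \<and>
     (\<forall>t u w. DG u w t = coef B g d ?z (\<Gamma> t u) w + coef B g d ?z u (\<Gamma> t w)))"
    unfolding christoffel_def by simp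
  have ex: "\<exists>!\<Gamma>. bilinear \<Gamma> \<and> (\<forall>u w. \<Gamma> u w = \<Gamma> w u) \<and>
     (\<forall>t u w. DG u w t = coef B g d ?z (\<Gamma> t u) w + coef B g d ?z u (\<Gamma> t w))"
    by (rule levi_civita_unique_existence[OF bil[OF z] sym[OF z] pos P])
  have *: "bilinear (christoffel B g d ?z) \<and> (\<forall>u w. christoffel B g d ?z u w = christoffel B g d ?z w u) \<and>
     (\<forall>t u w. DG u w t = coef B g d ?z (christoffel B g d ?z t u) w + coef B g d ?z u (christoffel B g d ?z t w))"
    unfolding chr by (rule theI'[OF ex])
  then show "bilinear (christoffel B g d ?z)" by blast
  from * show "christoffel B g d ?z u w = christoffel B g d ?z w u" by blast
  from * show "DG u w = (\<lambda>v. coef B g d ?z (christoffel B g d ?z v u) w + coef B g d ?z u (christoffel B g d ?z v w))"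
    by (intro ext) blast
qed


section \<open>The boundary identity on manifolds\<close>

text \<open>The ambient hypotheses are all stated in one chart \<open>d\<close> at the boundary point: \<open>rep\<close> says that there
  the metric only looks at components in \<open>d\<close>, which spares the proof that covariant derivatives
  transform as tangent vectors; \<open>hess\<close>, \<open>hess_sym\<close> and \<open>lie\<close> express that \<open>Rc\<close>, the field \<open>\<partial>\<^sub>\<rho>\<close> in
  coordinates, is a gradient with umbilic level sets of principal curvature \<open>\<kappa>\<close>.  On \<open>\<Sigma>\<close> the chart is one
  in which \<open>x\<close> lies on the boundary hyperplane and \<open>\<eta>\<close> points across it, as provided by the
  definition of the conormal; nearby points of that hyperplane are then boundary points by
  definition.\<close>

theorem free_boundary_variation:
  fixes A :: "('s::topological_space, 'e::euclidean_space) chart set"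
    and B :: "('k::topological_space, 'b::euclidean_space) chart set"
  assumes I: "proper_interval I" and smA: "smooth_atlas half_space UNIV A" and B: "diff_atlas R' M' B"
    and dim: "DIM('b) = DIM('e) + 1"
    and fam: "minimal_family I A B g \<Phi> \<nu>" and fb: "free_boundary I A B g \<rho> R r \<Phi> \<eta>"
    and a: "a \<in> I" and x: "x \<in> bdry A" and d: "d \<in> charts_at B (\<Phi> (a, x))"
    and z0_def: "z0 = snd d (\<Phi> (a, x))" and U_def: "U = snd d ` fst d" and G_def: "G = coef B g d"
    and rep: "\<And>v w. g (\<Phi> (a, x)) v w = G z0 (v d) (w d)"
    and bil: "\<And>z. z \<in> U \<Longrightarrow> bilinear (G z)" and sym: "\<And>z u w. z \<in> U \<Longrightarrow> G z u w = G z w u"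
    and pos: "\<And>u. u \<noteq> 0 \<Longrightarrow> 0 < G z0 u u"
    and dG: "\<And>u w. ((\<lambda>z. G z u w) has_derivative DG u w) (at z0 within U)"
    and Rc: "\<And>q. q \<in> fst d \<Longrightarrow> \<rho> q \<in> r ` I \<Longrightarrow> R q d = Rc (snd d q)"
    and DR: "(Rc has_derivative DR) (at z0 within U)"
    and d\<rho>: "((\<rho> \<circ> cinv d) has_derivative G z0 (Rc z0)) (at z0 within U)"
    and hess: "\<And>w. ((\<lambda>z. G z (Rc z) w) has_derivative S w) (at z0 within U)"
    and hess_sym: "\<And>v w. S w v = S v w"
    and lie: "\<And>v w. DG v w (Rc z0) + G z0 (DR v) w + G z0 v (DR w)
       = 2 * (\<kappa> * (G z0 v w - G z0 (Rc z0) v * G z0 (Rc z0) w))"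
    and dr: "(r has_vector_derivative r') (at a within I)"
  shows "dir_deriv A (normal_speed I B g \<Phi> \<nu> a) x (\<eta> a x) - \<kappa> * normal_speed I B g \<Phi> \<nu> a x
    = r' * second_ff A B g (\<lambda>x. \<Phi> (a, x)) (\<lambda>x. \<nu> (a, x)) x (\<eta> a x) (\<eta> a x)"
proof -
  have A: "diff_atlas half_space UNIV A"
    by (rule smooth_atlas_imp_diff_atlas[OF smA accessible_half_space])
  have cA: "carrier A = UNIV" "carrier B = M'" using atlas_carrier A B by auto
  have cyl: "carrier (cyl I A) = I \<times> UNIV"
    using cA unfolding carrier_def cyl_def by auto
  note dB = charts_atD[OF d]
  have oneA: "openin (top_of_set (UNIV :: 's set)) UNIV" by simp
  have con: "outward_unit_conormal A (induced A B g (\<lambda>x. \<Phi> (a, x))) x (\<eta> a x)"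
    using fb a x unfolding free_boundary_def by blast
  then obtain c where c: "c \<in> charts_at A x" "snd c x \<bullet> bdir = 0" "\<eta> a x c \<bullet> bdir < 0"
    unfolding outward_unit_conormal_def by blast
  note cAt = charts_atD[OF c(1)]
  define V where "V = snd c ` fst c"
  define y0 where "y0 = snd c x"
  define e where "e = \<eta> a x c"
  have inv: "cinv c y \<in> fst c" "snd c (cinv c y) = y" if "y \<in> V" for y
    using that cinv_chart[OF A cAt(1)] unfolding V_def by auto
  have Vo: "openin (top_of_set half_space) V"
    using chart_image_openin[OF A cAt(1) oneA] unfolding V_def by simp
  define C where "C = cyl_chart I c"
  have C: "C \<in> cyl I A" using cAt unfolding C_def cyl_eq by blast
  have cinvC: "cinv C p = (fst p, cinv c (snd p))" if "p \<in> I \<times> V" for p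
    using cinv_cyl_chart[OF atlas_inj[OF A cAt(1)]] that unfolding C_def V_def by blast
  define T0 where "T0 = snd C ` (fst C \<inter> \<Phi> -` fst d)"
  have T0: "p \<in> T0 \<longleftrightarrow> p \<in> I \<times> V \<and> \<Phi> (fst p, cinv c (snd p)) \<in> fst d" for p
    unfolding T0_def C_def V_def using cinv_chart[OF A cAt(1)]
    by (cases p) (force simp: image_iff)
  define P where "P = snd d \<circ> \<Phi> \<circ> cinv C"
  define N where "N p = \<nu> (cinv C p) d" for p
  have P: "P p = snd d (\<Phi> (fst p, cinv c (snd p)))" and N: "N p = \<nu> (fst p, cinv c (snd p)) d"
    if "p \<in> I \<times> V" for p
    using cinvC[OF that] unfolding P_def N_def by simp_all
  have sm: "smooth_map (cyl I A) B \<Phi>" "smooth_field_along (cyl I A) B \<Phi> \<nu>"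
    using fam unfolding minimal_family_def by blast+
  have smP: "smooth_on T0 P" using sm(1) C dB unfolding smooth_map_def P_def T0_def by blast
  have smN: "smooth_on T0 N" using sm(2) C dB unfolding smooth_field_along_def N_def T0_def by blast
  have \<Phi>c: "continuous_on (I \<times> UNIV) \<Phi>" "\<Phi> ` (I \<times> UNIV) \<subseteq> M'"
    using sm(1) cyl cA unfolding smooth_map_def by auto
  have T0o: "openin (top_of_set (I \<times> V)) T0"
  proof -
    have cc: "continuous_on V (cinv c)"
      using atlas_homeo[OF A cAt(1)] unfolding V_def homeomorphism_def by blast
    let ?\<psi> = "\<lambda>p. \<Phi> (fst p, cinv c (snd p))"
    have "continuous_on (I \<times> V) (\<lambda>p. (fst p, cinv c (snd p)))"
      by (intro continuous_intros continuous_on_compose2[OF cc]) auto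
    then have "continuous_on (I \<times> V) ?\<psi>" by (rule continuous_on_compose2[OF \<Phi>c(1)]) auto
    moreover have "?\<psi> \<in> (I \<times> V) \<rightarrow> M'" using \<Phi>c(2) by auto
    ultimately have "openin (top_of_set (I \<times> V)) (I \<times> V \<inter> ?\<psi> -` fst d)"
      using continuous_openin_preimage atlas_openin[OF B dB(1)] by blast
    moreover have "T0 = I \<times> V \<inter> ?\<psi> -` fst d" using T0 by auto
    ultimately show ?thesis by simp
  qed
  define q where "q = (a, y0)"
  have q0: "q \<in> T0" unfolding T0 q_def y0_def V_def using a cAt dB cinv_chart[OF A cAt(1)] by auto
  obtain O1 DP D2 where O1: "open O1" "q \<in> O1"
    and DP0: "\<And>p. p \<in> T0 \<inter> O1 \<Longrightarrow> (P has_derivative DP p) (at p within T0)"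
    and D20: "\<And>\<delta>. ((\<lambda>p. DP p \<delta>) has_derivative D2 \<delta>) (at q)" and D2s: "\<And>\<delta> \<epsilon>. D2 \<delta> \<epsilon> = D2 \<epsilon> \<delta>"
    using smooth_on_second_order[OF smP q0] by blast
  define T where "T = T0 \<inter> O1"
  have q: "q \<in> T" using q0 O1 unfolding T_def by blast
  have TIV: "p \<in> I \<times> V" "p \<in> T0" if "p \<in> T" for p using that T0 unfolding T_def by auto
  have To: "openin (top_of_set (I \<times> V)) T" unfolding T_def by (intro openin_Int_open T0o O1)
  have ToI: "openin (top_of_set (I \<times> half_space)) T"
    by (rule openin_trans[OF To]) (intro openin_Times openin_subtopology_self Vo)
  have PU: "P ` T \<subseteq> U" using P T0 TIV unfolding U_def by auto
  have PqT: "P q = z0" "snd q = y0" "fst q = a" "cinv c y0 = x"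
    using P[OF TIV(1)[OF q]] cinv_chart[OF A cAt(1,2)] unfolding q_def z0_def y0_def by auto
  have Dq: "(P has_derivative DP q) (at q within T)"
    using DP0[of q] q has_derivative_subset unfolding T_def by blast
  obtain DN where DN0: "(N has_derivative DN) (at q within T0)"
    using smooth_on_differentiable[OF smN q0] unfolding differentiable_def by blast
  then have DN: "(N has_derivative DN) (at q within T)"
    unfolding T_def by (rule has_derivative_subset) blast
  have slice: "((F \<circ> cinv c) has_derivative (\<lambda>u. H' (0, u)))
      (at (snd c x') within snd c ` (fst c \<inter> (\<lambda>x. \<Phi> (t, x)) -` fst d))"
    if H: "(H has_derivative H') (at (t, snd c x') within T0)" "t \<in> I" "x' \<in> fst c" "\<Phi> (t, x') \<in> fst d"
      and F: "\<And>x''. x'' \<in> fst c \<Longrightarrow> \<Phi> (t, x'') \<in> fst d \<Longrightarrow> F x'' = H (t, snd c x'')"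
    for F :: "'s \<Rightarrow> 'b" and H H' t x'
  proof -
    let ?S = "snd c ` (fst c \<inter> (\<lambda>x. \<Phi> (t, x)) -` fst d)"
    have S: "(\<lambda>y. (t, y)) ` ?S \<subseteq> T0"
      using that(2) cinv_chart[OF A cAt(1)] T0 unfolding V_def by auto
    have "((\<lambda>y. (t, y)) has_derivative (\<lambda>u. (0, u))) (at (snd c x') within ?S)"
      by (auto intro!: derivative_eq_intros)
    from has_derivative_in_compose[OF this has_derivative_subset[OF H(1) S]]
    show ?thesis
      by (rule has_derivative_transform[rotated 2]) (use that cinv_chart[OF A cAt(1)] in auto)
  qed
  have smt: "smooth_map A B (\<lambda>x. \<Phi> (t, x))" and
    injt: "\<And>x. inj_on (push A B (\<lambda>x. \<Phi> (t, x)) x) (tangent_space A x)" if "t \<in> I" for t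
    using fam that cA unfolding minimal_family_def immersion_def by blast+
  have open_t: "openin (top_of_set UNIV) ((\<lambda>x. \<Phi> (t, x)) -` fst d)" if "t \<in> I" for t
    using smt[OF that] cA open_vimage_chart[OF _ _ atlas_openin[OF B dB(1)]]
    unfolding smooth_map_def by auto
  have pt: "push A B (\<lambda>x. \<Phi> (t, x)) x' X \<in> tangent_space B (\<Phi> (t, x'))" if "t \<in> I" for t x' X
    using push_tangent[OF A B smt[OF that]] .
  have pts: "t \<in> I" "cinv c y \<in> fst c" "snd c (cinv c y) = y" "c \<in> charts_at A (cinv c y)"
    "d \<in> charts_at B (\<Phi> (t, cinv c y))" "\<Phi> (t, cinv c y) \<in> fst d" "P (t, y) = snd d (\<Phi> (t, cinv c y))"
    "N (t, y) = \<nu> (t, cinv c y) d"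
    if "(t, y) \<in> T" for t y
    using TIV[OF that] T0[of "(t, y)"] inv cAt dB P N unfolding charts_at_def by auto
  have push_c: "push A B (\<lambda>x. \<Phi> (t, x)) (cinv c y) X d = DP (t, y) (0, X c)"
    if p: "(t, y) \<in> T" and X: "X \<in> tangent_space A (cinv c y)" for t y X
  proof -
    note pp = pts[OF p]
    let ?c = "chart_at A (cinv c y)"
    have c': "?c \<in> charts_at A (cinv c y)" by (rule chart_at) (simp add: cA)
    have "(((\<lambda>x. snd d (\<Phi> (t, x))) \<circ> cinv c) has_derivative (\<lambda>u. DP (t, y) (0, u)))
       (at (snd c (cinv c y)) within snd c ` (fst c \<inter> (\<lambda>x. \<Phi> (t, x)) -` fst d))"
      by (rule slice) (use DP0[of "(t, y)"] p pp P inv in \<open>auto simp: T_def V_def cinv_chart[OF A cAt(1)]\<close>)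
    from D_chart_change[OF A pp(4) c' open_t[OF pp(1)] _ this X]
    show ?thesis using pp unfolding push_def by (simp add: Let_def o_def)
  qed
  have Gg: "g (\<Phi> (t, cinv c y)) v w = G (P (t, y)) (v d) (w d)"
    if p: "(t, y) \<in> T" and "v \<in> tangent_space B (\<Phi> (t, cinv c y))" "w \<in> tangent_space B (\<Phi> (t, cinv c y))"
    for t y v w
    using coef_eq[OF B that(2,3) pts(5)[OF p]] pts(7)[OF p] unfolding G_def by simp
  have \<nu>t: "\<nu> (t, x') \<in> tangent_space B (\<Phi> (t, x'))" if "t \<in> I" for t x'
    using sm(2) that cyl unfolding smooth_field_along_def by auto
  have un: "g (\<Phi> (t, x')) (\<nu> (t, x')) (\<nu> (t, x')) = 1"
    "\<And>X. X \<in> tangent_space A x' \<Longrightarrow> g (\<Phi> (t, x')) (\<nu> (t, x')) (push A B (\<lambda>x. \<Phi> (t, x)) x' X) = 0"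
    if "t \<in> I" for t x'
    using fam that cA unfolding minimal_family_def unit_normal_def by blast+
  have orth: "G (P p) (N p) (DP p (0, u)) = 0" and unit: "G (P p) (N p) (N p) = 1" if "p \<in> T" for p u
  proof -
    obtain t y where p: "p = (t, y)" by (cases p)
    note pp = pts[OF that[unfolded p]]
    have X: "tvec_of A c (cinv c y) u \<in> tangent_space A (cinv c y)" by (rule tvec_of_tangent[OF A pp(4)])
    show "G (P p) (N p) (DP p (0, u)) = 0"
      using Gg[OF that[unfolded p] \<nu>t[OF pp(1)] pt[OF pp(1)]] un(2)[OF pp(1) X]
        push_c[OF that[unfolded p] X] tvec_of_same[OF A pp(4)] pp(8) p by simp
    show "G (P p) (N p) (N p) = 1"
      using Gg[OF that[unfolded p] \<nu>t[OF pp(1)] \<nu>t[OF pp(1)]] un(1)[OF pp(1)] pp(8) p by simp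
  qed
  have bd: "\<rho> (\<Phi> (t, cinv c y)) = r t" "\<eta> t (cinv c y) \<in> tangent_space A (cinv c y)"
      "push A B (\<lambda>x. \<Phi> (t, x)) (cinv c y) (\<eta> t (cinv c y)) = R (\<Phi> (t, cinv c y))"
      "R (\<Phi> (t, cinv c y)) d = Rc (P (t, y))"
    if p: "(t, y) \<in> T" and "y \<bullet> bdir = 0" for t y
  proof -
    note pp = pts[OF p]
    have "cinv c y \<in> bdry A" unfolding bdry_def using pp that(2) by (auto intro!: bexI[of _ c])
    then show *: "\<rho> (\<Phi> (t, cinv c y)) = r t" "\<eta> t (cinv c y) \<in> tangent_space A (cinv c y)"
      "push A B (\<lambda>x. \<Phi> (t, x)) (cinv c y) (\<eta> t (cinv c y)) = R (\<Phi> (t, cinv c y))"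
      using fb pp(1) unfolding free_boundary_def outward_unit_conormal_def by blast+
    then show "R (\<Phi> (t, cinv c y)) d = Rc (P (t, y))" using Rc pp by simp
  qed
  have rad: "G (P p) (N p) (Rc (P p)) = 0" and level: "(\<rho> \<circ> cinv d) (P p) = r (fst p)"
    if "p \<in> T" "snd p \<bullet> bdir = 0" for p
  proof -
    obtain t y where p: "p = (t, y)" by (cases p)
    have pT: "(t, y) \<in> T" "y \<bullet> bdir = 0" using that p by auto
    note pp = pts[OF pT(1)] and bb = bd[OF pT]
    show "G (P p) (N p) (Rc (P p)) = 0"
      using Gg[OF pT(1) \<nu>t[OF pp(1)] pt[OF pp(1)], of "\<eta> t (cinv c y)"] un(2)[OF pp(1) bb(2)] bb pp(8) p by simp
    show "(\<rho> \<circ> cinv d) (P p) = r (fst p)"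
      using bb(1) pp cinv_chart[OF B dB(1)] p by simp
  qed
  have qT: "(a, y0) \<in> T" "y0 \<bullet> bdir = 0" using q c(2) unfolding q_def y0_def by auto
  note bq = bd[OF qT, unfolded PqT]
  have eq: "DP q (0, e) = Rc z0"
    using push_c[OF qT(1) bq(2)[folded PqT(4)]] bq PqT unfolding e_def q_def[symmetric] by simp
  have R1: "G z0 (Rc z0) (Rc z0) = 1"
  proof -
    have "g (\<Phi> (a, x)) (R (\<Phi> (a, x))) (R (\<Phi> (a, x))) = 1"
      using con bq(3) unfolding outward_unit_conormal_def induced_def by simp
    then show ?thesis using rep bq(4) PqT(1) unfolding q_def by simp
  qed
  have inj: "inj (\<lambda>u. DP q (0, u))"
  proof (rule injI)
    fix u u' assume uu: "DP q (0, u) = DP q (0, u')"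
    let ?X = "tvec_of A c x u" and ?Y = "tvec_of A c x u'"
    have XY: "?X \<in> tangent_space A x" "?Y \<in> tangent_space A x" using tvec_of_tangent[OF A c(1)] by auto
    have "push A B (\<lambda>x. \<Phi> (a, x)) x ?X d = push A B (\<lambda>x. \<Phi> (a, x)) x ?Y d"
      using push_c[OF qT(1), unfolded PqT(4)] XY uu tvec_of_same[OF A c(1)] unfolding q_def by simp
    then have "push A B (\<lambda>x. \<Phi> (a, x)) x ?X = push A B (\<lambda>x. \<Phi> (a, x)) x ?Y"
      by (rule tangent_space_eqI[OF B pt[OF a] pt[OF a] d])
    then have "?X = ?Y" using injt[OF a] XY unfolding inj_on_def by blast
    then show "u = u'" using tvec_of_same[OF A c(1)] by metis
  qed
  have dirs: "\<exists>s. 0 < \<bar>s\<bar> \<and> \<bar>s\<bar> < \<epsilon> \<and> q + s *\<^sub>R \<delta> \<in> T"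
    if \<delta>: "fst \<delta> = 0 \<or> snd \<delta> = 0" and eps: "\<epsilon> > 0" for \<delta> \<epsilon>
  proof -
    obtain O2 where O2: "open O2" "T = (I \<times> half_space) \<inter> O2" using ToI unfolding openin_open by auto
    then obtain k where k: "k > 0" "ball q k \<subseteq> O2" using q open_contains_ball by blast
    define k' where "k' = min \<epsilon> (k / (norm \<delta> + 1))"
    have k': "k' > 0" "k' \<le> \<epsilon>" unfolding k'_def using eps k by (auto simp: add_nonneg_pos)
    have near: "q + s *\<^sub>R \<delta> \<in> O2" if "\<bar>s\<bar> < k'" for s
    proof -
      have "\<bar>s\<bar> * norm \<delta> \<le> \<bar>s\<bar> * (norm \<delta> + 1)" by (intro mult_left_mono) auto
      also have "\<dots> < k" using that unfolding k'_def by (simp add: pos_less_divide_eq add_nonneg_pos)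
      finally have "q + s *\<^sub>R \<delta> \<in> ball q k" by (simp add: dist_norm)
      then show ?thesis using k(2) by blast
    qed
    have "\<exists>s. 0 < \<bar>s\<bar> \<and> \<bar>s\<bar> < k' \<and> a + s * fst \<delta> \<in> I \<and> y0 + s *\<^sub>R snd \<delta> \<in> half_space"
    proof (cases "fst \<delta> = 0")
      case True
      \<comment> \<open>at a boundary point of the half-space only one sense of the direction stays inside\<close>
      define s where "s = (if snd \<delta> \<bullet> bdir \<ge> 0 then k'/2 else - (k'/2))"
      have "y0 + s *\<^sub>R snd \<delta> \<in> half_space"
        using qT(2) k'(1) unfolding half_space_def s_def by (auto simp: inner_add_left mult_nonneg_nonpos)
      then show ?thesis using True a k' by (intro exI[of _ s]) (auto simp: s_def)
    next
      case False
      then have s0: "snd \<delta> = 0" using \<delta> by blast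
      obtain t where t: "0 < \<bar>t\<bar>" "\<bar>t\<bar> < k' * \<bar>fst \<delta>\<bar>" "a + t \<in> I"
        using proper_interval_near[OF I a, of "k' * \<bar>fst \<delta>\<bar>"] False k' by auto
      have "\<bar>t / fst \<delta>\<bar> < k'" using t(2) False by (simp add: pos_divide_less_eq)
      then show ?thesis using t False s0 qT(2) by (intro exI[of _ "t / fst \<delta>"]) (auto simp: half_space_def)
    qed
    then obtain s where s: "0 < \<bar>s\<bar>" "\<bar>s\<bar> < k'" "a + s * fst \<delta> \<in> I" "y0 + s *\<^sub>R snd \<delta> \<in> half_space" by blast
    have "q + s *\<^sub>R \<delta> = (a + s * fst \<delta>, y0 + s *\<^sub>R snd \<delta>)" unfolding q_def by (simp add: prod_eq_iff)
    then have "q + s *\<^sub>R \<delta> \<in> T" using s near[OF s(2)] O2(2) by simp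
    then show ?thesis using s(1,2) k'(2) by (intro exI[of _ s]) auto
  qed
  define \<Gamma> where "\<Gamma> = christoffel B g d z0"
  have z0: "z0 \<in> U" using dB unfolding z0_def U_def by blast
  note chr = christoffel_properties[OF B d, of g DG, folded U_def z0_def G_def, folded \<Gamma>_def]
  have \<Gamma>1: "bilinear \<Gamma>" by (rule chr(1); fact bil sym pos dG)
  have \<Gamma>2: "\<Gamma> u w = \<Gamma> w u" for u w by (rule chr(2); fact bil sym pos dG)
  have \<Gamma>3: "DG u w = (\<lambda>v. G z0 (\<Gamma> v u) w + G z0 u (\<Gamma> v w))" for u w
    by (rule chr(3); fact bil sym pos dG)
  note \<Gamma> = \<Gamma>1 \<Gamma>2 \<Gamma>3
  note dG' = dG[unfolded \<Gamma>(3)]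
  have accU: "accessible U z0"
    unfolding U_def z0_def by (rule chart_range_accessible[OF B dB])
  have shape: "G z0 (DR v + \<Gamma> v (Rc z0)) w = \<kappa> * (G z0 v w - G z0 (Rc z0) v * G z0 (Rc z0) w)" for v w
  proof (rule radial_shape[OF accU z0 _ _ \<Gamma>(1,2) dG' DR hess hess_sym])
    show "bilinear (G z)" if "z \<in> U" for z using bil that .
    show "G z0 u w = G z0 w u" for u w using sym z0 by blast
    show "G z0 (\<Gamma> (Rc z0) v) w + G z0 v (\<Gamma> (Rc z0) w) + G z0 (DR v) w + G z0 v (DR w)
       = 2 * (\<kappa> * (G z0 v w - G z0 (Rc z0) v * G z0 (Rc z0) w))" for v w
      using lie[of v w] unfolding \<Gamma>(3) .
  qed
  have dr': "((\<lambda>p. r (fst p)) has_derivative (\<lambda>\<delta>. fst \<delta> * r')) (at q within T)"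
  proof -
    have "fst ` T \<subseteq> I" using TIV by fastforce
    then have "(r has_derivative (\<lambda>s. s *\<^sub>R r')) (at (fst q) within fst ` T)"
      using dr has_derivative_subset unfolding has_vector_derivative_def PqT by blast
    from has_derivative_in_compose[OF _ this] show ?thesis
      by (simp add: has_derivative_fst)
  qed
  have D2: "((\<lambda>p. DP p \<delta>) has_derivative D2 \<delta>) (at q within T)" for \<delta>
    using D20 by (rule has_derivative_at_withinI)
  have "\<exists>F'. ((\<lambda>p. G (P p) (DP p (1, 0)) (N p)) has_derivative F') (at q within T) \<and>
     F' (0, e) - \<kappa> * G z0 (DP q (1, 0)) (N q) = r' * G z0 (DN (0, e) + \<Gamma> (Rc z0) (N q)) (Rc z0)"
    by (rule free_boundary_identity[where U = U and \<rho> = "\<rho> \<circ> cinv d" and r = r and b = bdir and ?D2.0 = D2])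
       (fact dim bil \<Gamma>(1,2) dG' q PqT(1) PU Dq D2 D2s DN orth unit inj DR rad level d\<rho> dr' eq R1 shape dirs
        | use sym[OF z0] c(3) qT(2) PqT(2) e_def in simp)+
  then obtain F' where F': "((\<lambda>p. G (P p) (DP p (1, 0)) (N p)) has_derivative F') (at q within T)"
     "F' (0, e) - \<kappa> * G z0 (DP q (1, 0)) (N q) = r' * G z0 (DN (0, e) + \<Gamma> (Rc z0) (N q)) (Rc z0)" by blast
  have speed: "normal_speed I B g \<Phi> \<nu> t (cinv c y) = G (P (t, y)) (DP (t, y) (1, 0)) (N (t, y))"
    if p: "(t, y) \<in> T" for t y
  proof -
    note pp = pts[OF p]
    let ?\<gamma> = "\<lambda>t. \<Phi> (t, cinv c y)"
    have yV: "y \<in> V" using TIV[OF p] by simp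
    have "((\<lambda>s. (s, y)) has_derivative (\<lambda>s. (s, 0))) (at t within (I \<inter> ?\<gamma> -` fst d))"
      by (auto intro!: derivative_eq_intros)
    moreover have "(\<lambda>s. (s, y)) ` (I \<inter> ?\<gamma> -` fst d) \<subseteq> T0" using yV T0 by auto
    then have "(P has_derivative DP (t, y)) (at (t, y) within (\<lambda>s. (s, y)) ` (I \<inter> ?\<gamma> -` fst d))"
      using has_derivative_subset[OF DP0] p unfolding T_def by blast
    ultimately have "((\<lambda>s. P (s, y)) has_derivative (\<lambda>s. DP (t, y) (s, 0))) (at t within (I \<inter> ?\<gamma> -` fst d))"
      using has_derivative_in_compose by blast
    then have "((snd d \<circ> ?\<gamma>) has_derivative (\<lambda>s. DP (t, y) (s, 0))) (at t within (I \<inter> ?\<gamma> -` fst d))"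
      by (rule has_derivative_transform[rotated 2]) (use pp P yV in auto)
    moreover have "linear (DP (t, y))" using DP0[of "(t, y)"] p has_derivative_linear unfolding T_def by blast
    then have "(\<lambda>s. DP (t, y) (s, 0)) = (\<lambda>s. s *\<^sub>R DP (t, y) (1, 0))"
      by (simp add: fun_eq_iff flip: linear_scale)
    ultimately have vd: "((snd d \<circ> ?\<gamma>) has_vector_derivative DP (t, y) (1, 0)) (at t within (I \<inter> ?\<gamma> -` fst d))"
      unfolding has_vector_derivative_def by (simp only:)
    have "continuous_on I ?\<gamma>"
      by (rule continuous_on_compose2[OF \<Phi>c(1)]) (auto intro!: continuous_intros)
    then have cont: "continuous (at t within I) ?\<gamma>" using pp(1) by (simp add: continuous_on_eq_continuous_within)
    have v: "velocity B I ?\<gamma> t = tvec_of B d (?\<gamma> t) (DP (t, y) (1, 0))"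
      by (rule velocity_component[OF B accessible_proper_interval[OF I pp(1)] pp(1) cont _ pp(5) vd])
         (use \<Phi>c(2) in auto)
    show ?thesis
      using Gg[OF p tvec_of_tangent[OF B pp(5)] \<nu>t[OF pp(1)]] tvec_of_same[OF B pp(5)] pp(8)
      unfolding normal_speed_def v by simp
  qed
  have dir: "dir_deriv A (normal_speed I B g \<Phi> \<nu> a) x (\<eta> a x) = F' (0, e)"
  proof -
    let ?V = "{y \<in> V. (a, y) \<in> T}"
    have Vo': "openin (top_of_set V) ?V"
    proof -
      have "(\<lambda>y. (a, y)) \<in> V \<rightarrow> I \<times> V" using a by auto
      moreover have "continuous_on V (\<lambda>y. (a, y))" by (intro continuous_intros)
      ultimately have "openin (top_of_set V) (V \<inter> (\<lambda>y. (a, y)) -` T)"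
        using continuous_openin_preimage To by blast
      moreover have "V \<inter> (\<lambda>y. (a, y)) -` T = ?V" by auto
      ultimately show ?thesis by simp
    qed
    have y0V: "y0 \<in> ?V" using qT TIV by auto
    have "((\<lambda>y. (a, y)) has_derivative (\<lambda>u. (0, u))) (at y0 within ?V)"
      by (auto intro!: derivative_eq_intros)
    moreover have "((\<lambda>p. G (P p) (DP p (1, 0)) (N p)) has_derivative F') (at (a, y0) within (\<lambda>y. (a, y)) ` ?V)"
      by (rule has_derivative_subset[OF F'(1)[unfolded q_def]]) auto
    ultimately have "((\<lambda>y. G (P (a, y)) (DP (a, y) (1, 0)) (N (a, y))) has_derivative (\<lambda>u. F' (0, u))) (at y0 within ?V)"
      by (rule has_derivative_in_compose)
    then have "((normal_speed I B g \<Phi> \<nu> a \<circ> cinv c) has_derivative (\<lambda>u. F' (0, u))) (at y0 within ?V)"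
      by (rule has_derivative_transform[rotated 2]) (use y0V speed in auto)
    then have der: "((normal_speed I B g \<Phi> \<nu> a \<circ> cinv c) has_derivative (\<lambda>u. F' (0, u)))
        (at (snd c x) within snd c ` (fst c \<inter> UNIV))"
      using at_within_openin[OF Vo' y0V] unfolding V_def y0_def by simp
    have c': "chart_at A x \<in> charts_at A x" by (rule chart_at) (simp add: cA)
    show ?thesis
      using D_chart_change[OF A c(1) c' oneA _ der, of "\<eta> a x"] bq(2)
      unfolding dir_deriv_def e_def by (simp add: Let_def)
  qed
  have sff: "second_ff A B g (\<lambda>x. \<Phi> (a, x)) (\<lambda>x. \<nu> (a, x)) x (\<eta> a x) (\<eta> a x)
     = G z0 (DN (0, e) + \<Gamma> (Rc z0) (N q)) (Rc z0)"
  proof -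
    let ?c = "chart_at A x"
    have c': "?c \<in> charts_at A x" by (rule chart_at) (simp add: cA)
    have "(((\<lambda>x. \<nu> (a, x) d) \<circ> cinv c) has_derivative (\<lambda>u. DN (0, u)))
       (at (snd c x) within snd c ` (fst c \<inter> (\<lambda>x. \<Phi> (a, x)) -` fst d))"
    proof (rule slice[OF _ a cAt(2) dB(2)])
      show "(N has_derivative DN) (at (a, snd c x) within T0)" using DN0 unfolding q_def y0_def .
      show "\<nu> (a, x') d = N (a, snd c x')" if "x' \<in> fst c" for x'
        using N[of "(a, snd c x')"] a that cinv_chart[OF A cAt(1)] unfolding V_def by auto
    qed
    from D_chart_change[OF A c(1) c' open_t[OF a] _ this bq(2)]
    have "cov_deriv A B g (\<lambda>x. \<Phi> (a, x)) (\<lambda>x. \<nu> (a, x)) x (\<eta> a x) d = DN (0, e) + \<Gamma> (Rc z0) (N q)"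
      using d dB bq(3,4) pts(8)[OF qT(1)] PqT unfolding cov_deriv_def \<Gamma>_def e_def q_def z0_def
      by (simp add: Let_def o_def)
    then show ?thesis
      unfolding second_ff_def rep using bq(3,4) PqT(1) unfolding q_def by simp
  qed
  have "normal_speed I B g \<Phi> \<nu> a x = G z0 (DP q (1, 0)) (N q)"
    using speed[OF qT(1)] PqT unfolding q_def by simp
  then show ?thesis using F'(2) dir sff by simp
qed


section \<open>Warped products\<close>

lemma diff_atlas_cyl:
  fixes A :: "('m::topological_space, 'e::euclidean_space) chart set"
  assumes A: "diff_atlas R M A" and J: "\<And>t. t \<in> J \<Longrightarrow> accessible J t"
  shows "diff_atlas (J \<times> R) (J \<times> M) (cyl J A)"
  unfolding diff_atlas_def
proof (intro conjI ballI)
  show "carrier (cyl J A) = J \<times> M"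
    using atlas_carrier[OF A] unfolding carrier_def cyl_eq by auto
  show "accessible (J \<times> R) y" if "y \<in> J \<times> R" for y
    using that accessible_Times[of J "fst y" R "snd y"] J A unfolding diff_atlas_def by auto
  fix C assume "C \<in> cyl J A"
  then obtain c where c: "c \<in> A" "C = cyl_chart J c" unfolding cyl_eq by blast
  have h: "homeomorphism (fst c) (snd c ` fst c) (snd c) (cinv c)"
    and o: "openin (top_of_set M) (fst c)" "openin (top_of_set R) (snd c ` fst c)"
    using A c(1) unfolding diff_atlas_def by blast+
  have im: "snd C ` fst C = J \<times> snd c ` fst c" unfolding c(2) by (simp only: cyl_chart_simps(1) cyl_chart_image)
  have inv: "cinv C p = (fst p, cinv c (snd p))" if "p \<in> J \<times> snd c ` fst c" for p
    using cinv_cyl_chart[OF atlas_inj[OF A c(1)] that] c(2) by simp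
  show "openin (top_of_set (J \<times> M)) (fst C)" unfolding c(2) cyl_chart_simps
    by (intro openin_Times openin_subtopology_self o)
  show "openin (top_of_set (J \<times> R)) (snd C ` fst C)" unfolding im
    by (intro openin_Times openin_subtopology_self o)
  show "homeomorphism (fst C) (snd C ` fst C) (snd C) (cinv C)"
    unfolding im
  proof (rule homeomorphismI)
    have "continuous_on (fst C) (\<lambda>q. (fst q, snd c (snd q)))"
      unfolding c(2) cyl_chart_simps
      by (intro continuous_intros continuous_on_compose2[OF homeomorphism_cont1[OF h]]) auto
    then show "continuous_on (fst C) (snd C)" unfolding c(2) cyl_chart_simps by (simp cong: continuous_on_cong)
    have "continuous_on (J \<times> snd c ` fst c) (\<lambda>p. (fst p, cinv c (snd p)))"
      by (intro continuous_intros continuous_on_compose2[OF homeomorphism_cont2[OF h]]) auto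
    then show "continuous_on (J \<times> snd c ` fst c) (cinv C)" by (simp add: inv cong: continuous_on_cong)
    show "snd C ` fst C \<subseteq> J \<times> snd c ` fst c" using im by simp
    show "cinv C ` (J \<times> snd c ` fst c) \<subseteq> fst C"
      using inv c(2) by (auto intro: inv_into_into)
    show "cinv C (snd C x) = x" if "x \<in> fst C" for x
      using that inv[of "snd C x"] c(2) cinv_chart[OF A c(1)] by (auto simp: mem_Times_iff)
    show "snd C (cinv C y) = y" if "y \<in> J \<times> snd c ` fst c" for y
      using that inv[of y] c(2) by (auto simp: f_inv_into_f)
  qed
  fix C' y assume "C' \<in> cyl J A" and y: "y \<in> snd C ` (fst C \<inter> fst C')"
  then obtain c' where c': "c' \<in> A" "C' = cyl_chart J c'" unfolding cyl_eq by blast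
  have int: "fst C \<inter> fst C' = J \<times> (fst c \<inter> fst c')" unfolding c(2) c'(2) by auto
  have S: "snd C ` (fst C \<inter> fst C') = J \<times> snd c ` (fst c \<inter> fst c')"
    by (simp only: int) (simp only: c(2) cyl_chart_image)
  let ?\<tau> = "snd c' \<circ> cinv c"
  obtain s where s: "snd y = snd c s" "s \<in> fst c \<inter> fst c'" using y S by auto
  then have cs: "c \<in> charts_at A s" "c' \<in> charts_at A s" using c(1) c'(1) by (auto simp: charts_at_def)
  let ?D = "D (snd c ` (fst c \<inter> fst c')) ?\<tau> (snd y)"
  have \<tau>: "(?\<tau> has_derivative ?D) (at (snd y) within snd c ` (fst c \<inter> fst c'))"
    using transition_derivative[OF A cs] s by simp
  have "((\<lambda>p. ?\<tau> (snd p)) has_derivative (\<lambda>v. ?D (snd v))) (at y within J \<times> snd c ` (fst c \<inter> fst c'))"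
  proof (rule has_derivative_in_compose[where f = snd, OF has_derivative_snd[OF has_derivative_ident]])
    show "(?\<tau> has_derivative ?D) (at (snd y) within snd ` (J \<times> snd c ` (fst c \<inter> fst c')))"
      by (rule has_derivative_subset[OF \<tau>]) auto
  qed
  then have "((\<lambda>p. (fst p, ?\<tau> (snd p))) has_derivative (\<lambda>v. (fst v, ?D (snd v))))
      (at y within J \<times> snd c ` (fst c \<inter> fst c'))"
    by (intro has_derivative_Pair has_derivative_fst has_derivative_ident)
  then have "((snd C' \<circ> cinv C) has_derivative (\<lambda>v. (fst v, ?D (snd v)))) (at y within snd C ` (fst C \<inter> fst C'))"
    unfolding S
    by (rule has_derivative_transform[rotated 2])
       (use y S in \<open>auto simp: c'(2) inv\<close>)
  then show "(snd C' \<circ> cinv C) differentiable (at y within snd C ` (fst C \<inter> fst C'))"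
    unfolding differentiable_def by blast
qed

context
  fixes AF :: "('f::topological_space, 'e::euclidean_space) chart set" and J :: "real set"
  assumes AF: "diff_atlas UNIV UNIV AF" and J: "\<And>t. t \<in> J \<Longrightarrow> accessible J t"
begin

lemma diff_atlas_warped: "diff_atlas (J \<times> UNIV) (J \<times> UNIV) (cyl J AF)"
  by (rule diff_atlas_cyl[OF AF J])

text \<open>The two projections of a tangent vector of \<open>J \<times> F\<close> are read off from its components in any product
  chart, although they are defined through a chosen one.\<close>

lemma warped_tvec_components:
  assumes c: "c \<in> AF" and q: "q \<in> J \<times> fst c"
  defines "X \<equiv> tvec_of (cyl J AF) (cyl_chart J c) q"
  shows "dir_deriv (cyl J AF) fst q (X u) = fst u"
    and "push (cyl J AF) AF snd q (X u) = tvec_of AF c (snd q) (snd u)"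
proof -
  let ?B = "cyl J AF" and ?C = "cyl_chart J c"
  have C: "?C \<in> charts_at ?B q" using c q by (auto simp: charts_at_def cyl_eq)
  let ?C' = "chart_at ?B q"
  have C': "?C' \<in> charts_at ?B q" by (rule chart_at) (metis C UN_I carrier_def charts_atD)
  have X: "X u \<in> tangent_space ?B q" "X u ?C = u"
    unfolding X_def using tvec_of_tangent[OF diff_atlas_warped C] tvec_of_same[OF diff_atlas_warped C] by auto
  have C'sub: "fst ?C' \<subseteq> J \<times> UNIV" using charts_atD(1)[OF C'] by (auto simp: cyl_eq)
  have inv: "cinv ?C p = (fst p, cinv c (snd p))" if "p \<in> J \<times> snd c ` fst c" for p
    by (rule cinv_cyl_chart[OF atlas_inj[OF AF c] that])
  have im: "snd ?C ` (fst ?C \<inter> (J \<times> V)) = J \<times> snd c ` (fst c \<inter> V)" for V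
  proof -
    have "fst ?C \<inter> (J \<times> V) = J \<times> (fst c \<inter> V)" by auto
    then show ?thesis by (simp only: cyl_chart_image)
  qed
  show "dir_deriv ?B fst q (X u) = fst u"
  proof -
    have "((fst \<circ> cinv ?C) has_derivative fst) (at (snd ?C q) within snd ?C ` (fst ?C \<inter> (J \<times> UNIV)))"
      unfolding im
      by (rule has_derivative_transform[OF _ _ has_derivative_fst[OF has_derivative_ident]])
         (use q inv in auto)
    from D_chart_change[OF diff_atlas_warped C C' _ _ this X(1)]
    have "D (snd ?C' ` (fst ?C' \<inter> (J \<times> UNIV))) (fst \<circ> cinv ?C') (snd ?C' q) (X u ?C') = fst u"
      using q X(2) by auto
    moreover have "fst ?C' \<inter> (J \<times> UNIV) = fst ?C'" using C'sub by blast
    ultimately show ?thesis unfolding dir_deriv_def by (simp add: Let_def)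
  qed
  show "push ?B AF snd q (X u) = tvec_of AF c (snd q) (snd u)"
  proof
    fix e show "push ?B AF snd q (X u) e = tvec_of AF c (snd q) (snd u) e"
    proof (cases "e \<in> charts_at AF (snd q)")
      case True
      note eA = charts_atD[OF True]
      let ?\<tau> = "D (snd c ` (fst c \<inter> fst e)) (snd e \<circ> cinv c) (snd c (snd q))"
      have cq: "c \<in> charts_at AF (snd q)" using c q by (auto simp: charts_at_def)
      have "((\<lambda>p. (snd e \<circ> cinv c) (snd p)) has_derivative (\<lambda>v. ?\<tau> (snd v)))
         (at (snd ?C q) within J \<times> snd c ` (fst c \<inter> fst e))"
      proof (rule has_derivative_in_compose[where f = snd, OF has_derivative_snd[OF has_derivative_ident]])
        show "((snd e \<circ> cinv c) has_derivative ?\<tau>)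
           (at (snd (snd ?C q)) within snd ` (J \<times> snd c ` (fst c \<inter> fst e)))"
          unfolding cyl_chart_simps snd_conv
          by (rule has_derivative_subset[OF transition_derivative[OF AF cq True]]) auto
      qed
      then have der: "(((snd e \<circ> snd) \<circ> cinv ?C) has_derivative (\<lambda>v. ?\<tau> (snd v)))
         (at (snd ?C q) within snd ?C ` (fst ?C \<inter> (J \<times> fst e)))"
        unfolding im by (rule has_derivative_transform[rotated 2]) (use q eA inv in auto)
      have o: "openin (top_of_set (J \<times> UNIV)) (J \<times> fst e)"
        using atlas_openin[OF AF eA(1)] by (intro openin_Times openin_subtopology_self)
      have qe: "q \<in> J \<times> fst e" using q eA by auto
      have "D (snd ?C' ` (fst ?C' \<inter> (J \<times> fst e))) ((snd e \<circ> snd) \<circ> cinv ?C') (snd ?C' q) (X u ?C') = ?\<tau> (snd u)"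
        using D_chart_change[OF diff_atlas_warped C C' o qe der X(1)] unfolding X(2) .
      moreover have "fst ?C' \<inter> (J \<times> fst e) = fst ?C' \<inter> snd -` fst e" using C'sub by auto
      ultimately show ?thesis using True unfolding push_def tvec_of_def by (simp add: Let_def)
    qed (simp add: push_def tvec_of_def)
  qed
qed

lemma coef_warped:
  assumes c: "c \<in> AF" and z: "z \<in> J \<times> snd c ` fst c"
  shows "coef (cyl J AF) (warped_metric J AF h gF) (cyl_chart J c) z u w
    = fst u * fst w + (h (fst z))\<^sup>2 * coef AF gF c (snd z) (snd u) (snd w)"
proof -
  have inv: "cinv (cyl_chart J c) z = (fst z, cinv c (snd z))"
    by (rule cinv_cyl_chart[OF atlas_inj[OF AF c] z])
  have q: "(fst z, cinv c (snd z)) \<in> J \<times> fst c" using z by (auto intro: inv_into_into)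
  show ?thesis
    unfolding coef_def inv Let_def warped_metric_def warped_tvec_components[OF c q] by simp
qed

lemma warped_metric_chart_at:
  assumes c: "c \<in> AF" and q: "q \<in> J \<times> fst c" and at: "chart_at (cyl J AF) q = cyl_chart J c"
  shows "warped_metric J AF h gF q v w = coef (cyl J AF) (warped_metric J AF h gF) (cyl_chart J c)
    (snd (cyl_chart J c) q) (v (cyl_chart J c)) (w (cyl_chart J c))"
proof -
  let ?C = "cyl_chart J c"
  have C: "?C \<in> charts_at (cyl J AF) q" using c q by (auto simp: charts_at_def cyl_eq)
  have "cinv ?C (snd ?C q) = q" using cinv_chart[OF diff_atlas_warped charts_atD(1)[OF C]] q by simp
  moreover have "dir_deriv (cyl J AF) fst q (tvec_of (cyl J AF) ?C q (X ?C)) = dir_deriv (cyl J AF) fst q X"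
    "push (cyl J AF) AF snd q (tvec_of (cyl J AF) ?C q (X ?C)) = push (cyl J AF) AF snd q X" for X
    unfolding dir_deriv_def push_def at Let_def tvec_of_same[OF diff_atlas_warped C] by (rule refl)+
  ultimately show ?thesis unfolding coef_def Let_def warped_metric_def by simp
qed

lemma warped_radial_component:
  assumes c: "c \<in> AF" and q: "q \<in> J \<times> fst c"
  shows "warped_radial J AF q (cyl_chart J c) = (1, 0)"
proof -
  have t: "fst q \<in> J" using q by auto
  have "((\<lambda>t. (t, snd c (snd q))) has_vector_derivative (1, 0)) (at (fst q) within J)"
    unfolding has_vector_derivative_def by (auto intro!: derivative_eq_intros)
  moreover have "at (fst q) within J \<noteq> bot"
    using accessible_real_limit_point[OF J[OF t]] trivial_limit_within by blast
  ultimately have "ddt J (\<lambda>t. (t, snd c (snd q))) (fst q) = (1, 0)"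
    by (simp add: vector_derivative_within)
  then show ?thesis
    using c q by (auto simp: warped_radial_def velocity_def charts_at_def cyl_eq o_def)
qed

end

text \<open>In a product chart \<open>\<partial>\<^sub>\<rho>\<close> is the constant field \<open>(1, 0)\<close>, whose inner product with any vector is
  the first component of that vector, so the Hessian term is 0 and \<open>L\<^sub>R g = 2 h h' g\<^sub>F\<close>.\<close>

lemma free_boundary_variation_warped:
  fixes A :: "('s::topological_space, 'e::euclidean_space) chart set"
    and AF :: "('f::topological_space, 'e) chart set"
  assumes I: "proper_interval I" and A: "smooth_atlas half_space UNIV A"
    and F: "smooth_atlas UNIV UNIV AF" "riemannian_metric AF gF" and J: "proper_interval J"
    and h: "smooth_on J h" "\<And>t. t \<in> J \<Longrightarrow> 0 < h t" and r: "smooth_on I r" "r ` I \<subseteq> J"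
    and fam: "minimal_family I A (cyl J AF) (warped_metric J AF h gF) \<Phi> \<nu>"
    and fb: "free_boundary I A (cyl J AF) (warped_metric J AF h gF) fst (warped_radial J AF) r \<Phi> \<eta>"
    and a: "a \<in> I" and x: "x \<in> bdry A"
  shows "dir_deriv A (normal_speed I (cyl J AF) (warped_metric J AF h gF) \<Phi> \<nu> a) x (\<eta> a x)
           - ddt J h (r a) / h (r a)
             * normal_speed I (cyl J AF) (warped_metric J AF h gF) \<Phi> \<nu> a x
           = ddt I r a
             * second_ff A (cyl J AF) (warped_metric J AF h gF)
                 (\<lambda>x. \<Phi> (a, x)) (\<lambda>x. \<nu> (a, x)) x (\<eta> a x) (\<eta> a x)"
proof -
  let ?B = "cyl J AF" and ?g = "warped_metric J AF h gF"
  note Jacc = accessible_proper_interval[OF J]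
  have AF: "diff_atlas UNIV UNIV AF" by (rule smooth_atlas_imp_diff_atlas[OF F(1) accessible_UNIV])
  have B: "diff_atlas (J \<times> UNIV) (J \<times> UNIV) (cyl J AF)" by (rule diff_atlas_cyl[OF AF Jacc])
  let ?p = "\<Phi> (a, x)" and ?d = "chart_at ?B (\<Phi> (a, x))"
  have "(a, x) \<in> carrier (cyl I A)"
    using a A unfolding smooth_atlas_def carrier_def cyl_def by force
  then have "?p \<in> carrier ?B" using fam unfolding minimal_family_def smooth_map_def by blast
  then have d: "?d \<in> charts_at ?B ?p" by (rule chart_at)
  then obtain c where c: "c \<in> AF" "?d = cyl_chart J c" using charts_atD(1)[OF d] unfolding cyl_eq by blast
  have p: "?p \<in> J \<times> fst c" using charts_atD(2)[OF d] c(2) by simp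
  have pr: "fst ?p = r a" using fb a x unfolding free_boundary_def by blast
  define k where "k = coef AF gF c"
  define U where "U = snd ?d ` fst ?d"
  define z0 where "z0 = snd ?d ?p"
  define G where "G = coef ?B ?g ?d"
  have U: "U = J \<times> snd c ` fst c" unfolding U_def c(2) by (simp only: cyl_chart_simps(1) cyl_chart_image)
  have z0: "z0 = (r a, snd c (snd ?p))" unfolding z0_def c(2) using pr by simp
  have z0U: "z0 \<in> U" unfolding z0_def U_def using charts_atD(2)[OF d] by blast
  have G: "G z u w = fst u * fst w + (h (fst z))\<^sup>2 * k (snd z) (snd u) (snd w)" if "z \<in> U" for z u w
    using coef_warped[OF AF Jacc c(1)] that unfolding G_def k_def U c(2) by blast
  have k: "bilinear (k y)" "\<And>u w. k y u w = k y w u" "\<And>u. u \<noteq> 0 \<Longrightarrow> 0 < k y u u" if "y \<in> snd c ` fst c" for y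
    using F(2) c(1) that unfolding riemannian_metric_def k_def by blast+
  define Dk where "Dk u w = D (snd c ` fst c) (\<lambda>y. k y u w) (snd z0)" for u w
  have Dk: "((\<lambda>y. k y u w) has_derivative Dk u w) (at (snd z0) within snd c ` fst c)" for u w
    unfolding Dk_def
    by (rule has_derivative_D, rule smooth_on_differentiable)
       (use F(2) c(1) z0U U in \<open>auto simp: riemannian_metric_def k_def\<close>)
  define h' where "h' = ddt J h (r a)"
  have raJ: "r a \<in> J" using r(2) a by blast
  have h': "(h has_vector_derivative h') (at (r a) within J)"
    unfolding h'_def using smooth_on_differentiable[OF h(1) raJ] vector_derivative_works by blast
  define DG where "DG u w v = 2 * h (r a) * h' * fst v * k (snd z0) (snd u) (snd w)
     + (h (r a))\<^sup>2 * Dk (snd u) (snd w) (snd v)" for u w v :: "real \<times> 'e"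
  show ?thesis
    unfolding h'_def[symmetric]
  proof (rule free_boundary_variation[OF I A B _ fam fb a x d z0_def U_def G_def,
      where Rc = "\<lambda>z :: real \<times> 'e. (1, 0) :: real \<times> 'e" and DR = "\<lambda>v. 0" and S = "\<lambda>w v. 0" and DG = DG])
    show "DIM(real \<times> 'e) = DIM('e) + 1" by simp
    show "?g ?p v w = G z0 (v ?d) (w ?d)" for v w
      using warped_metric_chart_at[OF AF Jacc c(1) p c(2)] unfolding G_def z0_def c(2) by blast
    show "bilinear (G z)" if z: "z \<in> U" for z
    proof -
      have kz: "bilinear (k (snd z))" using k(1) z U by auto
      show ?thesis unfolding bilinear_def
        by (intro conjI allI linearI) (simp_all add: G[OF z] bilinear_simps[OF kz] algebra_simps)
    qed
    show "G z u w = G z w u" if z: "z \<in> U" for z u w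
      using k(2)[of "snd z"] z U unfolding G[OF z] by auto
    show "0 < G z0 u u" if "u \<noteq> 0" for u
    proof -
      have kz: "bilinear (k (snd z0))" and kp: "v \<noteq> 0 \<Longrightarrow> 0 < k (snd z0) v v" for v
        using k(1,3) z0U U by auto
      have hp: "(h (fst z0))\<^sup>2 > 0" using h(2)[OF raJ] z0 by simp
      show ?thesis
      proof (cases "snd u = 0")
        case True
        then have "fst u \<noteq> 0" using that by (simp add: prod_eq_iff)
        then show ?thesis unfolding G[OF z0U] True bilinear_lzero[OF kz] by (auto simp: zero_less_mult_iff neq_iff)
      next
        case False
        then have "(h (fst z0))\<^sup>2 * k (snd z0) (snd u) (snd u) > 0" using kp hp by simp
        then show ?thesis unfolding G[OF z0U] by (smt (verit) zero_le_square)
      qed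
    qed
    show "((\<lambda>z. G z u w) has_derivative DG u w) (at z0 within U)" for u w
    proof -
      have "((\<lambda>z. h (fst z)) has_derivative (\<lambda>v. fst v *\<^sub>R h')) (at z0 within U)"
        by (rule has_derivative_in_compose[where f = fst, OF has_derivative_fst[OF has_derivative_ident]])
           (rule has_derivative_subset, use h'[unfolded has_vector_derivative_def] in \<open>auto simp: z0 U\<close>)
      moreover have "((\<lambda>z. k (snd z) (snd u) (snd w)) has_derivative (\<lambda>v. Dk (snd u) (snd w) (snd v))) (at z0 within U)"
        by (rule has_derivative_in_compose[where f = snd, OF has_derivative_snd[OF has_derivative_ident]])
           (rule has_derivative_subset[OF Dk], auto simp: U)
      ultimately have "((\<lambda>z. fst u * fst w + (h (fst z))\<^sup>2 * k (snd z) (snd u) (snd w)) has_derivative DG u w) (at z0 within U)"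
        by (auto intro!: derivative_eq_intros simp: DG_def fun_eq_iff z0 power2_eq_square algebra_simps)
      then show ?thesis by (rule has_derivative_transform[rotated 2]) (use z0U G in auto)
    qed
    show "warped_radial J AF q ?d = (1, 0)" if "q \<in> fst ?d" for q
      using warped_radial_component[OF AF Jacc c(1)] that unfolding c(2) by simp
    have G1: "G z (1, 0) w = fst w" if z: "z \<in> U" for z w
    proof -
      have "bilinear (k (snd z))" using k(1) z U by auto
      then show ?thesis unfolding G[OF z] by (simp add: bilinear_lzero)
    qed
    show "((fst \<circ> cinv ?d) has_derivative G z0 (1, 0)) (at z0 within U)"
    proof (rule has_derivative_transform[OF z0U])
      show "(fst has_derivative G z0 (1, 0)) (at z0 within U)"
        by (rule has_derivative_eq_rhs[OF has_derivative_fst[OF has_derivative_ident]]) (simp add: G1[OF z0U] fun_eq_iff)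
      show "(fst \<circ> cinv ?d) z = fst z" if "z \<in> U" for z
        using cinv_cyl_chart[OF atlas_inj[OF AF c(1)], of z J] that U c(2) by simp
    qed
    show "((\<lambda>z. G z (1, 0) w) has_derivative (\<lambda>v. 0)) (at z0 within U)" for w
      by (rule has_derivative_transform[OF z0U _ has_derivative_const[of "fst w"]]) (use G1 in auto)
    show "DG v w (1, 0) + G z0 0 w + G z0 v 0
       = 2 * (h' / h (r a) * (G z0 v w - G z0 (1, 0) v * G z0 (1, 0) w))" for v w
    proof -
      have kz: "bilinear (k (snd z0))" using k(1) z0U U by auto
      have "linear (Dk (snd v) (snd w))" using Dk has_derivative_linear by blast
      then show ?thesis
        using h(2)[OF raJ] unfolding DG_def G1[OF z0U] G[OF z0U]
        by (simp add: linear_0 bilinear_simps[OF kz[unfolded z0 snd_conv]] z0 power2_eq_square field_simps)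
    qed
    show "(r has_vector_derivative ddt I r a) (at a within I)"
      using smooth_on_differentiable[OF r(1) a] vector_derivative_works by blast
  qed auto
qed


section \<open>Rotationally symmetric balls\<close>

text \<open>The metric in Euclidean coordinates: the radial part of a vector keeps its Euclidean length and the
  spherical part is scaled by \<open>h(\<rho>)/\<rho>\<close>.\<close>

definition polar_form :: "(real \<Rightarrow> real) \<Rightarrow> 'b::euclidean_space \<Rightarrow> 'b \<Rightarrow> 'b \<Rightarrow> real" where
  "polar_form h z u w = (if z = 0 then u \<bullet> w else
     (sgn z \<bullet> u) * (sgn z \<bullet> w) + (h (norm z) / norm z)\<^sup>2 * (u \<bullet> w - (sgn z \<bullet> u) * (sgn z \<bullet> w)))"

lemma has_derivative_sgn:
  fixes z :: "'b::euclidean_space"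
  assumes "z \<noteq> 0"
  shows "(sgn has_derivative (\<lambda>v. (v - (sgn z \<bullet> v) *\<^sub>R sgn z) /\<^sub>R norm z)) (at z)"
proof -
  have "((\<lambda>z. inverse (norm z) *\<^sub>R z) has_derivative
     (\<lambda>v. inverse (norm z) *\<^sub>R v + (- (inverse (norm z) * (v \<bullet> sgn z) * inverse (norm z))) *\<^sub>R z)) (at z)"
    by (rule has_derivative_scaleR[OF Deriv.has_derivative_inverse[OF _ has_derivative_norm[OF assms]] has_derivative_ident])
       (use assms in simp)
  moreover have "(\<lambda>z. inverse (norm z) *\<^sub>R z) = (sgn :: 'b \<Rightarrow> 'b)" by (simp add: sgn_div_norm fun_eq_iff)
  moreover have "inverse (norm z) *\<^sub>R v + (- (inverse (norm z) * (v \<bullet> sgn z) * inverse (norm z))) *\<^sub>R z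
     = (v - (sgn z \<bullet> v) *\<^sub>R sgn z) /\<^sub>R norm z" for v
    by (simp add: sgn_div_norm algebra_simps inner_commute)
  ultimately show ?thesis by simp
qed

lemma sgn_inner_self: "z \<noteq> 0 \<Longrightarrow> sgn z \<bullet> sgn z = (1::real)" for z :: "'b::euclidean_space"
  by (simp add: dot_square_norm norm_sgn)

lemma polar_form_bilinear: "bilinear (polar_form h z)"
  unfolding bilinear_def polar_form_def
  by (intro conjI allI linearI) (simp_all add: inner_add_left inner_add_right algebra_simps)

lemma polar_form_sym: "polar_form h z u w = polar_form h z w u"
  by (simp add: polar_form_def inner_commute mult.commute)

text \<open>By the Cauchy-Schwarz inequality the spherical part is nonnegative; this is also why curves are at
  least as long as the variation of their norm.\<close>

lemma polar_form_ge:
  fixes z :: "'b::euclidean_space"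
  shows "(sgn z \<bullet> u)\<^sup>2 \<le> polar_form h z u u"
proof (cases "z = 0")
  case False
  have "(sgn z \<bullet> u)\<^sup>2 \<le> u \<bullet> u"
    using Cauchy_Schwarz_ineq[of "sgn z" u] sgn_inner_self[OF False] by simp
  then show ?thesis using False by (simp add: polar_form_def power2_eq_square)
qed (simp add: polar_form_def)

lemma polar_form_pos:
  fixes z :: "'b::euclidean_space"
  assumes "z \<noteq> 0" "h (norm z) \<noteq> 0" "u \<noteq> 0"
  shows "0 < polar_form h z u u"
proof (cases "sgn z \<bullet> u = 0")
  case True
  then show ?thesis using assms by (simp add: polar_form_def)
next
  case False
  then show ?thesis using polar_form_ge[of z u h] by (smt (verit) zero_less_power2)
qed

lemma polar_form_radial:
  fixes z :: "'b::euclidean_space"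
  shows "polar_form h z (sgn z) w = sgn z \<bullet> w"
  using sgn_inner_self[of z] by (auto simp: polar_form_def)

context
  fixes r0 :: real
begin

abbreviation "ball_chart \<equiv> (ball (0::'b::euclidean_space) r0, \<lambda>x :: 'b. x)"

lemma cinv_ball_chart: "z \<in> ball 0 r0 \<Longrightarrow> cinv ball_chart z = z"
  by (simp add: inv_into_f_eq)

lemma charts_at_ball: "z \<in> ball 0 r0 \<Longrightarrow> charts_at (ball_atlas r0) z = {ball_chart}"
  by (auto simp: charts_at_def ball_atlas_def)

lemma chart_at_ball: "z \<in> ball 0 r0 \<Longrightarrow> chart_at (ball_atlas r0) z = ball_chart"
  by (simp add: chart_at_def charts_at_ball)

lemma diff_atlas_ball: "diff_atlas UNIV (ball 0 r0) (ball_atlas r0)"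
proof -
  have "continuous_on (ball 0 r0) (cinv ball_chart)"
    by (rule continuous_on_eq[OF continuous_on_id]) (simp add: cinv_ball_chart)
  then have "homeomorphism (ball 0 r0) (ball 0 r0) (\<lambda>x. x) (cinv ball_chart)"
    by (intro homeomorphismI) (auto simp: cinv_ball_chart)
  moreover have "((\<lambda>x. x) \<circ> cinv ball_chart) differentiable (at y within ball 0 r0)" if "y \<in> ball 0 r0" for y
  proof -
    have "((\<lambda>x. x) \<circ> cinv ball_chart has_derivative (\<lambda>x. x)) (at y within ball 0 r0)"
      by (rule has_derivative_transform[OF that _ has_derivative_ident]) (auto simp: cinv_ball_chart)
    then show ?thesis unfolding differentiable_def by blast
  qed
  ultimately show ?thesis
    unfolding diff_atlas_def by (auto simp: ball_atlas_def carrier_def accessible_UNIV)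
qed

lemma dir_deriv_ball:
  assumes "z \<in> ball 0 r0" "(f has_derivative f') (at z)"
  shows "dir_deriv (ball_atlas r0) f z X = f' (X ball_chart)"
proof -
  have "((f \<circ> cinv ball_chart) has_derivative f') (at z within ball 0 r0)"
    by (rule has_derivative_transform[OF assms(1) _ has_derivative_at_withinI[OF assms(2)]])
       (auto simp: cinv_ball_chart)
  moreover have "accessible (ball 0 r0) z"
    by (rule accessible_openin[OF accessible_UNIV]) (use assms in auto)
  ultimately have "D (ball 0 r0) (f \<circ> cinv ball_chart) z = f'" using D_eqI by blast
  then show ?thesis unfolding dir_deriv_def chart_at_ball[OF assms(1)] by (simp add: Let_def)
qed

lemma polar_metric_eq:
  assumes z: "z \<in> ball 0 r0"
  shows "polar_metric r0 h z v w = polar_form h z (v ball_chart) (w ball_chart)"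
proof (cases "z = 0")
  case True
  then show ?thesis using dir_deriv_ball[OF z has_derivative_ident] by (simp add: polar_metric_def polar_form_def)
next
  case False
  let ?s = "sgn z" and ?n = "norm z"
  define P where "P u = u - (?s \<bullet> u) *\<^sub>R ?s" for u
  have P: "P u \<bullet> P u' = u \<bullet> u' - (?s \<bullet> u) * (?s \<bullet> u')" for u u'
    using sgn_inner_self[OF False] unfolding P_def
    by (simp add: inner_diff_left inner_diff_right inner_commute)
  have "polar_metric r0 h z v w = (?s \<bullet> v ball_chart) * (?s \<bullet> w ball_chart)
     + (h ?n)\<^sup>2 * ((P (v ball_chart) /\<^sub>R ?n) \<bullet> (P (w ball_chart) /\<^sub>R ?n))"
    using False dir_deriv_ball[OF z has_derivative_norm[OF False]] dir_deriv_ball[OF z has_derivative_sgn[OF False]]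
    unfolding polar_metric_def P_def by (simp add: inner_commute)
  also have "\<dots> = (?s \<bullet> v ball_chart) * (?s \<bullet> w ball_chart)
     + (h ?n / ?n)\<^sup>2 * (P (v ball_chart) \<bullet> P (w ball_chart))"
    using False by (simp add: power2_eq_square field_simps)
  also have "\<dots> = polar_form h z (v ball_chart) (w ball_chart)"
    using False unfolding P polar_form_def by simp
  finally show ?thesis .
qed

lemma coef_polar:
  assumes z: "z \<in> ball 0 r0"
  shows "coef (ball_atlas r0) (polar_metric r0 h) ball_chart z u w = polar_form h z u w"
proof -
  have "tvec_of (ball_atlas r0) ball_chart z x ball_chart = x" for x
    by (rule tvec_of_same[OF diff_atlas_ball]) (simp add: charts_at_ball[OF z])
  then show ?thesis unfolding coef_def cinv_ball_chart[OF z] by (simp add: Let_def polar_metric_eq[OF z])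
qed

lemma polar_radial_component:
  assumes z: "z \<in> ball 0 r0" "z \<noteq> 0"
  shows "polar_radial r0 z ball_chart = sgn z"
proof -
  have n: "norm z \<in> {0<..<r0}" using z by auto
  have "((\<lambda>t. t *\<^sub>R sgn z) has_vector_derivative sgn z) (at (norm z))"
    unfolding has_vector_derivative_def by (auto intro!: derivative_eq_intros)
  then have "ddt {0<..<r0} (\<lambda>t. t *\<^sub>R sgn z) (norm z) = sgn z"
    unfolding at_within_open[OF n open_greaterThanLessThan] by (rule vector_derivative_at)
  moreover have "norm z *\<^sub>R sgn z = z" using z by (simp add: sgn_div_norm)
  ultimately show ?thesis using z
    by (simp add: polar_radial_def velocity_def charts_at_ball o_def)
qed

end

lemma polar_form_has_derivative:
  fixes z0 :: "'b::euclidean_space"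
  assumes z0: "z0 \<noteq> 0" and h: "(h has_real_derivative h') (at (norm z0))"
  defines "s \<equiv> sgn z0" and "\<sigma> \<equiv> norm z0"
  defines "ds v \<equiv> (v - (s \<bullet> v) *\<^sub>R s) /\<^sub>R \<sigma>"
  shows "((\<lambda>z. polar_form h z u w) has_derivative
     (\<lambda>v. (ds v \<bullet> u) * (s \<bullet> w) + (s \<bullet> u) * (ds v \<bullet> w)
        + 2 * (h \<sigma> / \<sigma>) * ((h' * \<sigma> - h \<sigma>) / \<sigma>\<^sup>2) * (s \<bullet> v) * (u \<bullet> w - (s \<bullet> u) * (s \<bullet> w))
        - (h \<sigma> / \<sigma>)\<^sup>2 * ((ds v \<bullet> u) * (s \<bullet> w) + (s \<bullet> u) * (ds v \<bullet> w)))) (at z0)"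
proof -
  have \<sigma>: "\<sigma> > 0" unfolding \<sigma>_def using z0 by simp
  have ds: "(sgn has_derivative ds) (at z0)" unfolding ds_def s_def \<sigma>_def by (rule has_derivative_sgn[OF z0])
  have om: "((\<lambda>z. sgn z \<bullet> u) has_derivative (\<lambda>v. ds v \<bullet> u)) (at z0)" for u
    using ds by (rule has_derivative_inner_left)
  define k where "k = h \<sigma> / \<sigma>"
  define k' where "k' = (h' * \<sigma> - h \<sigma>) / \<sigma>\<^sup>2"
  have "((\<lambda>t. h t / t) has_real_derivative k') (at \<sigma>)"
    using h \<sigma> unfolding \<sigma>_def[symmetric] k'_def
    by (auto intro!: derivative_eq_intros simp: power2_eq_square)
  then have "((\<lambda>t. h t / t) has_derivative (*) k') (at (norm z0))"
    unfolding has_field_derivative_def \<sigma>_def .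
  from has_derivative_compose[OF has_derivative_norm[OF z0] this]
  have dk: "((\<lambda>z. h (norm z) / norm z) has_derivative (\<lambda>v. k' * (s \<bullet> v))) (at z0)"
    unfolding s_def by (simp add: inner_commute)
  have kz: "h (norm z0) / norm z0 = k" unfolding k_def \<sigma>_def ..
  note W = has_derivative_mult[OF om[of u] om[of w]]
  have "((\<lambda>z. (sgn z \<bullet> u) * (sgn z \<bullet> w) + (h (norm z) / norm z) * (h (norm z) / norm z) * (u \<bullet> w - (sgn z \<bullet> u) * (sgn z \<bullet> w))) has_derivative
     (\<lambda>v. (ds v \<bullet> u) * (s \<bullet> w) + (s \<bullet> u) * (ds v \<bullet> w)
        + 2 * k * k' * (s \<bullet> v) * (u \<bullet> w - (s \<bullet> u) * (s \<bullet> w))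
        - k\<^sup>2 * ((ds v \<bullet> u) * (s \<bullet> w) + (s \<bullet> u) * (ds v \<bullet> w)))) (at z0)"
    by (rule has_derivative_eq_rhs[OF has_derivative_add[OF W
          has_derivative_mult[OF has_derivative_mult[OF dk dk] has_derivative_diff[OF has_derivative_const W]]]])
       (simp add: fun_eq_iff kz s_def[symmetric] power2_eq_square algebra_simps)
  then show ?thesis unfolding k_def k'_def
    by (rule has_derivative_transform_within_open[of _ _ _ _ "- {0}"]) (use z0 in \<open>auto simp: polar_form_def power2_eq_square\<close>)
qed

text \<open>Here \<open>R = sgn\<close> and \<open>\<langle>R, w\<rangle> = sgn z \<bullet> w\<close>; the Hessian \<open>ds\<close> is the projection orthogonal to
  \<open>sgn z\<close>, divided by the radius.  All derivatives are taken at a boundary point, which lies at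
  distance \<open>r a > 0\<close> from the centre, where \<open>norm\<close> and \<open>sgn\<close> are differentiable.\<close>

lemma free_boundary_variation_polar:
  fixes A :: "('s::topological_space, 'e::euclidean_space) chart set" and \<Phi> :: "real \<times> 's \<Rightarrow> 'b::euclidean_space"
  assumes dim: "DIM('b) = DIM('e) + 1" and I: "proper_interval I" and A: "smooth_atlas half_space UNIV A"
    and h: "smooth_on {0<..<r0} h" "\<And>t. t \<in> {0<..<r0} \<Longrightarrow> 0 < h t"
    and r: "smooth_on I r" "r ` I \<subseteq> {0<..<r0}"
    and \<rho>: "\<And>z. z \<in> ball 0 r0 \<Longrightarrow> \<rho> z = norm z"
    and fam: "minimal_family I A (ball_atlas r0) (polar_metric r0 h) \<Phi> \<nu>"
    and fb: "free_boundary I A (ball_atlas r0) (polar_metric r0 h) \<rho> (polar_radial r0) r \<Phi> \<eta>"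
    and a: "a \<in> I" and x: "x \<in> bdry A"
  shows "dir_deriv A (normal_speed I (ball_atlas r0) (polar_metric r0 h) \<Phi> \<nu> a) x (\<eta> a x)
           - ddt {0<..<r0} h (r a) / h (r a)
             * normal_speed I (ball_atlas r0) (polar_metric r0 h) \<Phi> \<nu> a x
           = ddt I r a
             * second_ff A (ball_atlas r0) (polar_metric r0 h)
                 (\<lambda>x. \<Phi> (a, x)) (\<lambda>x. \<nu> (a, x)) x (\<eta> a x) (\<eta> a x)"
proof -
  let ?B = "ball_atlas r0 :: ('b, 'b) chart set" and ?g = "polar_metric r0 h :: ('b, 'b) metric"
  let ?d = "(ball (0::'b) r0, \<lambda>x :: 'b. x)"
  have "(a, x) \<in> carrier (cyl I A)"
    using a A unfolding smooth_atlas_def carrier_def cyl_def by force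
  moreover have "\<Phi> ` carrier (cyl I A) \<subseteq> carrier ?B"
    using fam unfolding minimal_family_def smooth_map_def by blast
  ultimately have p: "\<Phi> (a, x) \<in> ball 0 r0"
    unfolding atlas_carrier[OF diff_atlas_ball] by blast
  then have d: "?d \<in> charts_at ?B (\<Phi> (a, x))" by (simp add: charts_at_ball)
  define z0 where "z0 = snd ?d (\<Phi> (a, x))"
  define U where "U = snd ?d ` fst ?d"
  define G where "G = coef ?B ?g ?d"
  have U: "U = ball 0 r0" unfolding U_def by simp
  have z0U: "z0 \<in> ball 0 r0" unfolding z0_def using p by simp
  have nz: "norm z0 = r a" using fb a x \<rho>[OF p] unfolding free_boundary_def z0_def by auto
  have ra: "r a \<in> {0<..<r0}" using r(2) a by blast
  then have z0: "z0 \<noteq> 0" and hp: "0 < h (r a)" using nz h(2) by auto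
  have G: "G z u w = polar_form h z u w" if "z \<in> ball 0 r0" for z u w
    unfolding G_def by (rule coef_polar[OF that])
  have G0: "G z0 = polar_form h z0" using G[OF z0U] by (simp add: fun_eq_iff)
  define h' where "h' = ddt {0<..<r0} h (r a)"
  have "(h has_vector_derivative h') (at (r a) within {0<..<r0})"
    unfolding h'_def using smooth_on_differentiable[OF h(1) ra] vector_derivative_works by blast
  then have h': "(h has_real_derivative h') (at (norm z0))"
    unfolding nz at_within_open[OF ra open_greaterThanLessThan] has_real_derivative_iff_has_vector_derivative .
  define s where "s = sgn z0"
  have ss: "s \<bullet> s = 1" unfolding s_def by (rule sgn_inner_self[OF z0])
  define ds where "ds v = (v - (s \<bullet> v) *\<^sub>R s) /\<^sub>R r a" for v
  have ds: "(sgn has_derivative ds) (at z0)" using has_derivative_sgn[OF z0] unfolding ds_def s_def nz .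
  define DG where "DG u w v = (ds v \<bullet> u) * (s \<bullet> w) + (s \<bullet> u) * (ds v \<bullet> w)
        + 2 * (h (r a) / r a) * ((h' * r a - h (r a)) / (r a)\<^sup>2) * (s \<bullet> v) * (u \<bullet> w - (s \<bullet> u) * (s \<bullet> w))
        - (h (r a) / r a)\<^sup>2 * ((ds v \<bullet> u) * (s \<bullet> w) + (s \<bullet> u) * (ds v \<bullet> w))" for u w v
  have transfer: "(f has_derivative f') (at z0 within U)"
    if "(f1 has_derivative f') (at z0)" "\<And>z. z \<in> ball 0 r0 \<Longrightarrow> f z = f1 z" for f f1 :: "'b \<Rightarrow> real" and f'
    unfolding U by (rule has_derivative_transform[OF z0U that(2) has_derivative_at_withinI[OF that(1)]])
  show ?thesis
    unfolding h'_def[symmetric]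
  proof (rule free_boundary_variation[OF I A diff_atlas_ball dim fam fb a x d z0_def U_def G_def,
      where Rc = sgn and DR = ds and S = "\<lambda>w v. ds v \<bullet> w" and DG = DG])
    show "?g (\<Phi> (a, x)) v w = G z0 (v ?d) (w ?d)" for v w
      using polar_metric_eq[OF p] G[OF z0U] unfolding z0_def by simp
    show "bilinear (G z)" if "z \<in> U" for z
    proof -
      have "G z = polar_form h z" using G that U by (simp add: fun_eq_iff)
      then show ?thesis by (simp add: polar_form_bilinear)
    qed
    show "G z u w = G z w u" if "z \<in> U" for z u w
      using G that U polar_form_sym by metis
    show "0 < G z0 u u" if "u \<noteq> 0" for u
      unfolding G0 by (rule polar_form_pos[OF z0 _ that]) (use hp nz in simp)
    show "((\<lambda>z. G z u w) has_derivative DG u w) (at z0 within U)" for u w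
    proof (rule transfer[OF _ G])
      show "((\<lambda>z. polar_form h z u w) has_derivative DG u w) (at z0)"
        using polar_form_has_derivative[OF z0 h', of u w] unfolding DG_def[abs_def] ds_def s_def nz .
    qed
    show "polar_radial r0 q ?d = sgn (snd ?d q)" if "q \<in> fst ?d" "\<rho> q \<in> r ` I" for q
    proof -
      have q: "q \<in> ball 0 r0" using that by simp
      then have "norm q \<in> {0<..<r0}" using that(2) r(2) \<rho> by auto
      then show ?thesis using polar_radial_component[OF q] by simp
    qed
    show "(sgn has_derivative ds) (at z0 within U)" using ds by (rule has_derivative_at_withinI)
    have Gs: "G z (sgn z) w = sgn z \<bullet> w" if "z \<in> ball 0 r0" for z w
      unfolding G[OF that] by (rule polar_form_radial)
    show "((\<rho> \<circ> cinv ?d) has_derivative G z0 (sgn z0)) (at z0 within U)"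
    proof (rule transfer)
      have "G z0 (sgn z0) = (\<lambda>v. v \<bullet> sgn z0)" using Gs[OF z0U] by (simp add: fun_eq_iff inner_commute)
      then show "(norm has_derivative G z0 (sgn z0)) (at z0)" using has_derivative_norm[OF z0] by simp
      show "(\<rho> \<circ> cinv ?d) z = norm z" if "z \<in> ball 0 r0" for z
        using \<rho>[OF that] cinv_ball_chart[OF that] by simp
    qed
    show "((\<lambda>z. G z (sgn z) w) has_derivative (\<lambda>v. ds v \<bullet> w)) (at z0 within U)" for w
      by (rule transfer[OF has_derivative_inner_left[OF ds] Gs])
    show "ds v \<bullet> w = ds w \<bullet> v" for v w
      unfolding ds_def by (simp add: inner_diff_left inner_diff_right inner_commute)
    show "DG v w (sgn z0) + G z0 (ds v) w + G z0 v (ds w)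
       = 2 * (h' / h (r a) * (G z0 v w - G z0 (sgn z0) v * G z0 (sgn z0) w))" for v w
    proof -
      have dss: "ds s = 0" "s \<bullet> ds u = 0" for u
        unfolding ds_def using ss by (simp_all add: inner_diff_right)
      let ?Q = "v \<bullet> w - (s \<bullet> v) * (s \<bullet> w)" and ?k = "h (r a) / r a"
      have d1: "ds v \<bullet> w = ?Q / r a" "v \<bullet> ds w = ?Q / r a"
        unfolding ds_def by (simp_all add: inner_diff_left inner_diff_right inner_commute divide_inverse algebra_simps)
      have "DG v w s = 2 * ?k * ((h' * r a - h (r a)) / (r a)\<^sup>2) * ?Q"
        unfolding DG_def dss ss by simp
      moreover have "G z0 (ds v) w = ?k\<^sup>2 * (?Q / r a)" "G z0 v (ds w) = ?k\<^sup>2 * (?Q / r a)"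
        unfolding G0 polar_form_def s_def[symmetric] nz dss using z0 d1 by simp_all
      moreover have "G z0 v w - G z0 s v * G z0 s w = ?k\<^sup>2 * ?Q"
        unfolding G0 polar_form_def s_def[symmetric] nz using z0 ss by (simp add: algebra_simps)
      moreover have "2 * ?k * ((h' * r a - h (r a)) / (r a)\<^sup>2) * ?Q + ?k\<^sup>2 * (?Q / r a) + ?k\<^sup>2 * (?Q / r a)
          = 2 * (h' / h (r a) * (?k\<^sup>2 * ?Q))"
      proof -
        have "2 * ?k * ((h' * r a - h (r a)) / (r a)\<^sup>2) + ?k\<^sup>2 / r a + ?k\<^sup>2 / r a = 2 * (h' / h (r a) * ?k\<^sup>2)"
          using ra hp by (simp add: field_simps power2_eq_square)
        then have "(2 * ?k * ((h' * r a - h (r a)) / (r a)\<^sup>2) + ?k\<^sup>2 / r a + ?k\<^sup>2 / r a) * ?Q = 2 * (h' / h (r a) * ?k\<^sup>2) * ?Q"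
          by simp
        then show ?thesis by (simp add: distrib_right)
      qed
      ultimately show ?thesis unfolding s_def by simp
    qed
    show "(r has_vector_derivative ddt I r a) (at a within I)"
      using smooth_on_differentiable[OF r(1) a] vector_derivative_works by blast
  qed
qed


section \<open>The distance from the centre of the ball\<close>

lemma Ck_on_const: "Ck_on k U (\<lambda>_. c)"
proof (induction k arbitrary: c)
  case (Suc k)
  have "frechet_derivative (\<lambda>_. c) (at x) = (\<lambda>_. 0)" for x :: 'a
    by (rule frechet_derivative_at[symmetric]) (rule has_derivative_const)
  then show ?case using Suc by simp
qed simp

lemma Ck_on_line: "Ck_on k U (\<lambda>t :: real. t *\<^sub>R p)"
proof (cases k)
  case (Suc n)
  have d: "((\<lambda>t. t *\<^sub>R p) has_derivative (\<lambda>h. h *\<^sub>R p)) (at x)" for x :: real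
    by (auto intro!: derivative_eq_intros)
  then have "frechet_derivative (\<lambda>t. t *\<^sub>R p) (at x) = (\<lambda>h. h *\<^sub>R p)" for x :: real
    using frechet_derivative_at by metis
  then show ?thesis using d Ck_on_const unfolding Suc by (auto simp: differentiable_def)
qed (auto intro!: continuous_intros)

text \<open>Continuity of the velocity makes the fundamental theorem of calculus available for the Lebesgue
  integral.\<close>

lemma smooth_on_continuous_derivative:
  fixes f :: "real \<Rightarrow> 'b::real_normed_vector"
  assumes f: "smooth_on S f" and S: "\<And>t. t \<in> S \<Longrightarrow> t islimpt S"
  shows "continuous_on S (\<lambda>t. ddt S f t)"
  unfolding continuous_on_eq_continuous_within
proof
  fix t assume t: "t \<in> S"
  then obtain U g where U: "open U" "t \<in> U" "\<forall>k. Ck_on k U g" "\<forall>y\<in>S \<inter> U. f y = g y"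
    using f unfolding smooth_on_def by blast
  have C1: "Ck_on (Suc 0) U g" using U(3) by blast
  have eq: "ddt S f s = frechet_derivative g (at s) 1" if s: "s \<in> S \<inter> U" for s
  proof -
    have diff: "g differentiable (at s)" using C1 s by simp
    then have "(g has_derivative frechet_derivative g (at s)) (at s)"
      by (rule frechet_derivative_works[THEN iffD1])
    then have "(g has_derivative frechet_derivative g (at s)) (at s within (S \<inter> U))"
      by (rule has_derivative_at_withinI)
    then have "(f has_derivative frechet_derivative g (at s)) (at s within (S \<inter> U))"
      by (rule has_derivative_transform[rotated 2]) (use U s in auto)
    moreover have "at s within (S \<inter> U) = at s within S"
      by (rule at_within_openin) (use U s in auto)
    moreover have "frechet_derivative g (at s) = (\<lambda>x. x *\<^sub>R frechet_derivative g (at s) 1)"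
    proof
      fix x show "frechet_derivative g (at s) x = x *\<^sub>R frechet_derivative g (at s) 1"
        using linear_scale[OF linear_frechet_derivative[OF diff], of x 1] by simp
    qed
    ultimately have "(f has_vector_derivative frechet_derivative g (at s) 1) (at s within S)"
      unfolding has_vector_derivative_def by metis
    moreover have "at s within S \<noteq> bot" using S s trivial_limit_within by blast
    ultimately show ?thesis by (rule vector_derivative_within[rotated])
  qed
  have "continuous_on (S \<inter> U) (\<lambda>s. frechet_derivative g (at s) 1)"
    using C1 by (auto intro: continuous_on_subset)
  then have "continuous_on (S \<inter> U) (\<lambda>s. ddt S f s)" by (rule continuous_on_eq) (simp add: eq)
  then have "continuous (at t within (S \<inter> U)) (\<lambda>s. ddt S f s)"
    using t U by (simp add: continuous_on_eq_continuous_within)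
  moreover have "at t within (S \<inter> U) = at t within S"
    by (rule at_within_openin) (use U t in auto)
  ultimately show "continuous (at t within S) (\<lambda>s. ddt S f s)" by simp
qed

abbreviation unit_curve_atlas :: "(real, real) chart set" where
  "unit_curve_atlas \<equiv> {({0..1}, \<lambda>t. t)}"

lemma smooth_curve_in_ball:
  fixes \<gamma> :: "real \<Rightarrow> 'b::euclidean_space"
  shows "smooth_map unit_curve_atlas (ball_atlas r0) \<gamma> \<longleftrightarrow>
     \<gamma> ` {0..1} \<subseteq> ball 0 r0 \<and> smooth_on {0..1} \<gamma>"
proof -
  have inv: "inv_into {0..1} (\<lambda>t. t) t = t" if "t \<in> {0..1}" for t :: real
    using that by (simp add: inv_into_f_eq)
  have c: "carrier unit_curve_atlas = {0..1}" by (simp add: carrier_def)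
  have cB: "carrier (ball_atlas r0 :: ('b, 'b) chart set) = ball 0 r0"
    by (rule atlas_carrier[OF diff_atlas_ball])
  have sm: "smooth_on {0..1} ((\<lambda>x. x) \<circ> \<gamma> \<circ> inv_into {0..1} (\<lambda>t. t)) \<longleftrightarrow> smooth_on {0..1} \<gamma>"
    unfolding smooth_on_def using inv by simp
  have cont: "continuous_on {0..1} \<gamma>" if "smooth_on {0..1} \<gamma>"
    using smooth_on_differentiable[OF that] differentiable_imp_continuous_within
    unfolding continuous_on_eq_continuous_within by blast
  have im: "(\<lambda>t. t) ` ({0..1} \<inter> \<gamma> -` ball 0 r0) = {0..1}" if "\<gamma> ` {0..1} \<subseteq> ball 0 r0"
    using that by auto
  show ?thesis
    unfolding smooth_map_def c cB using sm cont im by (auto simp: ball_atlas_def)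
qed

lemma curve_length_ball:
  fixes \<gamma> :: "real \<Rightarrow> 'b::euclidean_space"
  assumes "\<gamma> ` {0..1} \<subseteq> ball 0 r0"
  shows "curve_length (ball_atlas r0) (polar_metric r0 h) \<gamma> = (\<integral>\<^sup>+t\<in>{0..1}.
     ennreal (sqrt (polar_form h (\<gamma> t) (ddt {0..1} \<gamma> t) (ddt {0..1} \<gamma> t))) \<partial>lborel)"
  unfolding curve_length_def
proof (rule nn_integral_cong)
  fix t :: real
  show "ennreal (sqrt (polar_metric r0 h (\<gamma> t) (velocity (ball_atlas r0) {0..1} \<gamma> t) (velocity (ball_atlas r0) {0..1} \<gamma> t))) * indicator {0..1} t
    = ennreal (sqrt (polar_form h (\<gamma> t) (ddt {0..1} \<gamma> t) (ddt {0..1} \<gamma> t))) * indicator {0..1} t"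
  proof (cases "t \<in> {0..1}")
    case True
    then have g: "\<gamma> t \<in> ball 0 r0" using assms by blast
    show ?thesis unfolding polar_metric_eq[OF g] by (simp add: velocity_def charts_at_ball[OF g] o_def)
  qed simp
qed

text \<open>The norm is differentiable only away from the centre.  For \<open>0 < e < norm (\<gamma> 1)\<close> let \<open>b\<close> be the last
  time at which the curve has norm \<open>e\<close>; after \<open>b\<close> it stays away from the centre, and its length there is
  at least \<open>norm (\<gamma> 1) - e\<close>.\<close>

lemma radius_le_curve_length:
  fixes \<gamma> :: "real \<Rightarrow> 'b::euclidean_space"
  assumes sm: "smooth_on {0..1} \<gamma>" and \<gamma>: "\<gamma> ` {0..1} \<subseteq> ball 0 r0" "\<gamma> 0 = 0"
  shows "ennreal (norm (\<gamma> 1)) \<le> curve_length (ball_atlas r0) (polar_metric r0 h) \<gamma>"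
    (is "_ \<le> ?L")
proof (rule ennreal_le_epsilon)
  fix e :: real assume e: "0 < e"
  let ?g' = "\<lambda>t. ddt {0..1} \<gamma> t" and ?\<phi> = "\<lambda>t. norm (\<gamma> t)"
  have lp: "t islimpt {0..1}" if "t \<in> {0..1}" for t :: real
    using that by (simp add: islimpt_Icc)
  have g': "(\<gamma> has_vector_derivative ?g' t) (at t within {0..1})" if "t \<in> {0..1}" for t
    using smooth_on_differentiable[OF sm that] vector_derivative_works by blast
  have cg: "continuous_on {0..1} \<gamma>"
    using smooth_on_differentiable[OF sm] differentiable_imp_continuous_within
    unfolding continuous_on_eq_continuous_within by blast
  have c\<phi>: "continuous_on {0..1} ?\<phi>" by (intro continuous_intros cg)
  show "ennreal (norm (\<gamma> 1)) \<le> ?L + ennreal e"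
  proof (cases "norm (\<gamma> 1) \<le> e")
    case True
    then have "ennreal (norm (\<gamma> 1)) \<le> ennreal e" by (simp add: ennreal_leI)
    then show ?thesis by (simp add: add_increasing)
  next
    case False
    define Z where "Z = {t \<in> {0..1}. ?\<phi> t = e}"
    have "\<exists>t. 0 \<le> t \<and> t \<le> 1 \<and> ?\<phi> t = e"
      by (rule IVT') (use \<gamma>(2) e False c\<phi> in auto)
    then have Z: "Z \<noteq> {}" unfolding Z_def by auto
    have "closed Z" unfolding Z_def
      using continuous_closed_preimage_constant[OF c\<phi>] by auto
    then have "compact Z" unfolding Z_def
      by (metis (no_types, lifting) bounded_subset bounded_closed_interval compact_eq_bounded_closed mem_Collect_eq subsetI)
    then obtain b where b: "b \<in> Z" "\<And>t. t \<in> Z \<Longrightarrow> t \<le> b" using compact_attains_sup[OF _ Z] by blast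
    have b01: "0 \<le> b" "b \<le> 1" "?\<phi> b = e" using b(1) unfolding Z_def by auto
    have big: "?\<phi> t \<ge> e" if t: "b \<le> t" "t \<le> 1" for t
    proof (rule ccontr)
      assume "\<not> ?\<phi> t \<ge> e"
      then have "\<exists>s. t \<le> s \<and> s \<le> 1 \<and> ?\<phi> s = e"
        by (intro IVT') (use False t b01 in \<open>auto intro: continuous_on_subset[OF c\<phi>]\<close>)
      then obtain s where s: "t \<le> s" "s \<le> 1" "?\<phi> s = e" by blast
      then have "s \<in> Z" using b01 t unfolding Z_def by auto
      then have "s = b" using b(2) s t by force
      then show False using s t b01 \<open>\<not> ?\<phi> t \<ge> e\<close> by simp
    qed
    then have nz: "\<gamma> t \<noteq> 0" if "b \<le> t" "t \<le> 1" for t using e that by fastforce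
    define f where "f t = sgn (\<gamma> t) \<bullet> ?g' t" for t
    have sub: "{b..1} \<subseteq> {0..1}" using b01 by auto
    have df: "(?\<phi> has_vector_derivative f t) (at t within {b..1})" if t: "b \<le> t" "t \<le> 1" for t
    proof -
      have "(\<gamma> has_derivative (\<lambda>x. x *\<^sub>R ?g' t)) (at t within {b..1})"
        using g'[of t] t b01 has_derivative_subset[OF _ sub] unfolding has_vector_derivative_def by auto
      from has_derivative_compose[OF this has_derivative_norm[OF nz[OF t]]]
      show ?thesis unfolding has_vector_derivative_def f_def by (simp add: inner_commute)
    qed
    have cf: "continuous_on {b..1} f"
    proof -
      have "continuous_on {b..1} ?g'"
        by (rule continuous_on_subset[OF smooth_on_continuous_derivative[OF sm lp] sub])
      moreover have "continuous_on {b..1} (\<lambda>t. sgn (\<gamma> t))"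
        by (intro continuous_on_sgn continuous_on_subset[OF cg sub]) (use nz in auto)
      ultimately show ?thesis unfolding f_def by (intro continuous_on_inner)
    qed
    have bi: "has_bochner_integral lborel (\<lambda>t. indicator {b..1} t *\<^sub>R f t) (?\<phi> 1 - ?\<phi> b)"
      by (rule has_bochner_integral_FTC_Icc[OF b01(2) df cf])
    have abs: "integrable lborel (\<lambda>t. \<bar>indicator {b..1} t *\<^sub>R f t\<bar>)"
      using bi by (intro integrable_abs) (auto simp: has_bochner_integral_iff)
    have "ennreal (norm (\<gamma> 1) - e) \<le> ennreal (\<integral>t. \<bar>indicator {b..1} t *\<^sub>R f t\<bar> \<partial>lborel)"
      using bi b01(3) integral_abs_bound[of lborel "\<lambda>t. indicator {b..1} t *\<^sub>R f t"]
      by (intro ennreal_leI) (auto simp: has_bochner_integral_iff)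
    also have "\<dots> = (\<integral>\<^sup>+t. ennreal \<bar>indicator {b..1} t *\<^sub>R f t\<bar> \<partial>lborel)"
      by (rule nn_integral_eq_integral[symmetric, OF abs]) simp
    also have "\<dots> \<le> ?L"
      unfolding curve_length_ball[OF \<gamma>(1)]
    proof (rule nn_integral_mono)
      fix t :: real
      have "\<bar>f t\<bar> \<le> sqrt (polar_form h (\<gamma> t) (?g' t) (?g' t))"
        unfolding f_def by (rule real_le_rsqrt) (simp add: polar_form_ge)
      then show "ennreal \<bar>indicator {b..1} t *\<^sub>R f t\<bar>
         \<le> ennreal (sqrt (polar_form h (\<gamma> t) (?g' t) (?g' t))) * indicator {0..1} t"
        using sub by (auto simp: indicator_def ennreal_leI)
    qed
    finally have "ennreal (norm (\<gamma> 1) - e) \<le> ?L" .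
    then have "ennreal (norm (\<gamma> 1) - e) + ennreal e \<le> ?L + ennreal e" by (rule add_right_mono)
    then show ?thesis using False e by (simp flip: ennreal_plus)
  qed
qed

lemma riem_dist_ball:
  fixes p :: "'b::euclidean_space"
  assumes p: "p \<in> ball 0 r0"
  shows "riem_dist (ball_atlas r0) (polar_metric r0 h) 0 p = norm p"
proof -
  let ?C = "{\<gamma>. smooth_map unit_curve_atlas (ball_atlas r0) \<gamma> \<and> \<gamma> 0 = 0 \<and> \<gamma> 1 = p}"
  let ?L = "curve_length (ball_atlas r0) (polar_metric r0 h)"
  let ?\<sigma> = "\<lambda>t :: real. t *\<^sub>R p"
  have im: "?\<sigma> ` {0..1} \<subseteq> ball 0 r0"
  proof
    fix z assume "z \<in> ?\<sigma> ` {0..1}"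
    then obtain t where t: "0 \<le> t" "t \<le> 1" "z = t *\<^sub>R p" by auto
    then have "norm z \<le> 1 * norm p" unfolding t(3) norm_scaleR by (intro mult_right_mono) auto
    then show "z \<in> ball 0 r0" using p by simp
  qed
  have "smooth_on {0..1} ?\<sigma>" unfolding smooth_on_def
    using Ck_on_line by (intro ballI exI[of _ UNIV] exI[of _ ?\<sigma>]) auto
  then have mem: "?\<sigma> \<in> ?C" using im smooth_curve_in_ball by auto
  have vel: "ddt {0..1} ?\<sigma> t = p" if t: "t \<in> {0..1}" for t :: real
  proof (rule vector_derivative_within)
    show "at t within {0..1} \<noteq> bot" using t islimpt_Icc trivial_limit_within by (metis atLeastAtMost_iff zero_less_one)
    show "(?\<sigma> has_vector_derivative p) (at t within {0..1})"
      unfolding has_vector_derivative_def by (auto intro!: derivative_eq_intros)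
  qed
  have "?L ?\<sigma> = (\<integral>\<^sup>+t. ennreal (norm p) * indicator {0..1::real} t \<partial>lborel)"
    unfolding curve_length_ball[OF im]
  proof (rule nn_integral_cong)
    fix t :: real
    show "ennreal (sqrt (polar_form h (t *\<^sub>R p) (ddt {0..1} ?\<sigma> t) (ddt {0..1} ?\<sigma> t))) * indicator {0..1} t
      = ennreal (norm p) * indicator {0..1} t"
    proof (cases "t \<in> {0..1}")
      case True
      have "sqrt (polar_form h (t *\<^sub>R p) p p) = norm p"
      proof (cases "t *\<^sub>R p = 0")
        case False
        then have "t > 0" using True by (cases "t = 0") auto
        then have "sgn (t *\<^sub>R p) = p /\<^sub>R norm p" by (simp add: sgn_div_norm)
        then have "sgn (t *\<^sub>R p) \<bullet> p = norm p"
          using False by (simp add: power2_norm_eq_inner[symmetric] power2_eq_square)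
        then show ?thesis using False by (simp add: polar_form_def power2_norm_eq_inner[symmetric] power2_eq_square)
      qed (simp add: polar_form_def norm_eq_sqrt_inner)
      then show ?thesis using vel[OF True] by simp
    qed simp
  qed
  also have "\<dots> = ennreal (norm p)" by (simp add: nn_integral_cmult_indicator)
  finally have up: "?L ?\<sigma> = ennreal (norm p)" .
  have "(INF \<gamma>\<in>?C. ?L \<gamma>) = ennreal (norm p)"
  proof (rule antisym)
    show "(INF \<gamma>\<in>?C. ?L \<gamma>) \<le> ennreal (norm p)" using INF_lower[OF mem, of ?L] up by simp
    show "ennreal (norm p) \<le> (INF \<gamma>\<in>?C. ?L \<gamma>)"
      using radius_le_curve_length smooth_curve_in_ball by (intro INF_greatest) blast
  qed
  then show ?thesis unfolding riem_dist_def by simp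
qed


section \<open>Both ambient geometries\<close>

theorem mainTheorem4:
  fixes I :: "real set"
    and A :: "('s::{t2_space, second_countable_topology}, 'e::euclidean_space) chart set"
    and AF :: "('f::{t2_space, second_countable_topology}, 'e) chart set"
  assumes "proper_interval I"
    and "compact (UNIV :: 's set)"
    and "smooth_atlas half_space UNIV A"
    and "\<And>C. C \<in> components (UNIV :: 's set) \<Longrightarrow> C \<inter> bdry A \<noteq> {}"
    and dim: "DIM('b::euclidean_space) = DIM('e) + 1"
  shows
    "(\<forall>gF J h r \<Phi> \<nu> \<eta>.
        smooth_atlas UNIV UNIV AF \<and> riemannian_metric AF gF \<and>
        proper_interval J \<and> smooth_on J h \<and> (\<forall>t\<in>J. 0 < h t) \<and>
        smooth_on I r \<and> r ` I \<subseteq> J \<and>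
        minimal_family I A (cyl J AF) (warped_metric J AF h gF) \<Phi> \<nu> \<and>
        free_boundary I A (cyl J AF) (warped_metric J AF h gF) fst (warped_radial J AF) r \<Phi> \<eta>
        \<longrightarrow>
        (\<forall>a\<in>I. \<forall>x\<in>bdry A.
           dir_deriv A (normal_speed I (cyl J AF) (warped_metric J AF h gF) \<Phi> \<nu> a) x (\<eta> a x)
           - ddt J h (r a) / h (r a)
             * normal_speed I (cyl J AF) (warped_metric J AF h gF) \<Phi> \<nu> a x
           = ddt I r a
             * second_ff A (cyl J AF) (warped_metric J AF h gF)
                 (\<lambda>x. \<Phi> (a, x)) (\<lambda>x. \<nu> (a, x)) x (\<eta> a x) (\<eta> a x)))
     \<and>
     (\<forall>r0 h r (\<Phi> :: real \<times> 's \<Rightarrow> 'b) \<nu> \<eta>.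
        0 < r0 \<and> smooth_on {0<..<r0} h \<and> (\<forall>t\<in>{0<..<r0}. 0 < h t) \<and>
        (\<exists>H. smooth_on {-r0<..<r0} H \<and> (\<forall>t\<in>{-r0<..<r0}. H (- t) = - H t) \<and>
             (\<forall>t\<in>{0<..<r0}. H t = h t) \<and> (H has_real_derivative 1) (at 0)) \<and>
        smooth_on I r \<and> r ` I \<subseteq> {0<..<r0} \<and>
        minimal_family I A (ball_atlas r0) (polar_metric r0 h) \<Phi> \<nu> \<and>
        free_boundary I A (ball_atlas r0) (polar_metric r0 h)
          (riem_dist (ball_atlas r0) (polar_metric r0 h) 0) (polar_radial r0) r \<Phi> \<eta>
        \<longrightarrow>
        (\<forall>a\<in>I. \<forall>x\<in>bdry A.
           dir_deriv A (normal_speed I (ball_atlas r0) (polar_metric r0 h) \<Phi> \<nu> a) x (\<eta> a x)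
           - ddt {0<..<r0} h (r a) / h (r a)
             * normal_speed I (ball_atlas r0) (polar_metric r0 h) \<Phi> \<nu> a x
           = ddt I r a
             * second_ff A (ball_atlas r0) (polar_metric r0 h)
                 (\<lambda>x. \<Phi> (a, x)) (\<lambda>x. \<nu> (a, x)) x (\<eta> a x) (\<eta> a x)))"
proof (intro conjI allI impI ballI, goal_cases)
  case (1 gF J h r \<Phi> \<nu> \<eta> a x)
  then show ?case
    by (intro free_boundary_variation_warped[OF assms(1,3)]) auto
next
  case (2 r0 h r \<Phi> \<nu> \<eta> a x)
  then show ?case
    by (intro free_boundary_variation_polar[OF dim assms(1,3), where \<rho> = "riem_dist (ball_atlas r0) (polar_metric r0 h) 0"]
        riem_dist_ball) auto
qed

end
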